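(* Let $\alpha>0$ and let $X=\{X_t\}_{t\in T}$ be an $\alpha$-Fréchet process satisfying Condition S. Then $X$ has a minimal spectral representation $\{f_t\}_{t\in T}\subset L_+^\alpha(S_{I,N},\lambda_{I,N})$ with standardized support $(S_{I,N},\lambda_{I,N})$, for some $I\in\{0,1\}$ and $N\in\{0,1,2,\dots\}\cup\{\infty\}$; that is, $$\{X_t\}_{t\in T}\stackrel{d}{=}\Big\{\int^{e}_{S_{I,N}}f_t(s)\,M_\alpha(ds)\Big\}_{t\in T},$$ where $M_\alpha$ is an $\alpha$-Fréchet random sup-measure with control measure $\lambda_{I,N}$.
   Context: A random variable $Z$ is $\alpha$-Fréchet with scale $\sigma>0$ if $P(Z\le x)=\exp(-\sigma^\alpha x^{-\alpha})$, $x>0$. A process $\{X_t\}_{t\in T}$ is an $\alpha$-Fréchet process if every max-linear combination $\max_{1\le j\le n}a_jX_{t_j}$ ($a_j>0$, $t_j\in T$) is an $\alpha$-Fréchet random variable. Condition S: there is a countable $T_0\subset T$ such that for every $t\in T$ there is a sequence $t_n\in T_0$ with $X_{t_n}\to X_t$ in probability. $L_+^\alpha(S,\mu)$ is the set of measurable $f:S\to[0,\infty)$ with $\int_Sf^\alpha d\mu<\infty$, with metric $\rho_{\mu,\alpha}(f,g)=\int_S|f^\alpha-g^\alpha|d\mu$. An $\alpha$-Fréchet random sup-measure $M_\alpha$ with control measure $\mu$ is a process indexed by measurable sets, independent over disjoint sets, $\sigma$-sup-additive over disjoint sets (a.s.), with $M_\alpha(A)$ $\alpha$-Fréchet of scale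 $\mu(A)^{1/\alpha}$. The extremal integral $\int^e_Sf\,dM_\alpha$ equals $\bigvee_i a_iM_\alpha(A_i)$ for $f=\sum_ia_i\mathbf 1_{A_i}$ ($A_i$ disjoint, $a_i\ge0$), extended to $f\in L_+^\alpha(S,\mu)$ by continuity in probability. $\{f_t\}_{t\in T}\subset L_+^\alpha(S,\mu)$ is a spectral representation of $X$ if $\{X_t\}\stackrel d=\{\int^e_Sf_t\,dM_\alpha\}$ in the sense of finite-dimensional distributions, equivalently $$P(X_{t_1}\le x_1,\dots,X_{t_n}\le x_n)=\exp\Big\{-\int_S\Big(\bigvee_{i=1}^n x_i^{-1}f_{t_i}\Big)^\alpha d\mu\Big\}$$ for all $n$, $t_i\in T$, $x_i>0$. $\mathrm{supp}\{f_t:t\in T\}$ is $\{f_0\neq0\}$ (mod $\mu$) for any function $f_0$ in the $\rho_{\mu,\alpha}$-closure of the set of max-linear combinations $\bigvee_{i\le n}a_if_{t_i}$ ($a_i>0$) such that $\mu(\{g\ne0\}\setminus\{f_0\neq0\})=0$ for all $g$ in that closure. $\rho(\{f_t\})$ is the $\sigma$-field generated by all ratios $f_t/f_{t'}$, $t,t'\in T$, with values in $[0,\infty]$ (and $0/0:=0$). The representation is minimal if (i) $\mathrm{supp}\{f_t:t\in T\}=S$ $\mu$-a.e., and (ii) for every measurable $B\subset S$ there is $A\in\rho(\{f_t:t\in T\})$ with $\mu(A\Delta B)=0$. A minimal representation has standardized support if, up to null sets, $(S,\mu)=(S_{I,N},\lambda_{I,N})$, where $S_{I,N}\subset(0,1)\cup\mathbb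 N$; $S_{I,N}\cap(0,1)$ is $\emptyset$ if $I=0$ and $(0,1)$ if $I=1$; $S_{I,N}\cap\mathbb N$ is $\emptyset$ if $N=0$, $\{1,\dots,N\}$ if $N\in\mathbb N$, and $\mathbb N$ if $N=\infty$; and $\lambda_{I,N}$ is Lebesgue measure on $S_{I,N}\cap(0,1)$ and counting measure on $S_{I,N}\cap\mathbb N$. *)

theory Defs
  imports "HOL-Probability.Probability"
begin

section \<open>Frechet random variables and processes\<close>

text \<open>The \<open>\<alpha>\<close>-Frechet distribution function on \<open>x > 0\<close>; for \<open>\<sigma> = 0\<close> it is that of the constant \<open>0\<close>.\<close>

definition frechet_cdf :: "real \<Rightarrow> real \<Rightarrow> real \<Rightarrow> real" where
  "frechet_cdf \<alpha> \<sigma> x = exp (- (\<sigma> powr \<alpha>) * x powr (- \<alpha>))"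

definition frechet_rv :: "'w measure \<Rightarrow> real \<Rightarrow> real \<Rightarrow> ('w \<Rightarrow> real) \<Rightarrow> bool" where
  "frechet_rv P \<alpha> \<sigma> Z \<longleftrightarrow> \<sigma> > 0 \<and> Z \<in> borel_measurable P \<and>
     (\<forall>x>0. \<P>(w in P. Z w \<le> x) = frechet_cdf \<alpha> \<sigma> x)"

text \<open>A max-linear combination is given by a finite nonempty set of distinct indices; a repeated index
  can be merged by keeping its largest coefficient.\<close>

definition frechet_process :: "'w measure \<Rightarrow> real \<Rightarrow> 't set \<Rightarrow> ('t \<Rightarrow> 'w \<Rightarrow> real) \<Rightarrow> bool" where
  "frechet_process P \<alpha> T X \<longleftrightarrow> prob_space P \<and>
     (\<forall>F a. finite F \<and> F \<noteq> {} \<and> F \<subseteq> T \<and> (\<forall>t\<in>F. a t > 0) \<longrightarrow>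
        (\<exists>\<sigma>. frechet_rv P \<alpha> \<sigma> (\<lambda>w. MAX t\<in>F. a t * X t w)))"

definition tendsto_in_prob :: "'w measure \<Rightarrow> (nat \<Rightarrow> 'w \<Rightarrow> real) \<Rightarrow> ('w \<Rightarrow> real) \<Rightarrow> bool" where
  "tendsto_in_prob P Y Z \<longleftrightarrow> (\<forall>\<epsilon>>0. (\<lambda>n. \<P>(w in P. \<bar>Y n w - Z w\<bar> > \<epsilon>)) \<longlonglongrightarrow> 0)"

definition condition_S :: "'w measure \<Rightarrow> 't set \<Rightarrow> ('t \<Rightarrow> 'w \<Rightarrow> real) \<Rightarrow> bool" where
  "condition_S P T X \<longleftrightarrow> (\<exists>T0\<subseteq>T. countable T0 \<and>
     (\<forall>t\<in>T. \<exists>u::nat \<Rightarrow> 't. (\<forall>n. u n \<in> T0) \<and> tendsto_in_prob P (\<lambda>n. X (u n)) (X t)))"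

definition same_fdd ::
  "'t set \<Rightarrow> 'w measure \<Rightarrow> ('t \<Rightarrow> 'w \<Rightarrow> real) \<Rightarrow> 'v measure \<Rightarrow> ('t \<Rightarrow> 'v \<Rightarrow> real) \<Rightarrow> bool" where
  "same_fdd T P X Q Y \<longleftrightarrow> (\<forall>F. finite F \<and> F \<subseteq> T \<longrightarrow>
     distr P (PiM F (\<lambda>_. borel)) (\<lambda>w. \<lambda>t\<in>F. X t w) =
     distr Q (PiM F (\<lambda>_. borel)) (\<lambda>w. \<lambda>t\<in>F. Y t w))"

section \<open>Random sup-measures and extremal integrals\<close>

definition Lplus :: "real \<Rightarrow> 's measure \<Rightarrow> ('s \<Rightarrow> real) set" where
  "Lplus \<alpha> \<mu> = {f \<in> borel_measurable \<mu>. (\<forall>s\<in>space \<mu>. 0 \<le> f s) \<and>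
     integrable \<mu> (\<lambda>s. f s powr \<alpha>)}"

definition rho :: "real \<Rightarrow> 's measure \<Rightarrow> ('s \<Rightarrow> real) \<Rightarrow> ('s \<Rightarrow> real) \<Rightarrow> real" where
  "rho \<alpha> \<mu> f g = (LINT s|\<mu>. \<bar>f s powr \<alpha> - g s powr \<alpha>\<bar>)"

text \<open>The index set is the whole \<open>\<sigma>\<close>-algebra of \<open>\<mu>\<close>. An \<open>\<alpha>\<close>-Frechet variable with infinite scale
  is read as the constant \<open>\<infinity>\<close>, which is why \<open>M\<close> takes values in \<open>[0,\<infinity>]\<close>.\<close>

definition frechet_sup_measure ::
  "real \<Rightarrow> 's measure \<Rightarrow> 'v measure \<Rightarrow> ('s set \<Rightarrow> 'v \<Rightarrow> ennreal) \<Rightarrow> bool" where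
  "frechet_sup_measure \<alpha> \<mu> Q M \<longleftrightarrow> prob_space Q \<and>
     (\<forall>A\<in>sets \<mu>. M A \<in> borel_measurable Q) \<and>
     (\<forall>A::nat \<Rightarrow> 's set. range A \<subseteq> sets \<mu> \<and> disjoint_family A \<longrightarrow>
        prob_space.indep_vars Q (\<lambda>_. borel) (\<lambda>i. M (A i)) UNIV) \<and>
     (\<forall>A::nat \<Rightarrow> 's set. range A \<subseteq> sets \<mu> \<and> disjoint_family A \<longrightarrow>
        (AE w in Q. M (\<Union>i. A i) w = (SUP i. M (A i) w))) \<and>
     (\<forall>A\<in>sets \<mu>. emeasure \<mu> A < \<infinity> \<longrightarrow>
        (\<forall>x>0. \<P>(w in Q. M A w \<le> ennreal x) = frechet_cdf \<alpha> (measure \<mu> A powr (1 / \<alpha>)) x)) \<and>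
     (\<forall>A\<in>sets \<mu>. emeasure \<mu> A = \<infinity> \<longrightarrow> (AE w in Q. M A w = \<infinity>))"

text \<open>For a simple function the level sets serve as the disjoint decomposition; by sup-additivity
  every other one gives the same value almost surely. For simple \<open>g\<close> in \<open>Lplus \<alpha> \<mu>\<close> the
  supremum is almost surely finite (\<open>0 * \<infinity> = 0\<close> takes care of the level \<open>0\<close>).\<close>

definition simple_extremal_integral ::
  "'s measure \<Rightarrow> ('s set \<Rightarrow> 'v \<Rightarrow> ennreal) \<Rightarrow> ('s \<Rightarrow> real) \<Rightarrow> 'v \<Rightarrow> real" where
  "simple_extremal_integral \<mu> M g w =
     enn2real (SUP a\<in>g ` space \<mu>. ennreal a * M {s\<in>space \<mu>. g s = a} w)"

text \<open>The extremal integral is determined only up to almost sure equality, so it is a relation: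
  \<open>Y\<close> is the value at \<open>f\<close> of the extension by continuity in probability from the (\<open>rho\<close>-dense)
  simple functions.\<close>

definition has_extremal_integral ::
  "real \<Rightarrow> 's measure \<Rightarrow> 'v measure \<Rightarrow> ('s set \<Rightarrow> 'v \<Rightarrow> ennreal) \<Rightarrow> ('s \<Rightarrow> real) \<Rightarrow> ('v \<Rightarrow> real) \<Rightarrow> bool" where
  "has_extremal_integral \<alpha> \<mu> Q M f Y \<longleftrightarrow> f \<in> Lplus \<alpha> \<mu> \<and> Y \<in> borel_measurable Q \<and>
     (\<forall>g::nat \<Rightarrow> 's \<Rightarrow> real.
        (\<forall>n. simple_function \<mu> (g n) \<and> g n \<in> Lplus \<alpha> \<mu>) \<and> (\<lambda>n. rho \<alpha> \<mu> (g n) f) \<longlonglongrightarrow> 0 \<longrightarrow>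
        tendsto_in_prob Q (\<lambda>n. simple_extremal_integral \<mu> M (g n)) Y)"

text \<open>\<open>f\<close> is a spectral representation of \<open>X\<close> by means of the random sup-measure \<open>M\<close> on \<open>Q\<close>.\<close>

definition spectral_representation ::
  "real \<Rightarrow> 's measure \<Rightarrow> 't set \<Rightarrow> ('t \<Rightarrow> 's \<Rightarrow> real) \<Rightarrow>
   'v measure \<Rightarrow> ('s set \<Rightarrow> 'v \<Rightarrow> ennreal) \<Rightarrow> 'w measure \<Rightarrow> ('t \<Rightarrow> 'w \<Rightarrow> real) \<Rightarrow> bool" where
  "spectral_representation \<alpha> \<mu> T f Q M P X \<longleftrightarrow>
     (\<forall>t\<in>T. f t \<in> Lplus \<alpha> \<mu>) \<and> frechet_sup_measure \<alpha> \<mu> Q M \<and>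
     (\<exists>Y. (\<forall>t\<in>T. has_extremal_integral \<alpha> \<mu> Q M (f t) (Y t)) \<and> same_fdd T P X Q Y)"

section \<open>Minimality\<close>

text \<open>The maximum over the empty set is \<open>0\<close>. As \<open>f t \<ge> 0\<close>, the inserted \<open>0\<close> matters only for \<open>F = {}\<close>,
  and the zero function is in the closure anyway as soon as \<open>T \<noteq> {}\<close> (let a coefficient tend to \<open>0\<close>).\<close>

definition max_linear :: "'t set \<Rightarrow> ('t \<Rightarrow> 's \<Rightarrow> real) \<Rightarrow> ('s \<Rightarrow> real) set" where
  "max_linear T f = {(\<lambda>s. Max (insert 0 ((\<lambda>t. a t * f t s) ` F))) | a F.
     finite F \<and> F \<subseteq> T \<and> (\<forall>t\<in>F. a t > 0)}"

definition max_linear_closure ::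
  "real \<Rightarrow> 's measure \<Rightarrow> 't set \<Rightarrow> ('t \<Rightarrow> 's \<Rightarrow> real) \<Rightarrow> ('s \<Rightarrow> real) set" where
  "max_linear_closure \<alpha> \<mu> T f =
     {g \<in> Lplus \<alpha> \<mu>. \<forall>\<epsilon>>0. \<exists>h\<in>max_linear T f. rho \<alpha> \<mu> h g < \<epsilon>}"

text \<open>The support is unique only modulo \<open>\<mu>\<close>: \<open>A\<close> is one of its versions.\<close>

definition is_supp :: "real \<Rightarrow> 's measure \<Rightarrow> 't set \<Rightarrow> ('t \<Rightarrow> 's \<Rightarrow> real) \<Rightarrow> 's set \<Rightarrow> bool" where
  "is_supp \<alpha> \<mu> T f A \<longleftrightarrow> (\<exists>f0\<in>max_linear_closure \<alpha> \<mu> T f. A = {s\<in>space \<mu>. f0 s \<noteq> 0} \<and>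
     (\<forall>g\<in>max_linear_closure \<alpha> \<mu> T f. emeasure \<mu> ({s\<in>space \<mu>. g s \<noteq> 0} - {s\<in>space \<mu>. f0 s \<noteq> 0}) = 0))"

text \<open>Division in \<open>ennreal\<close> satisfies \<open>0 / 0 = 0\<close> and \<open>x / 0 = \<infinity>\<close> for \<open>x > 0\<close>.\<close>

lemma "ennreal 0 / ennreal 0 = 0" and "x > 0 \<Longrightarrow> ennreal x / ennreal 0 = \<infinity>"
  by (simp_all add: divide_ennreal_def ennreal_mult_top)

definition ratio_sigma :: "'s measure \<Rightarrow> 't set \<Rightarrow> ('t \<Rightarrow> 's \<Rightarrow> real) \<Rightarrow> 's set set" where
  "ratio_sigma \<mu> T f = sigma_sets (space \<mu>)
     {(\<lambda>s. ennreal (f t s) / ennreal (f t' s)) -` B \<inter> space \<mu> | t t' B.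
        t \<in> T \<and> t' \<in> T \<and> B \<in> sets (borel :: ennreal measure)}"

definition minimal :: "real \<Rightarrow> 's measure \<Rightarrow> 't set \<Rightarrow> ('t \<Rightarrow> 's \<Rightarrow> real) \<Rightarrow> bool" where
  "minimal \<alpha> \<mu> T f \<longleftrightarrow>
     (\<exists>A. is_supp \<alpha> \<mu> T f A \<and> emeasure \<mu> (space \<mu> - A) = 0) \<and>
     (\<forall>B\<in>sets \<mu>. \<exists>A\<in>ratio_sigma \<mu> T f. emeasure \<mu> ((A - B) \<union> (B - A)) = 0)"

section \<open>Standardized support\<close>

definition std_set :: "nat \<Rightarrow> enat \<Rightarrow> real set" where
  "std_set I N = (if I = 1 then {0<..<1} else {}) \<union> real ` {k. 1 \<le> k \<and> enat k \<le> N}"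

definition std_measure :: "nat \<Rightarrow> enat \<Rightarrow> real measure" where
  "std_measure I N = measure_of (std_set I N) (sets (restrict_space borel (std_set I N)))
     (\<lambda>A. emeasure lborel (A \<inter> {0<..<1}) + emeasure (count_space UNIV) (A \<inter> \<nat>))"

lemma std_set_borel [measurable]: "std_set I N \<in> sets borel"
proof -
  have "real ` {k. 1 \<le> k \<and> enat k \<le> N} \<in> sets borel"
    by (rule sets.countable) auto
  thus ?thesis by (auto simp: std_set_def)
qed

lemma space_std_measure [simp]: "space (std_measure I N) = std_set I N"
  unfolding std_measure_def using sets.space_closed[of "restrict_space borel (std_set I N)"]
  by (simp add: space_measure_of space_restrict_space)

lemma sets_std_measure [simp]: "sets (std_measure I N) = sets (restrict_space borel (std_set I N))"
  using sets.sigma_sets_eq[of "restrict_space borel (std_set I N)"]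
    sets.space_closed[of "restrict_space borel (std_set I N)"]
  unfolding std_measure_def by (simp add: sets_measure_of space_restrict_space)

lemma emeasure_std_measure:
  assumes "A \<in> sets (std_measure I N)"
  shows "emeasure (std_measure I N) A =
    emeasure lborel (A \<inter> {0<..<1}) + emeasure (count_space UNIV) (A \<inter> \<nat>)"
proof (rule emeasure_measure_of[OF std_measure_def])
  let ?m = "\<lambda>A::real set. emeasure lborel (A \<inter> {0<..<1}) + emeasure (count_space UNIV) (A \<inter> \<nat>)"
  show "sets (restrict_space borel (std_set I N)) \<subseteq> Pow (std_set I N)"
    by (auto simp: sets_restrict_space)
  show "A \<in> sets (std_measure I N)" by fact
  show "positive (sets (std_measure I N)) ?m" by (simp add: positive_def)
  show "countably_additive (sets (std_measure I N)) ?m"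
  proof (rule countably_additiveI)
    fix B :: "nat \<Rightarrow> real set"
    assume B: "range B \<subseteq> sets (std_measure I N)" "disjoint_family B"
    have b: "B i \<in> sets borel" for i
    proof -
      have "B i \<in> sets (restrict_space borel (std_set I N))"
        using B(1) unfolding sets_std_measure by blast
      thus ?thesis by (simp add: sets_restrict_space_iff)
    qed
    have d: "disjoint_family (\<lambda>i. B i \<inter> C)" for C
      using B(2) by (auto simp: disjoint_family_on_def)
    have u: "(\<Union>i. B i \<inter> C) = (\<Union>i. B i) \<inter> C" for C
      by blast
    have "(\<Sum>i. ?m (B i)) = (\<Sum>i. emeasure lborel (B i \<inter> {0<..<1})) +
        (\<Sum>i. emeasure (count_space UNIV) (B i \<inter> \<nat>))"
      by (intro suminf_add[symmetric]) auto
    also have "(\<Sum>i. emeasure lborel (B i \<inter> {0<..<1})) = emeasure lborel (\<Union>i. B i \<inter> {0<..<1})"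
      using b by (intro suminf_emeasure d) auto
    also have "(\<Sum>i. emeasure (count_space UNIV) (B i \<inter> \<nat>)) = emeasure (count_space UNIV) (\<Union>i. B i \<inter> \<nat>)"
      by (intro suminf_emeasure d) auto
    finally show "(\<Sum>i. ?m (B i)) = ?m (\<Union>i. B i)" unfolding u .
  qed
qed

end

theory Submission
  imports Defs "HOL-Real_Asymp.Real_Asymp"
begin

text \<open>
The proof is elementary: it uses neither regular variation nor an exponent measure, only truncated
expectations, one compactness argument and the void probabilities of a Poisson process.

\<^emph>\<open>Finding a spectral measure.\<close> Raise the process to the power \<open>\<alpha>\<close>, so that every positive max-linear
combination \<open>h\<close> of \<open>Z t = (max 0 (X t)) powr \<alpha>\<close> has a distribution function \<open>exp (- v / y)\<close>. Then the
truncated expectation of \<open>h\<close> at \<open>R\<close> is \<open>v * ln R\<close> up to a bounded error (\<open>truncated_expectation_upper\<close>,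
\<open>truncated_expectation_lower\<close>): the constants \<open>v\<close>, which determine the law of \<open>X\<close>, are limits of
expressions that are linear in \<open>h\<close>. For a sequence \<open>Z 0, Z 1, ...\<close> let \<open>W\<close> be the maximum of
\<open>c n * Z n\<close> over \<open>n \<le> N\<close>, where the weights \<open>c\<close> decrease fast enough for the tail of \<open>W\<close> at \<open>y\<close> to be at most
\<open>1 / y\<close>. Truncating on the event \<open>W \<le> R\<close> instead of truncating \<open>h\<close> changes the expectation only by a bounded
amount, since \<open>h\<close> is at most a constant multiple of \<open>W\<close>. But on that event \<open>h\<close> is \<open>W\<close> times the same
max-linear combination of the ratios \<open>Z n / W\<close>. Hence \<open>v\<close> is a limit of integrals of one continuous function of
the ratios with respect to the finite measures of density \<open>W / ln R\<close> on \<open>W \<le> R\<close>. The ratios live in a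
compact cube, so the measures accumulate weakly at some \<open>m\<close>, and \<open>v\<close> becomes an integral with
respect to \<open>m\<close> (\<open>spectral_measure_exists\<close>). Helly's theorem on the line suffices for this, because the cube
is coded into the unit interval in such a way that each coordinate is a continuous function \<open>coord n\<close> of the code
(\<open>coord_encode\<close>, \<open>coord_continuous\<close>).

\<^emph>\<open>Minimality.\<close> Dividing all coordinates by their supremum and compensating by a density
(\<open>normalized_spectral_measure\<close>) one may assume that the supremum is 1. Then the coordinate \<open>n\<close> is the infimum
over \<open>k\<close> of its ratios to the coordinates \<open>k\<close> (\<open>INF_ratios_of_unit_supremum\<close>), and the point is the code of
its coordinates; so the ratios generate the whole Borel \<open>\<sigma>\<close>-algebra. The measure is carried to standardized form by
the quantile function of its diffuse part and an enumeration of its atoms, and the weight that this costs is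
absorbed in the spectral functions, where it cancels from all ratios (\<open>std_measure_standardizes\<close>,
\<open>standardized_spectral_functions\<close>). The support is full because the supremum of the suitably scaled spectral
functions is a positive function.

\<^emph>\<open>From a dense sequence to the whole process.\<close> If \<open>q s\<close> and \<open>q t\<close> are the \<open>\<alpha>\<close>-th powers of spectral functions, the
integral of their distance is \<open>2 * v s t - v s - v t\<close>, where \<open>v s t\<close> belongs to the maximum of the two variables. So
convergence in probability of the process makes the functions Cauchy in \<open>L\<^sup>1\<close>, and limits
represent the remaining variables (\<open>represents_cdfs_extend\<close>).

\<^emph>\<open>The random sup-measure.\<close> Take Poisson points \<open>(s, r)\<close> whose intensity is the control measure times Lebesgue measure
on \<open>r > 0\<close>. The supremum of \<open>r powr (- 1 / \<alpha>)\<close> over the points with \<open>s \<in> A\<close> is an \<open>\<alpha>\<close>-Frechet random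
sup-measure, and the supremum of \<open>g s * r powr (- 1 / \<alpha>)\<close> over all points is the extremal integral of \<open>g\<close>.
All distributions involved are probabilities that some region contains no point (locale \<open>frechet_points\<close>).
\<close>

section \<open>Maxima over finite index sets\<close>

lemma isCont_MAX:
  fixes f :: "'i \<Rightarrow> 'a::t2_space \<Rightarrow> real"
  assumes "finite F" "F \<noteq> {}" "\<And>i. i \<in> F \<Longrightarrow> isCont (f i) y"
  shows "isCont (\<lambda>y. MAX i\<in>F. f i y) y"
  using assms
proof (induction F rule: finite_ne_induct)
  case (insert i F)
  then have "(\<lambda>y. MAX j\<in>insert i F. f j y) = (\<lambda>y. max (f i y) (MAX j\<in>F. f j y))" by simp
  then show ?case using insert by (auto intro!: continuous_intros)
qed simp

lemma borel_measurable_MAX [measurable (raw)]: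
  fixes f :: "'i \<Rightarrow> 'a \<Rightarrow> real"
  assumes "finite F" "F \<noteq> {}" "\<And>i. i \<in> F \<Longrightarrow> f i \<in> borel_measurable M"
  shows "(\<lambda>w. MAX i\<in>F. f i w) \<in> borel_measurable M"
  using assms
proof (induction F rule: finite_ne_induct)
  case (insert i F)
  then have "(\<lambda>w. MAX j\<in>insert i F. f j w) = (\<lambda>w. max (f i w) (MAX j\<in>F. f j w))" by simp
  then show ?case using insert by (auto intro!: borel_measurable_max)
qed simp

lemma MAX_mult_left:
  fixes f :: "'i \<Rightarrow> real"
  assumes "finite F" "F \<noteq> {}" "0 \<le> c"
  shows "c * (MAX i\<in>F. f i) = (MAX i\<in>F. c * f i)"
  using assms by (induction F rule: finite_ne_induct) (auto simp: max_mult_distrib_left)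

lemma MAX_nonneg:
  fixes f :: "'i \<Rightarrow> real"
  assumes "finite F" "F \<noteq> {}" "\<And>i. i \<in> F \<Longrightarrow> 0 \<le> f i"
  shows "0 \<le> (MAX i\<in>F. f i)"
  using assms by (auto simp: Max_ge_iff)

lemma MAX_le_sum:
  fixes f :: "'i \<Rightarrow> real"
  assumes "finite F" "F \<noteq> {}" "\<And>i. i \<in> F \<Longrightarrow> 0 \<le> f i"
  shows "(MAX i\<in>F. f i) \<le> (\<Sum>i\<in>F. f i)"
  using assms by (auto intro!: member_le_sum)

section \<open>Coding sequences of numbers by points of the unit interval\<close>

text \<open>The \<open>i\<close>-th ternary digit of a point of the Cantor set, halved to 0 or 1. Reading the digit by a
clipped affine function extends it continuously to all reals; the removed middle thirds
provide the room for the transition from 0 to 1.\<close>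

fun cantor_digit :: "nat \<Rightarrow> real \<Rightarrow> real" where
  "cantor_digit 0 y = max 0 (min 1 (3 * y - 1))"
| "cantor_digit (Suc i) y = cantor_digit i (3 * y - 2 * cantor_digit 0 y)"

definition cantor_point :: "(nat \<Rightarrow> real) \<Rightarrow> real" where
  "cantor_point b = (\<Sum>i. 2 * b i / 3 ^ Suc i)"

text \<open>Digits of a binary expansion with remainders in the closed interval from 0 to 1, so that the number 1 is expanded as well
(all its digits are 1).\<close>

fun binary_digit :: "nat \<Rightarrow> real \<Rightarrow> real" where
  "binary_digit 0 x = (if x \<ge> 1/2 then 1 else 0)"
| "binary_digit (Suc k) x = binary_digit k (2 * x - binary_digit 0 x)"

text \<open>The binary digits of all members of the sequence are interleaved to form one point of the Cantor set.
Measurability is all that can be expected of \<open>encode\<close>; its one-sided inverse \<open>coord\<close> is continuous, and this is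
the direction that weak convergence needs.\<close>

definition encode :: "(nat \<Rightarrow> real) \<Rightarrow> real" where
  "encode x = cantor_point (\<lambda>i. case prod_decode i of (n, k) \<Rightarrow> binary_digit k (x n))"

definition coord :: "nat \<Rightarrow> real \<Rightarrow> real" where
  "coord n y = (\<Sum>k. cantor_digit (prod_encode (n, k)) y / 2 ^ Suc k)"

lemma cantor_digit_bounds: "0 \<le> cantor_digit i y" "cantor_digit i y \<le> 1"
  by (induction i arbitrary: y) auto

lemma cantor_digit_continuous: "isCont (cantor_digit i) y"
proof (induction i arbitrary: y)
  case 0
  then show ?case by (intro continuous_intros | simp)+
next
  case (Suc i)
  have "isCont (\<lambda>y. 3 * y - 2 * max 0 (min 1 (3 * y - 1)) :: real) y"
    by (intro continuous_intros)
  from isCont_o2[OF this Suc] show ?case by simp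
qed

lemma binary_digit_01: "binary_digit k x \<in> {0, 1}"
  by (induction k arbitrary: x) auto

lemma binary_digit_measurable [measurable]: "binary_digit k \<in> borel_measurable borel"
proof (induction k)
  case (Suc k)
  note [measurable] = Suc
  have "(\<lambda>x. binary_digit k (2 * x - (if x \<ge> 1/2 then 1 else 0))) \<in> borel_measurable borel"
    by measurable
  then show ?case by simp
qed simp

lemma sums_geometric_half: "(\<lambda>k. 1 / 2 ^ Suc k :: real) sums 1"
  using power_half_series by (simp add: power_divide)

lemma sums_geometric_third: "(\<lambda>k. 2 / 3 ^ Suc k :: real) sums 1"
proof -
  have "(\<lambda>k. (2/3) * (1/3) ^ k :: real) sums ((2/3) * (1 / (1 - 1/3)))"
    by (intro sums_mult geometric_sums) simp
  then show ?thesis by (simp add: power_divide)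
qed

text \<open>After \<open>K\<close> digits the error is the current remainder, which lies between 0 and 1, divided by \<open>2 ^ K\<close>.\<close>

lemma binary_expansion_sums:
  assumes "0 \<le> x" "x \<le> 1"
  shows "(\<lambda>k. binary_digit k x / 2 ^ Suc k) sums x"
proof -
  have *: "\<bar>x - (\<Sum>k<K. binary_digit k x / 2 ^ Suc k)\<bar> \<le> (1/2) ^ K" for K
    using assms
  proof (induction K arbitrary: x)
    case (Suc K)
    let ?x' = "2 * x - binary_digit 0 x"
    have "0 \<le> ?x'" "?x' \<le> 1" using Suc.prems by auto
    from Suc.IH[OF this]
    have IH: "\<bar>?x' - (\<Sum>k<K. binary_digit k ?x' / 2 ^ Suc k)\<bar> \<le> (1/2) ^ K" .
    have "x - (\<Sum>k<Suc K. binary_digit k x / 2 ^ Suc k)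
        = (?x' - (\<Sum>k<K. binary_digit k ?x' / 2 ^ Suc k)) / 2"
    proof -
      have "(\<Sum>k<K. binary_digit k ?x' / 2 ^ Suc (Suc k))
          = (\<Sum>k<K. binary_digit k ?x' / 2 ^ Suc k) / 2"
        unfolding sum_divide_distrib by (intro sum.cong) (auto simp: field_simps)
      then show ?thesis
        unfolding sum.lessThan_Suc_shift
        by (simp del: binary_digit.simps(1) power_Suc add: diff_divide_distrib)
    qed
    with IH show ?case by (simp only: abs_divide power_Suc) simp
  qed auto
  have "(\<lambda>K. (1/2::real) ^ K) \<longlonglongrightarrow> 0" by (rule LIMSEQ_power_zero) simp
  then have "(\<lambda>K. x - (\<Sum>k<K. binary_digit k x / 2 ^ Suc k)) \<longlonglongrightarrow> 0"
    by (rule Lim_null_comparison[rotated])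
      (use * in \<open>simp only: real_norm_def eventually_True\<close>)
  from tendsto_diff[OF tendsto_const[of x] this] show ?thesis by (simp add: sums_def)
qed

lemma cantor_summable:
  assumes "\<And>i. b i \<in> {0..1::real}"
  shows "summable (\<lambda>i. 2 * b i / 3 ^ Suc i)"
  by (rule summable_comparison_test'[OF sums_summable[OF sums_geometric_third], of 0])
    (use assms in \<open>auto simp: field_simps\<close>)

lemma cantor_point_bounds:
  assumes "\<And>i. b i \<in> {0..1::real}"
  shows "0 \<le> cantor_point b" "cantor_point b \<le> 1"
proof -
  show "0 \<le> cantor_point b" unfolding cantor_point_def
    by (intro suminf_nonneg cantor_summable) (use assms in auto)
  have "cantor_point b \<le> (\<Sum>i. 2 / 3 ^ Suc i)" unfolding cantor_point_def
    by (intro suminf_le cantor_summable sums_summable[OF sums_geometric_third])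
      (use assms in \<open>auto simp: field_simps\<close>)
  then show "cantor_point b \<le> 1" using sums_unique[OF sums_geometric_third] by simp
qed

text \<open>Removing the leading digit of the expansion shifts the digit sequence, which matches the recursion of \<open>cantor_digit\<close>.\<close>

lemma cantor_digit_point:
  assumes "\<And>i. b i \<in> {0, 1::real}"
  shows "cantor_digit i (cantor_point b) = b i"
  using assms
proof (induction i arbitrary: b)
  have step: "cantor_point b = (2 * b 0 + cantor_point (\<lambda>i. b (Suc i))) / 3
      \<and> cantor_digit 0 (cantor_point b) = b 0"
    if b: "\<And>i. b i \<in> {0, 1::real}" for b
  proof -
    have b': "b i \<in> {0..1}" for i using b[of i] by auto
    have "cantor_point b = (\<Sum>i. 2 * b (Suc i) / 3 ^ Suc (Suc i)) + 2 * b 0 / 3"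
      unfolding cantor_point_def using suminf_split_head[OF cantor_summable[of b, OF b']]
      by simp
    also have "(\<Sum>i. 2 * b (Suc i) / 3 ^ Suc (Suc i)) = (\<Sum>i. 2 * b (Suc i) / 3 ^ Suc i / 3)"
      by (simp add: field_simps)
    also have "\<dots> = cantor_point (\<lambda>i. b (Suc i)) / 3"
      unfolding cantor_point_def by (intro suminf_divide cantor_summable b')
    finally have eq: "cantor_point b = (2 * b 0 + cantor_point (\<lambda>i. b (Suc i))) / 3" by simp
    have "0 \<le> cantor_point (\<lambda>i. b (Suc i))" "cantor_point (\<lambda>i. b (Suc i)) \<le> 1"
      by (intro cantor_point_bounds b')+
    then show ?thesis using b[of 0] unfolding eq by auto
  qed
  {
    case 0 then show ?case using step[of b] by blast
  next
    case (Suc i)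
    have "cantor_digit (Suc i) (cantor_point b)
        = cantor_digit i (3 * cantor_point b - 2 * cantor_digit 0 (cantor_point b))" by simp
    also have "3 * cantor_point b - 2 * cantor_digit 0 (cantor_point b)
        = cantor_point (\<lambda>i. b (Suc i))"
      using step[of b, OF Suc.prems] by simp
    finally show ?case using Suc.IH[of "\<lambda>i. b (Suc i)"] Suc.prems by simp
  }
qed

lemma encode_bounds: "0 \<le> encode x" "encode x \<le> 1"
proof -
  have "(case prod_decode i of (n, k) \<Rightarrow> binary_digit k (x n)) \<in> {0..1}" for i
    using binary_digit_01 by (auto split: prod.split)
      (metis binary_digit_01 empty_iff insert_iff order_refl zero_le_one)+
  then show "0 \<le> encode x" "encode x \<le> 1" unfolding encode_def by (intro cantor_point_bounds; blast)+
qed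

lemma coord_encode:
  assumes "0 \<le> x n" "x n \<le> 1"
  shows "coord n (encode x) = x n"
proof -
  have "cantor_digit (prod_encode (n, k)) (encode x) = binary_digit k (x n)" for k
    unfolding encode_def
    by (subst cantor_digit_point) (use binary_digit_01 in \<open>auto split: prod.split\<close>)
  then show ?thesis
    using binary_expansion_sums[OF assms] by (simp add: coord_def sums_iff)
qed

lemma encode_measurable [measurable (raw)]:
  assumes [measurable]: "\<And>n. x n \<in> borel_measurable M"
  shows "(\<lambda>w. encode (\<lambda>n. x n w)) \<in> borel_measurable M"
proof -
  have "(\<lambda>w. case prod_decode i of (n, k) \<Rightarrow> binary_digit k (x n w)) \<in> borel_measurable M" for i
    by (cases "prod_decode i") simp
  note [measurable] = this
  show ?thesis unfolding encode_def cantor_point_def by measurable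
qed

lemma coord_term_bound: "norm (cantor_digit i y / 2 ^ Suc k) \<le> 1 / 2 ^ Suc k"
  using cantor_digit_bounds[of i y] by (simp add: field_simps)

lemma coord_summable: "summable (\<lambda>k. cantor_digit (prod_encode (n, k)) y / 2 ^ Suc k)"
  by (rule summable_comparison_test'[OF sums_summable[OF sums_geometric_half], of 0])
    (rule coord_term_bound)

lemma coord_bounds: "0 \<le> coord n y" "coord n y \<le> 1"
proof -
  show "0 \<le> coord n y" unfolding coord_def
    by (intro suminf_nonneg coord_summable) (simp add: cantor_digit_bounds)
  have "coord n y \<le> (\<Sum>k. 1 / 2 ^ Suc k)" unfolding coord_def
    by (intro suminf_le coord_summable sums_summable[OF sums_geometric_half])
      (use coord_term_bound cantor_digit_bounds in \<open>simp add: field_simps\<close>)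
  then show "coord n y \<le> 1" using sums_unique[OF sums_geometric_half] by simp
qed

text \<open>The series of the binary expansion converges uniformly.\<close>

lemma coord_continuous: "isCont (coord n) y"
proof -
  have lim: "uniform_limit UNIV (\<lambda>K y. \<Sum>k<K. cantor_digit (prod_encode (n, k)) y / 2 ^ Suc k)
      (coord n) sequentially"
    unfolding coord_def
    by (rule Weierstrass_m_test[OF _ sums_summable[OF sums_geometric_half]]) (rule coord_term_bound)
  have "continuous_on UNIV (coord n)"
    by (rule uniform_limit_theorem[OF _ lim])
      (auto intro!: always_eventually continuous_intros continuous_at_imp_continuous_on
        cantor_digit_continuous)
  then show ?thesis by (simp add: continuous_on_eq_continuous_at)
qed

lemma coord_measurable [measurable]: "coord n \<in> borel_measurable borel"
  by (intro borel_measurable_continuous_onI continuous_at_imp_continuous_on ballI coord_continuous)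

section \<open>Truncated expectations\<close>

text \<open>The layer cake formula, obtained from Tonelli's theorem for the region below the graph of \<open>min H R\<close>.\<close>

lemma (in prob_space) truncated_expectation_layers:
  assumes [measurable]: "H \<in> borel_measurable M" and H: "\<And>w. 0 \<le> H w" and R: "0 \<le> (R::real)"
  shows "ennreal (expectation (\<lambda>w. min (H w) R)) =
    (\<integral>\<^sup>+y. ennreal (prob {w\<in>space M. y < H w}) * indicator {0..<R} y \<partial>lborel)"
proof -
  have int: "integrable M (\<lambda>w. min (H w) R)"
    by (rule integrable_const_bound[of _ R]) (use H R in auto)
  have "ennreal (expectation (\<lambda>w. min (H w) R)) = (\<integral>\<^sup>+w. ennreal (min (H w) R) \<partial>M)"
    using int H R by (intro nn_integral_eq_integral[symmetric]) auto
  also have "\<dots> = (\<integral>\<^sup>+w. (\<integral>\<^sup>+y. indicator {0..<min (H w) R} y \<partial>lborel) \<partial>M)"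
    using H R by (intro nn_integral_cong) simp
  also have "\<dots> = (\<integral>\<^sup>+w. (\<integral>\<^sup>+y. indicator {w\<in>space M. y < H w} w * indicator {0..<R} y \<partial>lborel) \<partial>M)"
    by (intro nn_integral_cong) (auto split: split_indicator)
  also have "\<dots> = (\<integral>\<^sup>+y. (\<integral>\<^sup>+w. indicator {w\<in>space M. y < H w} w * indicator {0..<R} y \<partial>M) \<partial>lborel)"
  proof -
    interpret P: pair_sigma_finite M lborel ..
    have "(\<lambda>(w, y). indicator {w\<in>space M. y < H w} w * indicator {0..<R} y :: ennreal)
        \<in> borel_measurable (M \<Otimes>\<^sub>M lborel)"
      unfolding indicator_def by measurable
    then show ?thesis by (rule P.Fubini'[symmetric])
  qed
  also have "\<dots> = (\<integral>\<^sup>+y. ennreal (prob {w\<in>space M. y < H w}) * indicator {0..<R} y \<partial>lborel)"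
    by (intro nn_integral_cong) (simp add: nn_integral_multc emeasure_eq_measure)
  finally show ?thesis .
qed

text \<open>The tail is at most 1 on \<open>y \<le> 1\<close> and at most \<open>v / y\<close> beyond.\<close>

lemma (in prob_space) truncated_expectation_upper:
  assumes [measurable]: "H \<in> borel_measurable M" and H: "\<And>w. 0 \<le> H w"
    and R: "1 \<le> (R::real)" and v: "0 \<le> v"
    and tail: "\<And>y. y > 0 \<Longrightarrow> prob {w\<in>space M. y < H w} \<le> v / y"
  shows "expectation (\<lambda>w. min (H w) R) \<le> 1 + v * ln R"
proof -
  have "ennreal (expectation (\<lambda>w. min (H w) R)) =
      (\<integral>\<^sup>+y. ennreal (prob {w\<in>space M. y < H w}) * indicator {0..<R} y \<partial>lborel)"
    using R by (intro truncated_expectation_layers H) auto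
  also have "\<dots> \<le> (\<integral>\<^sup>+y. indicator {0..1} y + ennreal (v / y) * indicator {1..R} y \<partial>lborel)"
  proof (rule nn_integral_mono)
    fix y :: real
    consider "y < 0 \<or> y \<ge> R" | "0 \<le> y" "y \<le> 1" | "1 < y" "y < R" by linarith
    then show "ennreal (prob {w\<in>space M. y < H w}) * indicator {0..<R} y
        \<le> indicator {0..1} y + ennreal (v / y) * indicator {1..R} y"
    proof cases
      case 2
      have "ennreal (prob {w\<in>space M. y < H w}) \<le> 1" by simp
      then show ?thesis using 2 by (auto split: split_indicator intro: add_increasing2)
    next
      case 3
      then show ?thesis using tail[of y] by (auto intro: ennreal_leI)
    qed auto
  qed
  also have "\<dots> = 1 + (\<integral>\<^sup>+y. ennreal (v / y) * indicator {1..R} y \<partial>lborel)"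
    by (subst nn_integral_add) auto
  also have "(\<integral>\<^sup>+y. ennreal (v / y) * indicator {1..R} y \<partial>lborel) = ennreal (v * ln R - v * ln 1)"
    using R v by (intro nn_integral_FTC_Icc)
      (auto intro!: derivative_eq_intros simp: has_real_derivative_iff_has_vector_derivative[symmetric] divide_nonneg_pos)
  also have "1 + ennreal (v * ln R - v * ln 1) = ennreal (1 + v * ln R)"
    using R v by (simp flip: ennreal_1 ennreal_plus)
  finally show ?thesis using R v by (subst (asm) ennreal_le_iff) auto
qed

text \<open>The tail \<open>1 - exp (- v / y)\<close> is at least \<open>v / (v + y)\<close>, which has the antiderivative \<open>v * ln (v + y)\<close>. Together with
the upper bound this identifies \<open>v\<close> as the limit of truncated expectations divided by \<open>ln R\<close>.\<close>

lemma (in prob_space) truncated_expectation_lower: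
  assumes [measurable]: "H \<in> borel_measurable M" and H: "\<And>w. 0 \<le> H w"
    and R: "1 \<le> (R::real)" and v: "0 \<le> v"
    and cdf: "\<And>y. y > 0 \<Longrightarrow> prob {w\<in>space M. H w \<le> y} = exp (- v / y)"
  shows "v * ln R - v * ln (1 + v) \<le> expectation (\<lambda>w. min (H w) R)"
proof -
  have tail: "v / (v + y) \<le> prob {w\<in>space M. y < H w}" if "y > 0" for y
  proof -
    have "prob {w\<in>space M. y < H w} = 1 - exp (- v / y)"
      using prob_neg[of "\<lambda>w. H w \<le> y"] cdf[OF that] by (simp add: not_le)
    moreover have "exp (- v / y) \<le> 1 / (1 + v / y)"
      using exp_ge_add_one_self[of "v / y"] v that
      by (simp add: exp_minus inverse_eq_divide frac_le add_pos_nonneg)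
    moreover have "1 / (1 + v / y) = 1 - v / (v + y)" using v that by (simp add: field_simps)
    ultimately show ?thesis by simp
  qed
  have "ennreal (v * ln (v + R) - v * ln (v + 1))
      = (\<integral>\<^sup>+y. ennreal (v / (v + y)) * indicator {1..R} y \<partial>lborel)"
    using R v by (intro nn_integral_FTC_Icc[symmetric])
      (auto intro!: derivative_eq_intros simp: has_real_derivative_iff_has_vector_derivative[symmetric] divide_nonneg_pos)
  also have "\<dots> = (\<integral>\<^sup>+y. ennreal (v / (v + y)) * indicator {1..<R} y \<partial>lborel)"
    using AE_lborel_singleton[of R] by (intro nn_integral_cong_AE) (auto split: split_indicator)
  also have "\<dots> \<le> (\<integral>\<^sup>+y. ennreal (prob {w\<in>space M. y < H w}) * indicator {0..<R} y \<partial>lborel)"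
  proof (rule nn_integral_mono)
    fix y :: real
    show "ennreal (v / (v + y)) * indicator {1..<R} y
        \<le> ennreal (prob {w\<in>space M. y < H w}) * indicator {0..<R} y"
      using tail[of y] by (auto split: split_indicator intro: ennreal_leI)
  qed
  also have "\<dots> = ennreal (expectation (\<lambda>w. min (H w) R))"
    using R by (intro truncated_expectation_layers[symmetric] H) auto
  finally have "v * ln (v + R) - v * ln (v + 1) \<le> expectation (\<lambda>w. min (H w) R)"
    using H R by (subst (asm) ennreal_le_iff) (auto intro!: integral_nonneg)
  moreover have "v * ln R \<le> v * ln (v + R)" using R v by (intro mult_left_mono) auto
  ultimately show ?thesis by (simp add: add.commute)
qed

section \<open>The spectral measure of a sequence\<close>

text \<open>The function \<open>v\<close> records the scales of all max-linear combinations. The weights \<open>c\<close> make the maxima \<open>W N\<close> of the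
\<open>c n * Z n\<close> uniformly tight; the measure \<open>m\<close> is a weak limit of the laws of the codes of the ratios \<open>c n * Z n / W N\<close>
under densities proportional to \<open>W N\<close> on the event \<open>W N \<le> exp N\<close>. These densities have to be
normalized to probabilities for Helly's theorem. Their total masses need not be computed: they are pinned down in the
limit by any one \<open>Z n\<close> whose scale is positive, and if there is none then the zero measure will do.\<close>

lemma spectral_measure_exists:
  fixes Z :: "nat \<Rightarrow> 'w \<Rightarrow> real" and v :: "nat set \<Rightarrow> (nat \<Rightarrow> real) \<Rightarrow> real"
  assumes "prob_space P" and Z_meas [measurable]: "\<And>n. Z n \<in> borel_measurable P"
    and Z_nonneg: "\<And>n w. 0 \<le> Z n w"
    and v_nonneg: "\<And>F b. \<lbrakk>finite F; F \<noteq> {}; \<forall>n\<in>F. 0 < b n\<rbrakk> \<Longrightarrow> 0 \<le> v F b"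
    and cdf: "\<And>F b y. \<lbrakk>finite F; F \<noteq> {}; \<forall>n\<in>F. 0 < b n; 0 < y\<rbrakk> \<Longrightarrow>
        measure P {w\<in>space P. (MAX n\<in>F. b n * Z n w) \<le> y} = exp (- v F b / y)"
  obtains c m where "\<And>n. 0 < c n" "finite_measure m" "sets m = sets borel"
    "\<And>F b. \<lbrakk>finite F; F \<noteq> {}; \<forall>n\<in>F. 0 < b n\<rbrakk> \<Longrightarrow>
        (\<integral>y. (MAX n\<in>F. b n * coord n y) \<partial>m) = v F (\<lambda>n. b n * c n)"
proof -
  interpret P: prob_space P by fact
  define v1 where "v1 n = v {n} (\<lambda>_. 1)" for n
  have v1_nonneg: "0 \<le> v1 n" for n unfolding v1_def by (rule v_nonneg) auto
  have tail1: "P.prob {w\<in>space P. y < b * Z n w} = 1 - exp (- (b * v1 n) / y)" if "0 < y" "0 < b" for b n y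
  proof -
    have "P.prob {w\<in>space P. Z n w \<le> y / b} = exp (- v1 n / (y / b))"
      using cdf[of "{n}" "\<lambda>_. 1" "y / b"] that by (simp add: v1_def)
    moreover have "{w\<in>space P. Z n w \<le> y / b} = {w\<in>space P. \<not> y < b * Z n w}"
      using that by (auto simp: field_simps not_less)
    ultimately show ?thesis
      using P.prob_neg[of "\<lambda>w. y < b * Z n w"] by (simp add: mult.commute)
  qed
  have tail: "P.prob {w\<in>space P. y < (MAX n\<in>F. b n * Z n w)} \<le> (\<Sum>n\<in>F. b n * v1 n) / y"
    if "finite F" "F \<noteq> {}" "\<forall>n\<in>F. 0 < b n" "0 < y" for F b y
  proof -
    have "{w\<in>space P. y < (MAX n\<in>F. b n * Z n w)} = (\<Union>n\<in>F. {w\<in>space P. y < b n * Z n w})"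
      using that by (auto simp: Max_gr_iff)
    also have "P.prob \<dots> \<le> (\<Sum>n\<in>F. P.prob {w\<in>space P. y < b n * Z n w})"
      using that(1) by (intro P.finite_measure_subadditive_finite) auto
    also have "\<dots> \<le> (\<Sum>n\<in>F. b n * v1 n / y)"
    proof (rule sum_mono)
      fix n assume "n \<in> F"
      then show "P.prob {w\<in>space P. y < b n * Z n w} \<le> b n * v1 n / y"
        using that exp_ge_add_one_self[of "- (b n * v1 n) / y"] by (subst tail1) auto
    qed
    finally show ?thesis by (simp add: sum_divide_distrib)
  qed
  show thesis
  proof (cases "\<forall>n. v1 n = 0")
    case True
    have "v F b = 0" if "finite F" "F \<noteq> {}" "\<forall>n\<in>F. 0 < b n" for F b
    proof -
      have "P.prob {w\<in>space P. 1 < (MAX n\<in>F. b n * Z n w)} \<le> 0"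
        using tail[OF that, of 1] True by simp
      moreover have "(\<lambda>w. MAX n\<in>F. b n * Z n w) \<in> borel_measurable P"
        using that by measurable
      ultimately have "P.prob {w\<in>space P. (MAX n\<in>F. b n * Z n w) \<le> 1} \<ge> 1"
        using P.prob_neg[of "\<lambda>w. (MAX n\<in>F. b n * Z n w) \<le> 1"] by (simp add: not_le)
      then show ?thesis using cdf[OF that, of 1] v_nonneg[OF that] by simp
    qed
    then show thesis
      by (intro that[of "\<lambda>_. 1" "null_measure borel"])
        (auto intro!: finite_measureI simp: integral_null_measure)
  next
    case False
    then obtain n0 where n0: "0 < v1 n0" using v1_nonneg by (metis less_eq_real_def)
    \<comment> \<open>The added 1 covers variables of scale 0; the scales of the \<open>c n * Z n\<close> sum to at most 1.\<close>
    define c where "c n = 1 / (2 ^ Suc n * (1 + v1 n))" for n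
    have c_pos: "0 < c n" for n using v1_nonneg[of n] by (auto simp: c_def intro!: divide_pos_pos mult_pos_pos)
    have c_v1: "c n * v1 n \<le> 1 / 2 ^ Suc n" for n
      using v1_nonneg[of n] by (simp add: c_def divide_simps)
    have sum_c: "(\<Sum>n\<le>N. c n * v1 n) \<le> 1" for N
    proof -
      have "(\<Sum>n\<le>N. c n * v1 n) \<le> (\<Sum>n\<le>N. 1 / 2 ^ Suc n)" by (intro sum_mono c_v1)
      also have "\<dots> \<le> (\<Sum>n. 1 / 2 ^ Suc n)"
        by (intro sum_le_suminf sums_summable[OF sums_geometric_half]) auto
      finally show ?thesis using sums_unique[OF sums_geometric_half] by simp
    qed
    define W where "W N w = (MAX n\<in>{..N}. c n * Z n w)" for N w
    have W_meas [measurable]: "W N \<in> borel_measurable P" for N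
      unfolding W_def by measurable
    have W_ge: "c n * Z n w \<le> W N w" if "n \<le> N" for n N w
      unfolding W_def using that by (intro Max_ge) auto
    have W_nonneg: "0 \<le> W N w" for N w
      using W_ge[of 0 N w] Z_nonneg[of 0 w] c_pos[of 0] by (meson le0 mult_nonneg_nonneg less_imp_le order_trans)
    have W_tail: "P.prob {w\<in>space P. y < W N w} \<le> 1 / y" if "0 < y" for y N
    proof -
      have "P.prob {w\<in>space P. y < W N w} \<le> (\<Sum>n\<le>N. c n * v1 n) / y"
        unfolding W_def using c_pos that by (intro tail) auto
      also have "\<dots> \<le> 1 / y" using sum_c that by (intro divide_right_mono) auto
      finally show ?thesis .
    qed
    \<comment> \<open>Any truncation level would do whose logarithm tends to infinity; this one has logarithm \<open>N\<close>.\<close>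
    define R where "R N = exp (real N)" for N
    have R_ge1: "1 \<le> R N" and ln_R: "ln (R N) = real N" for N by (auto simp: R_def)
    define S where "S N = {w\<in>space P. W N w \<le> R N}" for N
    have S_meas [measurable]: "S N \<in> sets P" for N unfolding S_def by measurable
    define A where "A N h = P.expectation (\<lambda>w. h w * indicator (S N) w)" for N and h :: "'w \<Rightarrow> real"
    define a where "a N = A N (W N)" for N
    have int_W: "integrable P (\<lambda>w. W N w * indicator (S N) w)" for N
      by (rule P.integrable_const_bound[of _ "R N"])
        (use W_nonneg in \<open>auto simp: S_def indicator_def abs_of_nonneg intro: order_trans[OF zero_le_one R_ge1]\<close>)
    have a_le: "a N \<le> 1 + real N" for N
    proof -
      have "a N \<le> P.expectation (\<lambda>w. min (W N w) (R N))"
        unfolding a_def A_def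
      proof (intro integral_mono int_W P.integrable_const_bound[of _ "R N"])
        show "W N w * indicator (S N) w \<le> min (W N w) (R N)" for w
          using W_nonneg[of N w] R_ge1[of N] by (auto simp: S_def indicator_def)
      qed (use W_nonneg R_ge1 order_trans[OF zero_le_one R_ge1] in auto)
      also have "\<dots> \<le> 1 + 1 * ln (R N)"
        by (intro P.truncated_expectation_upper) (use W_nonneg R_ge1 W_tail in auto)
      finally show ?thesis by (simp add: ln_R)
    qed

    define hF where "hF F b w = (MAX n\<in>F. b n * (c n * Z n w))" for F b w
    have A_lim: "(\<lambda>N. A N (hF F b) / real N) \<longlonglongrightarrow> v F (\<lambda>n. b n * c n)"
      if F: "finite F" "F \<noteq> {}" "\<forall>n\<in>F. 0 < b n" for F b
    proof -
      define h where "h = hF F b"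
      define vh where "vh = v F (\<lambda>n. b n * c n)"
      define C where "C = 1 + (\<Sum>n\<in>F. b n)"
      have "0 \<le> (\<Sum>n\<in>F. b n)" using F by (intro sum_nonneg) (auto simp: less_imp_le)
      then have C1: "1 \<le> C" by (simp add: C_def)
      have h_meas [measurable]: "h \<in> borel_measurable P"
        unfolding h_def hF_def[abs_def] using F by measurable
      have h_nonneg: "0 \<le> h w" for w
        unfolding h_def hF_def using F c_pos Z_nonneg by (intro MAX_nonneg) (auto simp: less_imp_le)
      have vh_nonneg: "0 \<le> vh" unfolding vh_def using F c_pos by (intro v_nonneg) auto
      have h_cdf: "P.prob {w\<in>space P. h w \<le> y} = exp (- vh / y)" if "0 < y" for y
        using cdf[of F "\<lambda>n. b n * c n" y] F c_pos that by (simp add: h_def hF_def vh_def mult.assoc)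
      have h_tail: "P.prob {w\<in>space P. y < h w} \<le> vh / y" if "0 < y" for y
        using P.prob_neg[of "\<lambda>w. h w \<le> y"] h_cdf[OF that] exp_ge_add_one_self[of "- vh / y"]
        by (simp add: not_le)
      have h_le: "h w \<le> C * W N w" if "Max F \<le> N" for w N
        unfolding h_def hF_def
      proof (rule Max.boundedI)
        fix x assume "x \<in> (\<lambda>n. b n * (c n * Z n w)) ` F"
        then obtain n where n: "n \<in> F" "x = b n * (c n * Z n w)" by auto
        have "n \<le> N" using n F that by (meson Max_ge order_trans)
        have "b n \<le> (\<Sum>n\<in>F. b n)" using n F by (intro member_le_sum) (auto simp: less_imp_le)
        then have "b n \<le> C" by (simp add: C_def)
        then show "x \<le> C * W N w" unfolding n(2)
          using W_ge[OF \<open>n \<le> N\<close>, of w] n F c_pos[of n] Z_nonneg[of n w]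
          by (intro mult_mono) (auto simp: W_nonneg intro: order_trans[OF _ C1])
      qed (use F in auto)
      have upper: "A N h \<le> 1 + vh * (ln C + real N)"
        and lower: "vh * real N - vh * ln (1 + vh) - 1 \<le> A N h" if "Max F \<le> N" for N
      proof -
        have CR: "1 \<le> C * R N" using C1 R_ge1[of N] mult_mono[of 1 C 1 "R N"] by simp
        have int_h: "integrable P (\<lambda>w. h w * indicator (S N) w)"
        proof (rule P.integrable_const_bound[of _ "C * R N"])
          have "h w * indicator (S N) w \<le> C * R N" for w
          proof (cases "w \<in> S N")
            case True
            then have "C * W N w \<le> C * R N" using C1 by (auto simp: S_def)
            then show ?thesis using h_le[OF that, of w] True by simp
          qed (use CR in simp)
          then show "AE w in P. norm (h w * indicator (S N) w) \<le> C * R N"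
            using h_nonneg by (simp add: abs_mult)
        qed simp
        have int_min: "integrable P (\<lambda>w. min (h w) K)" if "0 \<le> K" for K
          by (rule P.integrable_const_bound[of _ K]) (use that h_nonneg in auto)
        have int_R: "integrable P (\<lambda>w. R N * indicator {w \<in> space P. R N < W N w} w)"
          by (rule P.integrable_const_bound[of _ "R N"]) (use R_ge1[of N] in \<open>auto simp: indicator_def\<close>)
        have "A N h \<le> P.expectation (\<lambda>w. min (h w) (C * R N))"
          unfolding A_def
        proof (intro integral_mono int_h int_min)
          fix w
          show "h w * indicator (S N) w \<le> min (h w) (C * R N)"
          proof (cases "w \<in> S N")
            case True
            then have "C * W N w \<le> C * R N" using C1 by (auto simp: S_def)
            then show ?thesis using h_le[OF that, of w] True by simp
          qed (use CR h_nonneg in simp)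
        qed (use CR in simp)
        also have "\<dots> \<le> 1 + vh * ln (C * R N)"
          by (intro P.truncated_expectation_upper h_nonneg CR vh_nonneg h_tail) auto
        also have "ln (C * R N) = ln C + real N"
          using C1 R_ge1[of N] by (simp add: ln_mult ln_R)
        finally show "A N h \<le> 1 + vh * (ln C + real N)" .
        have "vh * ln (R N) - vh * ln (1 + vh) \<le> P.expectation (\<lambda>w. min (h w) (R N))"
          by (intro P.truncated_expectation_lower h_nonneg R_ge1 vh_nonneg h_cdf) auto
        also have "\<dots> \<le> P.expectation (\<lambda>w. h w * indicator (S N) w + R N * indicator {w\<in>space P. R N < W N w} w)"
        proof (rule integral_mono)
          show "integrable P (\<lambda>w. min (h w) (R N))"
            using R_ge1[of N] by (intro int_min) simp
          show "integrable P (\<lambda>w. h w * indicator (S N) w + R N * indicator {w\<in>space P. R N < W N w} w)"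
            by (intro Bochner_Integration.integrable_add int_h int_R)
          show "min (h w) (R N) \<le> h w * indicator (S N) w + R N * indicator {w\<in>space P. R N < W N w} w"
            if "w \<in> space P" for w
            using that by (auto simp: S_def indicator_def)
        qed
        \<comment> \<open>The loss from the event \<open>W N > R N\<close> is bounded because the tail of \<open>W N\<close> at \<open>R N\<close> is at most \<open>1 / R N\<close>.\<close>
        also have "\<dots> = A N h + R N * P.prob {w\<in>space P. R N < W N w}"
          unfolding A_def by (subst Bochner_Integration.integral_add[OF int_h int_R]) simp
        also have "R N * P.prob {w\<in>space P. R N < W N w} \<le> 1"
          using W_tail[of "R N" N] R_ge1[of N] by (simp add: field_simps)
        finally show "vh * real N - vh * ln (1 + vh) - 1 \<le> A N h" by (simp add: ln_R)
      qed
      have "(\<lambda>N. (vh * real N - vh * ln (1 + vh) - 1) / real N) \<longlonglongrightarrow> vh"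
        "(\<lambda>N. (1 + vh * (ln C + real N)) / real N) \<longlonglongrightarrow> vh"
        by real_asymp+
      then have "(\<lambda>N. A N h / real N) \<longlonglongrightarrow> vh"
        by (rule tendsto_sandwich[rotated 2])
          (auto intro!: eventually_sequentiallyI[of "Max F"] divide_right_mono lower upper)
      then show "(\<lambda>N. A N (hF F b) / real N) \<longlonglongrightarrow> v F (\<lambda>n. b n * c n)"
        by (simp add: h_def vh_def)
    qed

    define v0 where "v0 = v {n0} (\<lambda>n. 1 * c n)"
    have v0_pos: "0 < v0"
    proof -
      have "exp (- v0) = P.prob {w\<in>space P. c n0 * Z n0 w \<le> 1}"
        using cdf[of "{n0}" c 1] c_pos by (simp add: v0_def)
      also have "\<dots> = exp (- (c n0 * v1 n0))"
        using P.prob_neg[of "\<lambda>w. 1 < c n0 * Z n0 w"] tail1[of 1 "c n0" n0] c_pos by (simp add: not_less)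
      finally show ?thesis using c_pos n0 by simp
    qed
    define h0 where "h0 = hF {n0} (\<lambda>_. 1)"
    have h0: "h0 w = c n0 * Z n0 w" for w by (simp add: h0_def hF_def)
    have A_h0: "(\<lambda>N. A N h0 / real N) \<longlonglongrightarrow> v0"
      using A_lim[of "{n0}" "\<lambda>_. 1"] by (simp add: v0_def h0_def)
    have "\<forall>\<^sub>F N in sequentially. 0 < a N"
    proof -
      have "\<forall>\<^sub>F N in sequentially. 0 < A N h0 / real N"
        using order_tendstoD(1)[OF A_h0 v0_pos] .
      moreover have "\<forall>\<^sub>F N in sequentially. n0 \<le> N" by (rule eventually_ge_at_top)
      ultimately show ?thesis
      proof eventually_elim
        case (elim N)
        have "A N h0 \<le> A N (W N)" unfolding A_def
        proof (rule integral_mono[OF _ int_W])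
          show "h0 w * indicator (S N) w \<le> W N w * indicator (S N) w" for w
            using W_ge[OF elim(2)] by (simp add: h0 mult_right_mono)
          show "integrable P (\<lambda>w. h0 w * indicator (S N) w)"
          proof (rule Bochner_Integration.integrable_bound[OF int_W])
            show "AE w in P. norm (h0 w * indicator (S N) w) \<le> norm (W N w * indicator (S N) w)"
              using W_ge[OF elim(2)] Z_nonneg c_pos W_nonneg
              by (auto simp: h0 abs_mult abs_of_nonneg less_imp_le indicator_def intro!: AE_I2)
          qed (simp add: h0)
        qed
        moreover have "0 < A N h0" using elim(1) by (simp add: zero_less_divide_iff)
        ultimately show ?case by (simp add: a_def)
      qed
    qed
    then obtain N0 where a_pos: "\<And>N. N0 \<le> N \<Longrightarrow> 0 < a N"
      by (auto simp: eventually_sequentially)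
    \<comment> \<open>Capping at 1 puts the coordinates beyond \<open>N\<close> into the unit interval; those up to \<open>N\<close> are at most 1 anyway.\<close>
    define e where "e N w = encode (\<lambda>n. min 1 (c n * Z n w / W N w))" for N w
    have e_meas [measurable]: "e N \<in> borel_measurable P" for N unfolding e_def by measurable
    define D where "D N = density P (\<lambda>w. ennreal (W N w * indicator (S N) w / a N))" for N
    define \<nu> where "\<nu> N = distr (D (N + N0)) borel (e (N + N0))" for N
    have D_prob: "prob_space (D N)" if "N0 \<le> N" for N
    proof (rule prob_spaceI)
      have "emeasure (D N) (space (D N)) = (\<integral>\<^sup>+w. ennreal (W N w * indicator (S N) w / a N) \<partial>P)"
        unfolding D_def by (subst emeasure_density) (auto intro!: nn_integral_cong)
      also have "\<dots> = ennreal (\<integral>w. W N w * indicator (S N) w / a N \<partial>P)"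
        using int_W a_pos[OF that] W_nonneg by (intro nn_integral_eq_integral) (auto intro!: AE_I2 divide_nonneg_pos)
      also have "(\<integral>w. W N w * indicator (S N) w / a N \<partial>P) = 1"
        using a_pos[OF that] by (simp add: a_def A_def)
      finally show "emeasure (D N) (space (D N)) = 1" by simp
    qed
    have D_sets [measurable_cong]: "sets (D N) = sets P" for N by (simp add: D_def)
    have \<nu>_dist: "real_distribution (\<nu> N)" for N
    proof -
      interpret D: prob_space "D (N + N0)" by (rule D_prob) simp
      show ?thesis unfolding \<nu>_def by (rule D.real_distribution_distr) simp
    qed
    have "tight \<nu>" unfolding tight_def
    proof (intro conjI allI impI \<nu>_dist)
      fix \<epsilon> :: real assume "0 < \<epsilon>"
      have "measure (\<nu> N) {-1<..1} = 1" for N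
      proof -
        interpret D: prob_space "D (N + N0)" by (rule D_prob) simp
        have "e (N + N0) w \<in> {-1<..1}" for w
          using encode_bounds unfolding e_def by (auto intro: less_le_trans[of _ 0])
        then have "e (N + N0) -` {-1<..1} \<inter> space (D (N + N0)) = space (D (N + N0))" by auto
        then show ?thesis unfolding \<nu>_def by (subst measure_distr) (auto simp: D.prob_space)
      qed
      then show "\<exists>a b. a < b \<and> (\<forall>n. 1 - \<epsilon> < measure (\<nu> n) {a<..b})"
        using \<open>0 < \<epsilon>\<close> by (intro exI[of _ "-1"] exI[of _ 1]) auto
    qed
    from tight_imp_convergent_subsubsequence[OF this strict_mono_id]
    obtain r m0 where r: "strict_mono (r :: nat \<Rightarrow> nat)" and m0: "real_distribution m0"
      and conv: "weak_conv_m (\<nu> \<circ> r) m0" by (auto simp: comp_def id_def)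
    interpret m0: real_distribution m0 by fact
    define \<phi> where "\<phi> F b y = (MAX n\<in>F. b n * coord n y)" for F b y
    have \<phi>_lim: "(\<lambda>k. A (r k + N0) (hF F b) / a (r k + N0)) \<longlonglongrightarrow> (\<integral>y. \<phi> F b y \<partial>m0)"
      if F: "finite F" "F \<noteq> {}" "\<forall>n\<in>F. 0 < b n" for F b
    proof -
      have cont: "isCont (\<phi> F b) y" for y
        unfolding \<phi>_def[abs_def] using F by (intro isCont_MAX continuous_intros coord_continuous) auto
      have bound: "norm (\<phi> F b y) \<le> (\<Sum>n\<in>F. b n)" for y
      proof -
        have "\<phi> F b y \<le> (\<Sum>n\<in>F. b n * coord n y)" unfolding \<phi>_def
          using F coord_bounds by (intro MAX_le_sum) (auto simp: less_imp_le)
        also have "\<dots> \<le> (\<Sum>n\<in>F. b n)"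
          using F coord_bounds by (intro sum_mono) (auto simp: mult_left_le less_imp_le)
        finally show ?thesis using MAX_nonneg[of F "\<lambda>n. b n * coord n y"] F coord_bounds
          by (auto simp: \<phi>_def less_imp_le)
      qed
      have meas [measurable]: "\<phi> F b \<in> borel_measurable borel"
        by (intro borel_measurable_continuous_onI continuous_at_imp_continuous_on ballI cont)
      have "(\<lambda>k. integral\<^sup>L ((\<nu> \<circ> r) k) (\<phi> F b)) \<longlonglongrightarrow> integral\<^sup>L m0 (\<phi> F b)"
        by (rule weak_conv_imp_integral_bdd_continuous_conv[OF _ m0 conv cont bound]) (simp add: \<nu>_dist)
      moreover have "\<forall>\<^sub>F k in sequentially.
          integral\<^sup>L ((\<nu> \<circ> r) k) (\<phi> F b) = A (r k + N0) (hF F b) / a (r k + N0)"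
      proof (rule eventually_sequentiallyI[of "Max F"])
        fix k assume "Max F \<le> k"
        define N where "N = r k + N0"
        have N: "Max F \<le> N" "N0 \<le> N"
          using seq_suble[OF r, of k] \<open>Max F \<le> k\<close> by (auto simp: N_def)
        have "integral\<^sup>L (\<nu> (r k)) (\<phi> F b) = (\<integral>w. \<phi> F b (e N w) \<partial>D N)"
          unfolding \<nu>_def N_def[symmetric] by (rule integral_distr) auto
        also have "\<dots> = (\<integral>w. (W N w * indicator (S N) w / a N) * \<phi> F b (e N w) \<partial>P)"
          unfolding D_def using a_pos[OF N(2)] W_nonneg
          by (subst integral_density) (auto intro!: AE_I2 divide_nonneg_pos)
        also have "\<dots> = (\<integral>w. hF F b w * indicator (S N) w / a N \<partial>P)"
        proof (rule Bochner_Integration.integral_cong[OF refl])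
          fix w
          have "W N w * \<phi> F b (e N w) = hF F b w"
          proof -
            have "W N w * (b n * coord n (e N w)) = b n * (c n * Z n w)" if "n \<in> F" for n
            proof -
              have "n \<le> N" using that F N by (meson Max_ge order_trans)
              have "coord n (e N w) = min 1 (c n * Z n w / W N w)" unfolding e_def
                using Z_nonneg c_pos W_nonneg by (intro coord_encode) (auto simp: less_imp_le)
              moreover have "W N w * min 1 (c n * Z n w / W N w) = c n * Z n w"
              proof (cases "W N w = 0")
                case True
                then show ?thesis using W_ge[OF \<open>n \<le> N\<close>, of w] Z_nonneg[of n w] c_pos[of n]
                  by (metis antisym less_imp_le mult_nonneg_nonneg mult_zero_left)
              next
                case False
                then show ?thesis using W_ge[OF \<open>n \<le> N\<close>, of w] W_nonneg[of N w] by (simp add: min_def field_simps)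
              qed
              ultimately show ?thesis by (simp add: algebra_simps)
            qed
            then have "(\<lambda>n. W N w * (b n * coord n (e N w))) ` F = (\<lambda>n. b n * (c n * Z n w)) ` F"
              by (intro image_cong) auto
            then show ?thesis
              unfolding \<phi>_def hF_def MAX_mult_left[OF F(1,2) W_nonneg] by simp
          qed
          then show "(W N w * indicator (S N) w / a N) * \<phi> F b (e N w) = hF F b w * indicator (S N) w / a N"
            by (metis (no_types, lifting) mult.commute mult.left_commute times_divide_eq_left)
        qed
        also have "\<dots> = A N (hF F b) / a N" by (simp add: A_def)
        finally show "integral\<^sup>L ((\<nu> \<circ> r) k) (\<phi> F b) = A (r k + N0) (hF F b) / a (r k + N0)"
          by (simp add: N_def)
      qed
      ultimately show ?thesis by (rule Lim_transform_eventually)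
    qed
    define I0 where "I0 = (\<integral>y. \<phi> {n0} (\<lambda>_. 1) y \<partial>m0)"
    have sub: "filterlim (\<lambda>k. r k + N0) sequentially sequentially"
      using filterlim_subseq[OF r] by (rule filterlim_at_top_mono) auto
    have I0_lim: "(\<lambda>k. A (r k + N0) h0 / a (r k + N0)) \<longlonglongrightarrow> I0"
      using \<phi>_lim[of "{n0}" "\<lambda>_. 1"] by (simp add: I0_def h0_def)
    \<comment> \<open>By \<open>a_le\<close> the masses \<open>a N / N\<close> stay bounded, so normalizing cannot make the limit for \<open>h0\<close> vanish.\<close>
    have I0_pos: "0 < I0"
    proof -
      have "(\<lambda>N. (A N h0 / real N) * (real N / (1 + real N))) \<longlonglongrightarrow> v0 * 1"
        by (intro tendsto_mult A_h0) real_asymp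
      from filterlim_compose[OF this sub]
      have "(\<lambda>k. (A (r k + N0) h0 / real (r k + N0)) * (real (r k + N0) / (1 + real (r k + N0)))) \<longlonglongrightarrow> v0"
        by simp
      moreover have "(A N h0 / real N) * (real N / (1 + real N)) \<le> A N h0 / a N" if "N0 \<le> N" for N
      proof -
        have "0 \<le> A N h0" unfolding A_def using Z_nonneg c_pos
          by (intro Bochner_Integration.integral_nonneg) (auto simp: h0 less_imp_le)
        then have "A N h0 / (1 + real N) \<le> A N h0 / a N"
          using a_le[of N] a_pos[OF that] by (intro divide_left_mono) auto
        then show ?thesis using \<open>0 \<le> A N h0\<close> by (cases "N = 0") (auto simp: divide_nonneg_pos a_pos[OF that])
      qed
      then have "\<exists>K. \<forall>k\<ge>K. (A (r k + N0) h0 / real (r k + N0)) * (real (r k + N0) / (1 + real (r k + N0)))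
          \<le> A (r k + N0) h0 / a (r k + N0)" by (meson le_add2)
      ultimately have "v0 \<le> I0" using I0_lim by (blast intro: LIMSEQ_le)
      then show ?thesis using v0_pos by simp
    qed
    \<comment> \<open>Along the subsequence the masses \<open>a N / N\<close> tend to \<open>v0 / I0\<close>: the limits for \<open>h0\<close> with and without normalization force this.\<close>
    define m where "m = density m0 (\<lambda>_. ennreal (v0 / I0))"
    show thesis
    proof (rule that[of c m])
      show "finite_measure m" unfolding m_def
        by (rule finite_measureI) (simp add: emeasure_density ennreal_mult_eq_top_iff)
      show "sets m = sets borel" by (simp add: m_def)
      fix F :: "nat set" and b :: "nat \<Rightarrow> real"
      assume F: "finite F" "F \<noteq> {}" "\<forall>n\<in>F. 0 < b n"
      have "(\<lambda>k. (A (r k + N0) (hF F b) / real (r k + N0)) / (A (r k + N0) h0 / real (r k + N0))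
              * (A (r k + N0) h0 / a (r k + N0)))
          \<longlonglongrightarrow> v F (\<lambda>n. b n * c n) / v0 * I0"
        using v0_pos
        by (intro tendsto_intros I0_lim filterlim_compose[OF A_lim[OF F] sub] filterlim_compose[OF A_h0 sub]) auto
      moreover have "\<forall>\<^sub>F k in sequentially. (A (r k + N0) (hF F b) / real (r k + N0)) / (A (r k + N0) h0 / real (r k + N0))
              * (A (r k + N0) h0 / a (r k + N0)) = A (r k + N0) (hF F b) / a (r k + N0)"
        using order_tendstoD(1)[OF filterlim_compose[OF A_h0 sub] v0_pos]
        by eventually_elim (auto simp: zero_less_divide_iff)
      ultimately have "(\<lambda>k. A (r k + N0) (hF F b) / a (r k + N0)) \<longlonglongrightarrow> v F (\<lambda>n. b n * c n) / v0 * I0"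
        by (rule Lim_transform_eventually)
      with \<phi>_lim[OF F] have eq: "(\<integral>y. \<phi> F b y \<partial>m0) = v F (\<lambda>n. b n * c n) / v0 * I0"
        by (rule LIMSEQ_unique)
      have [measurable]: "\<phi> F b \<in> borel_measurable borel"
        unfolding \<phi>_def[abs_def] using F by measurable
      have "(\<integral>y. \<phi> F b y \<partial>m) = v0 / I0 * (\<integral>y. \<phi> F b y \<partial>m0)"
        unfolding m_def using v0_pos I0_pos by (subst integral_density) auto
      then show "(\<integral>y. (MAX n\<in>F. b n * coord n y) \<partial>m) = v F (\<lambda>n. b n * c n)"
        using eq v0_pos I0_pos by (simp add: \<phi>_def)
    qed (rule c_pos)
  qed
qed

text \<open>Multiplying the measure by the supremum \<open>s\<close> of the coordinates and dividing the coordinates by \<open>s\<close> leaves every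
integral of a homogeneous function of degree one unchanged. Points where all coordinates vanish get
no mass. After recoding by the new coordinates, almost every point is determined by its coordinates.\<close>

lemma normalized_spectral_measure:
  assumes "finite_measure m" and sets_m [measurable_cong]: "sets m = sets borel"
  obtains m' where "finite_measure m'" "sets m' = sets borel"
    "AE y in m'. encode (\<lambda>n. coord n y) = y" "AE y in m'. (SUP n. coord n y) = 1"
    "\<And>F b. \<lbrakk>finite F; F \<noteq> {}; \<forall>n\<in>F. 0 < b n\<rbrakk> \<Longrightarrow>
        (\<integral>y. (MAX n\<in>F. b n * coord n y) \<partial>m') = (\<integral>y. (MAX n\<in>F. b n * coord n y) \<partial>m)"
proof -
  interpret finite_measure m by fact
  define s where "s y = (SUP n. coord n y)" for y
  have bdd: "bdd_above (range (\<lambda>n. coord n y))" for y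
    using coord_bounds(2) by (auto intro!: bdd_aboveI[of _ 1])
  have coord_le: "coord n y \<le> s y" for n y
    unfolding s_def by (intro cSUP_upper bdd) auto
  have s01: "0 \<le> s y" "s y \<le> 1" for y
  proof -
    show "0 \<le> s y" using coord_le[of 0 y] coord_bounds(1)[of 0 y] by simp
    show "s y \<le> 1" unfolding s_def using coord_bounds(2) by (intro cSUP_least) auto
  qed
  have s_meas [measurable]: "s \<in> borel_measurable borel"
    unfolding s_def[abs_def] using bdd by (intro borel_measurable_cSUP) auto
  define \<theta> where "\<theta> n y = coord n y / s y" for n y
  have \<theta>_meas [measurable]: "\<theta> n \<in> borel_measurable borel" for n
    unfolding \<theta>_def[abs_def] by measurable
  have \<theta>01: "0 \<le> \<theta> n y" "\<theta> n y \<le> 1" for n y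
    using coord_bounds(1)[of n y] coord_le[of n y] s01(1)[of y] by (auto simp: \<theta>_def divide_le_eq_1)
  have s_\<theta>: "s y * \<theta> n y = coord n y" for n y
    using coord_bounds(1)[of n y] coord_le[of n y] by (cases "s y = 0") (auto simp: \<theta>_def)
  define e where "e y = encode (\<lambda>n. \<theta> n y)" for y
  have e_meas [measurable]: "e \<in> borel_measurable borel" unfolding e_def[abs_def] by measurable
  have coord_e: "coord n (e y) = \<theta> n y" for n y
    unfolding e_def by (intro coord_encode \<theta>01)
  define D where "D = density m (\<lambda>y. ennreal (s y))"
  have D_sets [measurable_cong]: "sets D = sets borel" by (simp add: D_def sets_m)
  have sp_m: "space m = UNIV" using sets_eq_imp_space_eq[OF sets_m] by simp
  interpret D: finite_measure D
  proof (rule finite_measureI)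
    have "emeasure D (space D) = (\<integral>\<^sup>+y. ennreal (s y) \<partial>m)" unfolding D_def
      by (subst emeasure_density) (auto simp: sp_m)
    also have "\<dots> \<le> (\<integral>\<^sup>+y. 1 \<partial>m)" using s01 by (intro nn_integral_mono) simp
    also have "\<dots> < \<infinity>" by (simp add: less_top[symmetric])
    finally show "emeasure D (space D) \<noteq> \<infinity>" by simp
  qed
  show thesis
  proof (rule that[of "distr D borel e"])
    show "finite_measure (distr D borel e)" by (rule D.finite_measure_distr) simp
    show "AE y in distr D borel e. encode (\<lambda>n. coord n y) = y"
      by (subst AE_distr_iff) (simp_all add: coord_e e_def[symmetric])
    have "AE y in D. s y \<noteq> 0" unfolding D_def by (subst AE_density) auto
    moreover have "(SUP n. \<theta> n y) = 1" if "s y \<noteq> 0" for y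
    proof (rule antisym)
      have bd: "bdd_above (range (\<lambda>n. \<theta> n y))" using \<theta>01(2) by (auto intro!: bdd_aboveI[of _ 1])
      show "(SUP n. \<theta> n y) \<le> 1" using \<theta>01(2) by (intro cSUP_least) auto
      have "s y \<le> s y * (SUP n. \<theta> n y)"
      proof -
        have "coord n y \<le> s y * (SUP n. \<theta> n y)" for n
          unfolding s_\<theta>[symmetric, of n y] by (intro mult_left_mono s01 cSUP_upper bd) auto
        then show ?thesis by (subst s_def) (auto intro!: cSUP_least)
      qed
      then show "1 \<le> (SUP n. \<theta> n y)" using that s01(1)[of y] by simp
    qed
    ultimately have "AE y in D. (SUP n. coord n (e y)) = 1" by (auto simp: coord_e)
    moreover have "{y \<in> space borel. s y = 1} \<in> sets borel" by measurable
    ultimately show "AE y in distr D borel e. (SUP n. coord n y) = 1"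
      by (subst AE_distr_iff) (simp_all add: s_def)
    fix F :: "nat set" and b :: "nat \<Rightarrow> real"
    assume F: "finite F" "F \<noteq> {}" "\<forall>n\<in>F. 0 < b n"
    have meas: "(\<lambda>y. MAX n\<in>F. b n * coord n y) \<in> borel_measurable borel"
      "(\<lambda>y. MAX n\<in>F. b n * \<theta> n y) \<in> borel_measurable borel"
      using F by measurable
    have "(\<integral>y. (MAX n\<in>F. b n * coord n y) \<partial>distr D borel e) = (\<integral>y. (MAX n\<in>F. b n * \<theta> n y) \<partial>D)"
      by (subst integral_distr) (use meas in \<open>auto simp: coord_e\<close>)
    also have "\<dots> = (\<integral>y. s y * (MAX n\<in>F. b n * \<theta> n y) \<partial>m)"
      unfolding D_def using s01 meas by (subst integral_density) (auto simp: measurable_cong_sets[OF sets_m refl])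
    also have "\<dots> = (\<integral>y. (MAX n\<in>F. b n * coord n y) \<partial>m)"
    proof -
      have "s y * (MAX n\<in>F. b n * \<theta> n y) = (MAX n\<in>F. b n * coord n y)" for y
        unfolding MAX_mult_left[OF F(1,2) s01(1)] by (simp add: mult.left_commute[of "s y"] s_\<theta>)
      then show ?thesis by simp
    qed
    finally show "(\<integral>y. (MAX n\<in>F. b n * coord n y) \<partial>distr D borel e) = (\<integral>y. (MAX n\<in>F. b n * coord n y) \<partial>m)" .
  qed simp
qed

section \<open>Measures on the line in standardized form\<close>

lemma emeasure_count_space_image_inj:
  assumes "inj_on f A"
  shows "emeasure (count_space UNIV) (f ` A) = emeasure (count_space UNIV) A"
  using assms by (cases "finite A") (simp_all add: card_image finite_image_iff)

text \<open>The induction runs over Borel functions on the whole line, since a function on the standardized space need not be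
Borel outside of it, where the Lebesgue integral on the right-hand side is taken.\<close>

lemma nn_integral_std_measure:
  assumes "f \<in> borel_measurable (std_measure I N)"
  shows "(\<integral>\<^sup>+s. f s \<partial>std_measure I N) =
    (if I = 1 then \<integral>\<^sup>+s. f s * indicator {0<..<1} s \<partial>lborel else 0)
    + (\<Sum>k. if 1 \<le> k \<and> enat k \<le> N then f (real k) else 0)"
proof -
  define K where "K = {k. 1 \<le> k \<and> enat k \<le> N}"
  define J where "J = (if I = 1 then {0<..<1::real} else {})"
  have S: "std_set I N = J \<union> real ` K" by (simp add: std_set_def K_def J_def)
  have J_meas [measurable]: "J \<in> sets borel" by (simp add: J_def)
  have disj: "J \<inter> real ` K = {}" by (auto simp: J_def K_def)
  have borel_case: "(\<integral>\<^sup>+s. g s \<partial>std_measure I N) =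
      (\<integral>\<^sup>+s. g s * indicator J s \<partial>lborel) + (\<integral>\<^sup>+k. g (real k) * indicator K k \<partial>count_space UNIV)"
    if "g \<in> borel_measurable borel" for g :: "real \<Rightarrow> ennreal"
    using that
  proof (induction g rule: borel_measurable_induct)
    case (cong f g)
    then have "f = g" by auto
    then show ?case using cong by simp
  next
    case (set A)
    have "A \<inter> std_set I N \<in> sets (std_measure I N)"
      using set by (simp add: sets_restrict_space_iff)
    moreover have "(\<integral>\<^sup>+s. indicator A s \<partial>std_measure I N) = (\<integral>\<^sup>+s. indicator (A \<inter> std_set I N) s \<partial>std_measure I N)"
      by (intro nn_integral_cong) (simp add: indicator_def)
    ultimately have "(\<integral>\<^sup>+s. indicator A s \<partial>std_measure I N) =
       emeasure lborel (A \<inter> std_set I N \<inter> {0<..<1}) + emeasure (count_space UNIV) (A \<inter> std_set I N \<inter> \<nat>)"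
      by (simp add: emeasure_std_measure)
    also have "A \<inter> std_set I N \<inter> {0<..<1} = A \<inter> J" by (auto simp: S J_def K_def)
    also have "A \<inter> std_set I N \<inter> \<nat> = real ` {k\<in>K. real k \<in> A}"
      by (auto simp: S J_def K_def Nats_def)
    also have "emeasure (count_space UNIV) (real ` {k\<in>K. real k \<in> A}) = emeasure (count_space UNIV) {k\<in>K. real k \<in> A}"
      by (rule emeasure_count_space_image_inj) simp
    also have "emeasure lborel (A \<inter> J) = (\<integral>\<^sup>+s. indicator A s * indicator J s \<partial>lborel)"
      using set by (simp add: indicator_inter_arith[symmetric])
    also have "emeasure (count_space UNIV) {k\<in>K. real k \<in> A}
        = (\<integral>\<^sup>+k. indicator A (real k) * indicator K k \<partial>count_space UNIV)"
    proof -
      have "indicator A (real k) * indicator K k = (indicator {k\<in>K. real k \<in> A} k :: ennreal)" for k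
        by (auto split: split_indicator)
      then show ?thesis by simp
    qed
    finally show ?case .
  next
    case (mult u c)
    have [measurable]: "u \<in> borel_measurable (std_measure I N)"
      using mult(2) by (simp add: measurable_cong_sets[OF sets_std_measure refl] measurable_restrict_space1)
    show ?case using mult
      by (simp add: nn_integral_cmult mult.assoc distrib_left)
  next
    case (add u v)
    have [measurable]: "u \<in> borel_measurable (std_measure I N)" "v \<in> borel_measurable (std_measure I N)"
      using add by (simp_all add: measurable_cong_sets[OF sets_std_measure refl] measurable_restrict_space1)
    show ?case using add
      by (simp add: nn_integral_add distrib_right add.assoc add.left_commute)
  next
    case (seq U)
    have [measurable]: "U i \<in> borel_measurable (std_measure I N)" for i
      using seq by (simp add: measurable_cong_sets[OF sets_std_measure refl] measurable_restrict_space1)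
    have inc: "incseq (\<lambda>i s. U i s * indicator J s)" "incseq (\<lambda>i k. U i (real k) * indicator K k)"
      using seq(3) by (auto simp: incseq_def le_fun_def intro!: mult_right_mono)
    have "(\<integral>\<^sup>+s. (SUP i. U i s) \<partial>std_measure I N) = (SUP i. \<integral>\<^sup>+s. U i s \<partial>std_measure I N)"
      using seq by (intro nn_integral_monotone_convergence_SUP) auto
    also have "\<dots> = (SUP i. (\<integral>\<^sup>+s. U i s * indicator J s \<partial>lborel) + (\<integral>\<^sup>+k. U i (real k) * indicator K k \<partial>count_space UNIV))"
      by (simp add: seq)
    also have "\<dots> = (SUP i. \<integral>\<^sup>+s. U i s * indicator J s \<partial>lborel) + (SUP i. \<integral>\<^sup>+k. U i (real k) * indicator K k \<partial>count_space UNIV)"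
      using inc by (intro ennreal_SUP_add) (auto simp: incseq_def le_fun_def intro!: nn_integral_mono)
    also have "(SUP i. \<integral>\<^sup>+s. U i s * indicator J s \<partial>lborel) = (\<integral>\<^sup>+s. (SUP i. U i s * indicator J s) \<partial>lborel)"
      using seq inc by (intro nn_integral_monotone_convergence_SUP[symmetric]) auto
    also have "(SUP i. \<integral>\<^sup>+k. U i (real k) * indicator K k \<partial>count_space UNIV) = (\<integral>\<^sup>+k. (SUP i. U i (real k) * indicator K k) \<partial>count_space UNIV)"
      using inc by (intro nn_integral_monotone_convergence_SUP[symmetric]) auto
    finally show ?case by (simp add: SUP_mult_right_ennreal image_comp)
  qed
  define g where "g s = (if s \<in> std_set I N then f s else 0)" for s
  have "g \<in> borel_measurable borel"
    unfolding g_def[abs_def] using assms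
    by (simp add: measurable_restrict_space_iff[symmetric] measurable_cong_sets[OF sets_std_measure refl])
  note borel_case[OF this]
  moreover have "(\<integral>\<^sup>+s. g s \<partial>std_measure I N) = (\<integral>\<^sup>+s. f s \<partial>std_measure I N)"
    by (intro nn_integral_cong) (simp add: g_def)
  moreover have "(\<integral>\<^sup>+s. g s * indicator J s \<partial>lborel) = (if I = 1 then \<integral>\<^sup>+s. f s * indicator {0<..<1} s \<partial>lborel else 0)"
    by (auto intro!: nn_integral_cong simp: g_def J_def S split: split_indicator)
  moreover have "(\<integral>\<^sup>+k. g (real k) * indicator K k \<partial>count_space UNIV) = (\<Sum>k. if 1 \<le> k \<and> enat k \<le> N then f (real k) else 0)"
    by (subst nn_integral_count_space_nat) (auto intro!: suminf_cong simp: g_def S K_def)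
  ultimately show ?thesis by simp
qed

text \<open>On the interval \<open>G\<close> is the quantile function \<open>q\<close> of the diffuse part of \<open>m\<close>, and on the natural numbers it enumerates the atoms.
The distribution function \<open>F\<close> of the diffuse part is continuous, hence a left inverse of \<open>q\<close>: this is why \<open>G\<close>
loses no set. The last clause says that \<open>G\<close> generates the \<open>\<sigma>\<close>-algebra of the standardized
space up to null sets; it is what turns a generating family for \<open>m\<close> into one for the standardized measure.\<close>

lemma std_measure_standardizes:
  fixes m :: "real measure"
  assumes "finite_measure m" and sets_m: "sets m = sets borel"
  obtains I N G w where "I \<in> {0, 1::nat}" "G \<in> borel_measurable (std_measure I N)"
    "w \<in> borel_measurable (std_measure I N)" "\<And>s. 0 < (w s :: real)"
    "distr (density (std_measure I N) (\<lambda>s. ennreal (w s))) borel G = m"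
    "\<And>B. B \<in> sets (std_measure I N) \<Longrightarrow>
       \<exists>C\<in>sets borel. AE s in std_measure I N. s \<in> B \<longleftrightarrow> G s \<in> C"
proof -
  interpret finite_measure m by fact
  have sp_m: "space m = UNIV" using sets_eq_imp_space_eq[OF sets_m] by simp
  define At where "At = {x. measure m {x} \<noteq> 0}"
  have At_countable: "countable At" unfolding At_def by (rule countable_support)
  have At_borel [measurable]: "At \<in> sets borel" by (rule sets.countable) (use At_countable in auto)
  define N where "N = (if finite At then enat (card At) else \<infinity>)"
  define K where "K = {k. 1 \<le> k \<and> enat k \<le> N}"
  obtain p where p: "bij_betw p K At"
  proof (cases "finite At")
    case True
    have "K = {1..card At}" using True by (auto simp: K_def N_def)
    then have "card K = card At" "finite K" by auto
    then show thesis using finite_same_card_bij[of K At] True that by auto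
  next
    case False
    have "K = {1..}" using False by (auto simp: K_def N_def)
    moreover have "bij_betw (\<lambda>k. k - 1) {1..} (UNIV::nat set)"
      by (rule bij_betwI[where g = Suc]) auto
    ultimately show thesis
      using bij_betw_trans[OF _ bij_betw_from_nat_into[OF At_countable False]] that by auto
  qed
  have p_mem: "k \<in> K \<Longrightarrow> p k \<in> At" for k using p by (auto simp: bij_betw_def)
  define mc where "mc = measure m (- At)"
  define I :: nat where "I = (if mc = 0 then 0 else 1)"
  \<comment> \<open>Without a diffuse part \<open>I = 0\<close>, and \<open>q\<close> and \<open>F\<close> are arbitrary.\<close>
  obtain q and F :: "real \<Rightarrow> real" where q_meas: "q \<in> borel_measurable (restrict_space borel {0<..<1::real})"
    and F_meas: "F \<in> borel_measurable borel"
    and q: "\<And>A. mc \<noteq> 0 \<Longrightarrow> A \<in> sets borel \<Longrightarrow>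
         ennreal mc * emeasure lborel {s\<in>{0<..<1}. q s \<in> A} = emeasure m (A - At)"
      "\<And>s. mc \<noteq> 0 \<Longrightarrow> s \<in> {0<..<1} \<Longrightarrow> F (q s) = s"
  proof (cases "mc = 0")
    case True
    then show thesis by (intro that[of "\<lambda>_. 0" "\<lambda>_. 0"]) auto
  next
    case False
    then have mc: "0 < mc" by (simp add: mc_def zero_less_measure_iff)
    define M where "M = density m (\<lambda>x. ennreal (indicator (- At) x / mc))"
    have M_emeasure: "emeasure M A = emeasure m (A - At) / ennreal mc" if "A \<in> sets borel" for A
    proof -
      have "emeasure M A = (\<integral>\<^sup>+x. ennreal (1 / mc) * indicator (A - At) x \<partial>m)"
        unfolding M_def using that At_borel sets_m
        by (subst emeasure_density) (auto intro!: nn_integral_cong split: split_indicator simp: measurable_cong_sets[OF sets_m refl])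
      also have "\<dots> = ennreal (1 / mc) * emeasure m (A - At)"
        using that At_borel sets_m by (subst nn_integral_cmult_indicator) auto
      finally show ?thesis using mc by (simp add: divide_ennreal_def inverse_ennreal inverse_eq_divide mult.commute)
    qed
    have "prob_space M"
    proof (rule prob_spaceI)
      have "emeasure M UNIV = ennreal mc / ennreal mc"
        by (subst M_emeasure) (auto simp: mc_def emeasure_eq_measure Compl_eq_Diff_UNIV)
      then show "emeasure M (space M) = 1"
        using mc by (simp add: M_def sp_m ennreal_divide_self)
    qed
    then have "real_distribution M"
      by (simp add: real_distribution_def real_distribution_axioms_def M_def sets_m sp_m)
    then interpret M: cdf_distribution M by (simp add: cdf_distribution_def)
    have atomless: "measure M {x} = 0" for x
    proof (cases "x \<in> At")
      case False
      then have "{x} - At = {x}" by auto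
      then have "emeasure M {x} = 0" using M_emeasure[of "{x}"] False
        by (simp add: At_def emeasure_eq_measure)
      then show ?thesis by (simp add: M.emeasure_eq_measure)
    next
      case True
      then have "{x} - At = {}" by auto
      then have "emeasure M {x} = 0" using M_emeasure[of "{x}"] by simp
      then show ?thesis by (simp add: M.emeasure_eq_measure)
    qed
    show thesis
    proof (rule that[of M.I "cdf M"])
      show "M.I \<in> borel_measurable (restrict_space borel {0<..<1})" by simp
      show "cdf M \<in> borel_measurable borel" by simp
      fix A :: "real set" assume A: "A \<in> sets borel"
      have "emeasure M A = emeasure (restrict_space lborel {0<..<1}) (M.I -` A \<inter> {0<..<1})"
        using A by (subst M.distr_I_eq_M[symmetric], subst emeasure_distr)
          (auto simp: space_restrict_space measurable_cong_sets[OF sets_restrict_space_cong[OF sets_lborel] refl])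
      also have "\<dots> = emeasure lborel {s\<in>{0<..<1}. M.I s \<in> A}"
        by (subst emeasure_restrict_space) (auto intro!: arg_cong2[where f=emeasure])
      finally have eq: "emeasure lborel {s\<in>{0<..<1}. M.I s \<in> A} = emeasure m (A - At) / ennreal mc"
        using A by (simp add: M_emeasure)
      show "ennreal mc * emeasure lborel {s\<in>{0<..<1}. M.I s \<in> A} = emeasure m (A - At)"
        unfolding eq using mc
        by (simp add: ennreal_times_divide mult.commute[of "ennreal mc"] ennreal_mult_divide_eq)
    next
      fix s :: real assume s: "s \<in> {0<..<1}"
      \<comment> \<open>A quantile always satisfies \<open>s \<le> cdf M (M.I s)\<close>; equality needs the absence of atoms.\<close>
      show "cdf M (M.I s) = s"
      proof (rule antisym)
        show "s \<le> cdf M (M.I s)" using M.pseudoinverse'[rule_format, OF s, of "M.I s"] by simp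
        have "isCont (cdf M) (M.I s)" using atomless by (simp add: M.isCont_cdf)
        then have "(cdf M \<longlongrightarrow> cdf M (M.I s)) (at_left (M.I s))"
          by (simp add: continuous_at_imp_continuous_within continuous_within isCont_def filterlim_at_split)
        then show "cdf M (M.I s) \<le> s"
        proof (rule tendsto_upperbound)
          show "\<forall>\<^sub>F x in at_left (M.I s). cdf M x \<le> s"
          proof (rule eventually_at_leftI[of "M.I s - 1"])
            fix x assume "x \<in> {M.I s - 1<..<M.I s}"
            then have "\<not> s \<le> cdf M x" using M.pseudoinverse'[rule_format, OF s, of x] by simp
            then show "cdf M x \<le> s" by simp
          qed simp
        qed simp
      qed
    qed
  qed
  define G where "G s = (if s \<in> {0<..<1} then q s else p (nat \<lfloor>s\<rfloor>))" for s :: real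
  define w where "w s = (if s \<in> {0<..<1} then (if mc = 0 then 1 else mc)
      else if s \<in> real ` K then measure m {p (nat \<lfloor>s\<rfloor>)} else 1)" for s :: real
  have mc_nonneg: "0 \<le> mc" by (simp add: mc_def)
  have G_nat: "G (real k) = p k" and w_nat: "k \<in> K \<Longrightarrow> w (real k) = measure m {p k}" if "1 \<le> k" for k
    using that by (auto simp: G_def w_def)
  have w_pos: "0 < w s" for s
  proof -
    have "0 < measure m {p k}" if "k \<in> K" for k
      using p_mem[OF that] by (simp add: At_def zero_less_measure_iff)
    then show ?thesis using mc_nonneg by (auto simp: w_def)
  qed
  have std_set_K: "std_set I N = (if I = 1 then {0<..<1} else {}) \<union> real ` K"
    by (simp add: std_set_def K_def)
  have restr_meas: "h \<in> borel_measurable (std_measure I N)"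
    if "h \<in> borel_measurable (restrict_space borel {0<..<1})" for h :: "real \<Rightarrow> real"
  proof (rule measurableI)
    fix A :: "real set" assume A: "A \<in> sets borel"
    have "h -` A \<inter> {0<..<1} \<in> sets borel"
      using measurable_sets[OF that A] by (simp add: sets_restrict_space_iff space_restrict_space)
    moreover have "h -` A \<inter> real ` K \<in> sets borel" by (rule sets.countable) auto
    ultimately have "(h -` A \<inter> {0<..<1}) \<inter> std_set I N \<union> h -` A \<inter> real ` K \<in> sets borel" by auto
    also have "(h -` A \<inter> {0<..<1}) \<inter> std_set I N \<union> h -` A \<inter> real ` K = h -` A \<inter> std_set I N"
      by (auto simp: std_set_K)
    finally show "h -` A \<inter> space (std_measure I N) \<in> sets (std_measure I N)"
      by (simp add: sets_restrict_space_iff)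
  qed simp
  have G_meas: "G \<in> borel_measurable (std_measure I N)"
  proof (rule restr_meas)
    show "G \<in> borel_measurable (restrict_space borel {0<..<1})"
      using q_meas by (rule measurable_cong[THEN iffD1, rotated]) (simp add: G_def space_restrict_space)
  qed
  have w_meas: "w \<in> borel_measurable (std_measure I N)"
  proof (rule restr_meas)
    have "(\<lambda>_. if mc = 0 then 1 else mc) \<in> borel_measurable (restrict_space borel {0<..<1::real})" by simp
    then show "w \<in> borel_measurable (restrict_space borel {0<..<1})"
      by (rule measurable_cong[THEN iffD1, rotated]) (simp add: w_def space_restrict_space)
  qed
  have "distr (density (std_measure I N) (\<lambda>s. ennreal (w s))) borel G = m"
  proof (rule measure_eqI)
    fix A assume "A \<in> sets (distr (density (std_measure I N) (\<lambda>s. ennreal (w s))) borel G)"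
    then have A: "A \<in> sets borel" by simp
    let ?B = "G -` A \<inter> std_set I N"
    have B: "?B \<in> sets (std_measure I N)"
      using measurable_sets[OF G_meas A] by simp
    have "emeasure (distr (density (std_measure I N) (\<lambda>s. ennreal (w s))) borel G) A
        = (\<integral>\<^sup>+s. ennreal (w s) * indicator ?B s \<partial>std_measure I N)"
      using A G_meas w_meas B by (simp add: emeasure_distr emeasure_density)
    also have "\<dots> = (if I = 1 then \<integral>\<^sup>+s. ennreal (w s) * indicator ?B s * indicator {0<..<1} s \<partial>lborel else 0)
        + (\<Sum>k. if 1 \<le> k \<and> enat k \<le> N then ennreal (w (real k)) * indicator ?B (real k) else 0)"
      using w_meas B by (intro nn_integral_std_measure borel_measurable_times_ennreal
        borel_measurable_indicator measurable_compose[OF _ measurable_ennreal])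
    also have "(if I = 1 then \<integral>\<^sup>+s. ennreal (w s) * indicator ?B s * indicator {0<..<1} s \<partial>lborel else 0)
        = emeasure m (A - At)"
    proof (cases "I = 1")
      case True
      then have "mc \<noteq> 0" by (auto simp: I_def split: if_splits)
      have "{s\<in>{0<..<1}. q s \<in> A} \<in> sets lborel"
        using measurable_sets[OF q_meas A]
        by (auto simp: sets_restrict_space_iff space_restrict_space vimage_def Int_def conj_commute)
      then have "(\<integral>\<^sup>+s. ennreal mc * indicator {s\<in>{0<..<1}. q s \<in> A} s \<partial>lborel) = emeasure m (A - At)"
        using q(1)[OF \<open>mc \<noteq> 0\<close> A] by (simp add: nn_integral_cmult_indicator)
      moreover have "(\<integral>\<^sup>+s. ennreal (w s) * indicator ?B s * indicator {0<..<1} s \<partial>lborel)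
          = (\<integral>\<^sup>+s. ennreal mc * indicator {s\<in>{0<..<1}. q s \<in> A} s \<partial>lborel)"
        using True \<open>mc \<noteq> 0\<close> std_set_K
        by (intro nn_integral_cong) (auto simp: w_def G_def split: split_indicator)
      ultimately show ?thesis using True by simp
    next
      case False
      then have "mc = 0" by (auto simp: I_def split: if_splits)
      have "emeasure m (A - At) \<le> emeasure m (- At)"
        using A At_borel sets_m by (intro emeasure_mono) auto
      then show ?thesis using False \<open>mc = 0\<close> by (simp add: mc_def emeasure_eq_measure measure_le_0_iff)
    qed
    also have "(\<Sum>k. if 1 \<le> k \<and> enat k \<le> N then ennreal (w (real k)) * indicator ?B (real k) else 0)
        = emeasure m (A \<inter> At)"
    proof -
      have "(\<Sum>k. if 1 \<le> k \<and> enat k \<le> N then ennreal (w (real k)) * indicator ?B (real k) else 0)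
        = (\<integral>\<^sup>+k. (if k \<in> K then ennreal (w (real k)) * indicator ?B (real k) else 0) \<partial>count_space UNIV)"
        by (subst nn_integral_count_space_nat) (simp add: K_def)
      also have "\<dots> = (\<integral>\<^sup>+k. emeasure m ({p k} \<inter> A) \<partial>count_space K)"
        by (subst nn_integral_count_space_indicator[of K]) 
          (auto intro!: nn_integral_cong split: split_indicator simp: w_nat G_nat K_def std_set_K emeasure_eq_measure)
      also have "\<dots> = (\<integral>\<^sup>+x. emeasure m ({x} \<inter> A) \<partial>count_space At)"
        by (rule nn_integral_bij_count_space[OF p])
      also have "\<dots> = emeasure m (\<Union>x\<in>At. {x} \<inter> A)"
        using At_countable A sets_m
        by (intro emeasure_UN_countable[symmetric]) (auto simp: disjoint_family_on_def)
      also have "(\<Union>x\<in>At. {x} \<inter> A) = A \<inter> At" by auto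
      finally show ?thesis .
    qed
    also have "emeasure m (A - At) + emeasure m (A \<inter> At) = emeasure m A"
      using A At_borel sets_m by (subst plus_emeasure) (auto intro!: arg_cong[where f="emeasure m"])
    finally show "emeasure (distr (density (std_measure I N) (\<lambda>s. ennreal (w s))) borel G) A = emeasure m A" .
  qed (simp add: sets_m)
  moreover have "\<exists>C\<in>sets borel. AE s in std_measure I N. s \<in> B \<longleftrightarrow> G s \<in> C"
    if B: "B \<in> sets (std_measure I N)" for B
  proof -
    define C where "C = (F -` (B \<inter> {0<..<1}) - At) \<union> p ` {k\<in>K. real k \<in> B}"
    have B_borel: "B \<inter> {0<..<1} \<in> sets borel"
      using B by (auto simp: sets_restrict_space_iff)
    have "p ` {k\<in>K. real k \<in> B} \<in> sets borel" by (rule sets.countable) auto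
    moreover have "F -` (B \<inter> {0<..<1}) \<in> sets borel"
      using measurable_sets[OF F_meas B_borel] by simp
    ultimately have C_sets: "C \<in> sets borel" unfolding C_def by auto
    have "AE s in std_measure I N. s \<in> B \<longleftrightarrow> G s \<in> C"
    proof (rule AE_I')
      \<comment> \<open>On the interval \<open>G\<close> may hit an atom of \<open>m\<close>, but only on a null set, as the diffuse part does not charge atoms.\<close>
      let ?N = "{s\<in>{0<..<1}. q s \<in> At} \<inter> std_set I N"
      have "?N = (G -` At \<inter> std_set I N) \<inter> {0<..<1}" by (auto simp: G_def)
      moreover have "G -` At \<inter> std_set I N \<in> sets (std_measure I N)"
        using measurable_sets[OF G_meas At_borel] by simp
      ultimately have N_sets: "?N \<in> sets (std_measure I N)"
        by (auto simp: sets_restrict_space_iff)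
      have "emeasure lborel (?N \<inter> {0<..<1}) = 0"
      proof (cases "I = 1")
        case True
        then have "mc \<noteq> 0" by (auto simp: I_def split: if_splits)
        have "ennreal mc * emeasure lborel {s\<in>{0<..<1}. q s \<in> At} = 0"
          using q(1)[OF \<open>mc \<noteq> 0\<close> At_borel] by simp
        moreover have "?N \<inter> {0<..<1} = {s\<in>{0<..<1}. q s \<in> At}" using True std_set_K by auto
        ultimately show ?thesis using \<open>mc \<noteq> 0\<close> mc_nonneg by simp
      next
        case False
        then have "?N = {}" by (auto simp: std_set_K)
        then show ?thesis by simp
      qed
      moreover have "?N \<inter> \<nat> = {}" by (auto simp: Nats_def)
      ultimately show "?N \<in> null_sets (std_measure I N)"
        using N_sets by (simp add: null_sets_def emeasure_std_measure)
      show "{s \<in> space (std_measure I N). \<not> (s \<in> B \<longleftrightarrow> G s \<in> C)} \<subseteq> ?N"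
      proof (rule subsetI)
        have main: "s \<in> B \<longleftrightarrow> G s \<in> C" if s: "s \<in> std_set I N" "\<not> (s \<in> {0<..<1} \<and> q s \<in> At)" for s
        proof (cases "s \<in> {0<..<1}")
          case True
          then have "mc \<noteq> 0" using s(1) unfolding std_set_K by (auto simp: I_def K_def split: if_splits)
          have "q s \<notin> p ` {k\<in>K. real k \<in> B}" using True s p_mem by auto
          then show ?thesis using True s q(2)[OF \<open>mc \<noteq> 0\<close> True] by (auto simp: C_def G_def)
        next
          case False
          then obtain k where k: "s = real k" "k \<in> K" using s by (auto simp: std_set_K split: if_splits)
          then have "G s = p k" using G_nat[of k] by (auto simp: K_def)
          moreover have "p k \<in> p ` {k\<in>K. real k \<in> B} \<longleftrightarrow> real k \<in> B"
            using p k(2) by (auto simp: bij_betw_def inj_on_def)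
          ultimately show ?thesis using p_mem[OF k(2)] k by (auto simp: C_def)
        qed
        show "s \<in> ?N" if "s \<in> {s \<in> space (std_measure I N). \<not> (s \<in> B \<longleftrightarrow> G s \<in> C)}" for s
          using that main[of s] by auto
      qed
    qed
    with C_sets show ?thesis by blast
  qed
  moreover have "I \<in> {0, 1}" by (simp add: I_def)
  ultimately show thesis
    using G_meas w_meas w_pos by (intro that[of I G N w])
qed

section \<open>Poisson points\<close>

text \<open>The function \<open>x \<mapsto> exp (- x)\<close> on \<open>[0, \<infinity>]\<close>, the probability that a Poisson variable of mean \<open>x\<close> vanishes.\<close>

definition ennexp :: "ennreal \<Rightarrow> real" where
  "ennexp x = (if x = \<infinity> then 0 else exp (- enn2real x))"

lemma ennexp_ennreal [simp]: "0 \<le> x \<Longrightarrow> ennexp (ennreal x) = exp (- x)"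
  by (simp add: ennexp_def)

lemma ennexp_0 [simp]: "ennexp 0 = 1" and ennexp_top [simp]: "ennexp \<top> = 0"
  by (simp_all add: ennexp_def)

lemma ennexp_add: "ennexp (x + y) = ennexp x * ennexp y"
  by (cases x; cases y) (auto simp: ennexp_def exp_add[symmetric] simp flip: ennreal_plus)

lemma ennexp_sum: "ennexp (\<Sum>i\<in>J. x i) = (\<Prod>i\<in>J. ennexp (x i))"
  by (induction J rule: infinite_finite_induct) (auto simp: ennexp_add)

lemma ennexp_suminf: "(\<lambda>n. \<Prod>i\<le>n. ennexp (x i)) \<longlonglongrightarrow> ennexp (\<Sum>i. x i)"
proof -
  have lim: "(\<lambda>n. \<Sum>i\<le>n. x i) \<longlonglongrightarrow> (\<Sum>i. x i)"
    by (rule summable_LIMSEQ') simp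
  have "(\<lambda>n. ennexp (\<Sum>i\<le>n. x i)) \<longlonglongrightarrow> ennexp (\<Sum>i. x i)"
  proof (cases "(\<Sum>i. x i) = \<infinity>")
    case True
    show ?thesis unfolding True
    proof (rule LIMSEQ_I)
      fix r :: real assume r: "0 < r"
      have "\<forall>\<^sub>F n in sequentially. ennreal (- ln r) < (\<Sum>i\<le>n. x i)"
        using lim unfolding True by (rule order_tendstoD) simp
      then obtain N where N: "\<And>n. N \<le> n \<Longrightarrow> ennreal (- ln r) < (\<Sum>i\<le>n. x i)"
        by (auto simp: eventually_sequentially)
      show "\<exists>no. \<forall>n\<ge>no. norm (ennexp (\<Sum>i\<le>n. x i) - ennexp \<infinity>) < r"
      proof (intro exI allI impI)
        fix n assume "N \<le> n"
        show "norm (ennexp (\<Sum>i\<le>n. x i) - ennexp \<infinity>) < r"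
        proof (cases "\<Sum>i\<le>n. x i")
          case (real t)
          then have "- ln r < t" using N[OF \<open>N \<le> n\<close>] by (simp add: ennreal_less_iff)
            (metis ennreal_less_iff ennreal_neg less_eq_real_def not_le order_less_le_trans)
          then have "exp (- t) < exp (ln r)" by (subst exp_less_cancel_iff) simp
          then show ?thesis using real r by simp
        next
          case top
          show ?thesis unfolding top using r by simp
        qed
      qed
    qed
  next
    case False
    then have fin: "(\<Sum>i\<le>n. x i) \<noteq> \<infinity>" for n
      by (metis infinity_ennreal_def neq_top_trans sum_le_suminf finite_atMost summableI zero_le)
    obtain t where t: "(\<Sum>i. x i) = ennreal t" "0 \<le> t" using False by (cases "\<Sum>i. x i") auto
    have "(\<lambda>n. exp (- enn2real (\<Sum>i\<le>n. x i))) \<longlonglongrightarrow> exp (- enn2real (\<Sum>i. x i))"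
      using lim t by (intro tendsto_exp tendsto_minus tendsto_enn2real) auto
    then show ?thesis using False fin by (simp add: ennexp_def)
  qed
  then show ?thesis by (simp add: ennexp_sum)
qed

lemma ennexp_bounds: "ennexp x \<le> 1" "0 \<le> ennexp x"
  by (auto simp: ennexp_def)

text \<open>A Poisson process on the product of \<open>\<kappa>\<close> with Lebesgue measure on the unit interval from \<open>j\<close> to \<open>j + 1\<close>: a
Poisson number \<open>n\<close> together with an infinite sequence of independent points, of which the first \<open>n\<close> are used.\<close>

definition poisson_cell :: "real measure \<Rightarrow> nat \<Rightarrow> (nat \<times> (nat \<Rightarrow> real \<times> real)) measure" where
  "poisson_cell \<kappa> j = measure_pmf (poisson_pmf 1) \<Otimes>\<^sub>M
     (\<Pi>\<^sub>M i\<in>UNIV. \<kappa> \<Otimes>\<^sub>M uniform_measure lborel {real j<..<real j + 1})"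

text \<open>The length of the interval from 0 to \<open>x\<close>, cut at the integers.\<close>

lemma suminf_min_1_minus: "(\<Sum>j. min 1 (x - of_nat j)) = (x :: ennreal)"
proof -
  have partial: "(\<Sum>j<n. min 1 (x - of_nat j)) = min (of_nat n) x" for n
  proof (induction n)
    case (Suc n)
    have "min (of_nat n) x + min 1 (x - of_nat n) = min (of_nat (Suc n)) x"
    proof (cases x)
      case (real t)
      have "x - of_nat n = ennreal (t - real n)"
        using real by (simp add: ennreal_minus ennreal_of_nat_eq_real_of_nat)
      then have "min (of_nat n) x + min 1 (x - of_nat n)
          = ennreal (min (real n) t) + ennreal (max 0 (min 1 (t - real n)))"
        using real by (auto simp: min_def max_def ennreal_neg ennreal_of_nat_eq_real_of_nat simp flip: ennreal_1)
      also have "\<dots> = ennreal (min (real n) t + max 0 (min 1 (t - real n)))"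
        using real by (intro ennreal_plus[symmetric]) auto
      also have "min (real n) t + max 0 (min 1 (t - real n)) = min (real (Suc n)) t"
        by (auto simp: min_def max_def)
      also have "\<dots> = min (of_nat (Suc n)) x"
        unfolding real(2) ennreal_of_nat_eq_real_of_nat
        using real by (auto simp: min_def simp del: of_nat_Suc)
      finally show ?thesis .
    qed (simp add: top_add ennreal_top_minus min_def)
    then show ?case using Suc by simp
  qed simp
  have "(\<lambda>n. min (of_nat n) x) \<longlonglongrightarrow> min \<top> x"
    by (intro tendsto_min tendsto_const of_nat_tendsto_top_ennreal)
  then have "(\<lambda>n. \<Sum>j<n. min 1 (x - of_nat j)) \<longlonglongrightarrow> x" by (simp add: partial)
  then show ?thesis using LIMSEQ_unique[OF summable_LIMSEQ[OF summableI]] by blast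
qed

text \<open>If a single point hits the forbidden region, which lies below the graph of \<open>\<phi>\<close>, with probability \<open>b\<close>, then the
probability that none of a Poisson number of points does is the sum of \<open>exp (-1) * (1 - b) ^ n / n!\<close>, that is
\<open>exp (- b)\<close>.\<close>

lemma poisson_cell_void:
  fixes \<kappa> :: "real measure" and \<phi> :: "real \<Rightarrow> ennreal" and j :: nat
  assumes "prob_space \<kappa>" and sets_\<kappa>: "sets \<kappa> = sets borel"
    and [measurable]: "\<phi> \<in> borel_measurable borel"
  defines "V \<equiv> {z\<in>space (poisson_cell \<kappa> j). \<forall>i<fst z. \<phi> (fst (snd z i)) \<le> ennreal (snd (snd z i))}"
  shows "V \<in> sets (poisson_cell \<kappa> j)" and "prob_space (poisson_cell \<kappa> j)"
    and "measure (poisson_cell \<kappa> j) V = ennexp (\<integral>\<^sup>+s. min 1 (\<phi> s - of_nat j) \<partial>\<kappa>)"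
proof -
  define U where "U = uniform_measure lborel {real j<..<real j + 1}"
  define E where "E = \<kappa> \<Otimes>\<^sub>M U"
  define R where "R = (\<Pi>\<^sub>M i\<in>(UNIV::nat set). E)"
  interpret \<kappa>: prob_space \<kappa> by fact
  interpret U: prob_space U unfolding U_def by (rule prob_space_uniform_measure) auto
  interpret E: pair_prob_space \<kappa> U ..
  have "prob_space E" unfolding E_def by (rule E.P.prob_space_axioms)
  interpret E': prob_space E by fact
  interpret R: product_prob_space "\<lambda>_. E" "UNIV :: nat set" ..
  have sets_U: "sets U = sets borel" by (simp add: U_def)
  have sets_E: "sets E = sets (borel \<Otimes>\<^sub>M borel)"
    unfolding E_def by (intro sets_pair_measure_cong sets_\<kappa> sets_U)
  have space_E: "space E = UNIV" using sets_eq_imp_space_eq[OF sets_E] by (simp add: space_pair_measure)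
  have cell: "poisson_cell \<kappa> j = measure_pmf (poisson_pmf 1) \<Otimes>\<^sub>M R"
    by (simp add: poisson_cell_def R_def E_def U_def)
  interpret N: prob_space "measure_pmf (poisson_pmf 1)" by (rule measure_pmf.prob_space_axioms)
  interpret R': prob_space R unfolding R_def by (rule R.P.prob_space_axioms)
  interpret C: pair_prob_space "measure_pmf (poisson_pmf 1)" R ..
  show "prob_space (poisson_cell \<kappa> j)" unfolding cell by (rule C.P.prob_space_axioms)
  define A where "A = {p. \<phi> (fst p) \<le> ennreal (snd p)}"
  have A_sets: "A \<in> sets E"
  proof -
    have "{p\<in>space (borel \<Otimes>\<^sub>M borel). \<phi> (fst p) \<le> ennreal (snd p)} \<in> sets (borel \<Otimes>\<^sub>M borel)"
      by measurable
    then show ?thesis by (simp add: sets_E A_def space_pair_measure)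
  qed
  have V: "V = (SIGMA n:UNIV. {p\<in>space R. \<forall>i<n. p i \<in> A})"
    unfolding V_def cell A_def by (simp add: space_pair_measure set_eq_iff)
  have slice: "{p\<in>space R. \<forall>i<n. p i \<in> A} \<in> sets R" for n
  proof -
    have "{p\<in>space R. p i \<in> A} \<in> sets R" for i
    proof -
      have "(\<lambda>p. p i) \<in> measurable R E"
        unfolding R_def by (rule measurable_component_singleton) simp
      from measurable_sets[OF this A_sets] show ?thesis
        by (simp add: vimage_def Int_def conj_commute)
    qed
    then have "{p\<in>space R. \<forall>i\<in>{..<n}. p i \<in> A} \<in> sets R"
      by (intro sets.sets_Collect_finite_All) auto
    then show ?thesis by (simp only: Ball_def lessThan_iff)
  qed
  show V_sets: "V \<in> sets (poisson_cell \<kappa> j)"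
  proof -
    have "(\<Union>n. {n} \<times> {p\<in>space R. \<forall>i<n. p i \<in> A}) \<in> sets (poisson_cell \<kappa> j)"
      unfolding cell by (intro sets.countable_UN image_subsetI pair_measureI slice) simp
    also have "(\<Union>n. {n} \<times> {p\<in>space R. \<forall>i<n. p i \<in> A}) = V" unfolding V by blast
    finally show ?thesis .
  qed
  define b where "b = (\<integral>\<^sup>+s. min 1 (\<phi> s - of_nat j) \<partial>\<kappa>)"
  have A_compl: "emeasure E (space E - A) = b"
  proof -
    have Ac: "space E - A = {p. ennreal (snd p) < \<phi> (fst p)}" by (auto simp: space_E A_def)
    have "emeasure E (space E - A) = (\<integral>\<^sup>+s. emeasure U (Pair s -` (space E - A)) \<partial>\<kappa>)"
      unfolding E_def using A_sets unfolding E_def by (intro U.emeasure_pair_measure_alt) auto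
    also have "\<dots> = (\<integral>\<^sup>+s. min 1 (\<phi> s - of_nat j) \<partial>\<kappa>)"
    proof (rule nn_integral_cong)
      fix s
      have "emeasure U (Pair s -` (space E - A)) = emeasure U {r. ennreal r < \<phi> s}"
        by (simp add: Ac vimage_def)
      also have "\<dots> = emeasure lborel ({real j<..<real j + 1} \<inter> {r. ennreal r < \<phi> s})"
      proof -
        have "{r\<in>space borel. ennreal r < \<phi> s} \<in> sets borel" by measurable
        then show ?thesis unfolding U_def
          by (subst emeasure_uniform_measure) (auto simp: divide_ennreal_def)
      qed
      also have "\<dots> = min 1 (\<phi> s - of_nat j)"
      proof (cases "\<phi> s")
        case (real t)
        have "{real j<..<real j + 1} \<inter> {r. ennreal r < \<phi> s} = {real j<..<min (real j + 1) t}"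
          using real by (auto simp: ennreal_less_iff)
        moreover have "\<phi> s - of_nat j = ennreal (t - real j)"
          using real by (simp add: ennreal_minus ennreal_of_nat_eq_real_of_nat)
        ultimately show ?thesis
          by (cases "real j \<le> t") (auto simp: min_def ennreal_neg simp flip: ennreal_1)
      qed (simp add: ennreal_top_minus)
      finally show "emeasure U (Pair s -` (space E - A)) = min 1 (\<phi> s - of_nat j)" .
    qed
    finally show ?thesis by (simp add: b_def)
  qed
  have b_real: "b = ennreal (1 - E'.prob A)"
    using A_compl E'.prob_compl[OF A_sets] by (simp add: E'.emeasure_eq_measure)
  have "emeasure (poisson_cell \<kappa> j) V = (\<integral>\<^sup>+n. emeasure R (Pair n -` V) \<partial>measure_pmf (poisson_pmf 1))"
    using V_sets unfolding cell by (rule R'.emeasure_pair_measure_alt)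
  also have "\<dots> = (\<integral>\<^sup>+n. ennreal (E'.prob A ^ n) \<partial>measure_pmf (poisson_pmf 1))"
  proof (rule nn_integral_cong)
    fix n
    have "Pair n -` V = {p\<in>space R. \<forall>i\<in>{..<n}. p i \<in> A}" unfolding V by auto
    also have "emeasure R \<dots> = (\<Prod>i\<in>{..<n}. emeasure E A)"
      unfolding R_def by (intro R.emeasure_PiM_Collect) (auto simp: A_sets)
    finally show "emeasure R (Pair n -` V) = ennreal (E'.prob A ^ n)"
      by (simp add: E'.emeasure_eq_measure ennreal_power)
  qed
  also have "\<dots> = (\<Sum>n. ennreal (exp (-1) * (E'.prob A ^ n / fact n)))"
    by (subst nn_integral_measure_pmf, subst nn_integral_count_space_nat)
      (auto intro!: suminf_cong simp: ennreal_mult[symmetric] field_simps)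
  also have "\<dots> = ennreal (exp (-1) * exp (E'.prob A))"
  proof (rule suminf_ennreal_eq)
    show "(\<lambda>n. exp (-1) * (E'.prob A ^ n / fact n)) sums (exp (-1) * exp (E'.prob A))"
      using exp_converges[of "E'.prob A"] by (intro sums_mult) (simp add: divide_inverse mult.commute)
  qed auto
  also have "exp (-1) * exp (E'.prob A) = ennexp b"
    unfolding b_real by (simp add: exp_add[symmetric] del: exp_of_nat_mult) 
  finally show "measure (poisson_cell \<kappa> j) V = ennexp (\<integral>\<^sup>+s. min 1 (\<phi> s - of_nat j) \<partial>\<kappa>)"
    by (simp add: measure_def b_def ennexp_bounds)
qed

lemma (in product_prob_space) measure_PiM_countable_box:
  assumes I: "I = (UNIV :: 'i set)" and g: "bij (g :: nat \<Rightarrow> 'i)" and E: "\<And>i. E i \<in> sets (M i)"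
  shows "(\<lambda>n. \<Prod>k\<le>n. measure (M (g k)) (E (g k))) \<longlonglongrightarrow>
      measure (PiM I M) {\<omega>\<in>space (PiM I M). \<forall>i. \<omega> i \<in> E i}"
    and "{\<omega>\<in>space (PiM I M). \<forall>i. \<omega> i \<in> E i} \<in> sets (PiM I M)"
proof -
  define S where "S n = {\<omega>\<in>space (PiM I M). \<forall>i\<in>g ` {..n}. \<omega> i \<in> E i}" for n
  have S_sets: "S n \<in> sets (PiM I M)" for n
    unfolding S_def I using E by measurable
  have inj: "inj_on g A" for A using g by (metis bij_betw_def inj_on_subset subset_UNIV)
  have "measure (PiM I M) (S n) = (\<Prod>k\<le>n. measure (M (g k)) (E (g k)))" for n
  proof -
    have "emeasure (PiM I M) (S n) = (\<Prod>i\<in>g ` {..n}. emeasure (M i) (E i))"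
      unfolding S_def using E by (intro emeasure_PiM_Collect) (auto simp: I)
    also have "\<dots> = (\<Prod>k\<le>n. emeasure (M (g k)) (E (g k)))"
      by (rule prod.reindex_cong[OF inj]) auto
    also have "\<dots> = ennreal (\<Prod>k\<le>n. measure (M (g k)) (E (g k)))"
      by (simp add: M.emeasure_eq_measure prod_ennreal)
    finally show ?thesis by (simp add: measure_def prod_nonneg)
  qed
  moreover have "(\<lambda>n. measure (PiM I M) (S n)) \<longlonglongrightarrow> measure (PiM I M) (\<Inter>n. S n)"
    using S_sets by (intro P.finite_Lim_measure_decseq) (auto simp: decseq_def S_def)
  moreover have S_Int: "(\<Inter>n. S n) = {\<omega>\<in>space (PiM I M). \<forall>i. \<omega> i \<in> E i}"
  proof -
    have "\<omega> i \<in> E i" if "\<omega> \<in> (\<Inter>n. S n)" for \<omega> i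
    proof -
      obtain n where "i = g n" using g by (meson bij_pointE)
      moreover have "\<omega> \<in> S n" using that by blast
      ultimately show ?thesis by (auto simp: S_def)
    qed
    moreover have "\<omega> \<in> space (PiM I M)" if "\<omega> \<in> (\<Inter>n. S n)" for \<omega>
      using INT_D[OF that, of 0] by (simp add: S_def)
    moreover have "{\<omega>\<in>space (PiM I M). \<forall>i. \<omega> i \<in> E i} \<subseteq> S n" for n by (auto simp: S_def)
    ultimately show ?thesis by blast
  qed
  ultimately show "(\<lambda>n. \<Prod>k\<le>n. measure (M (g k)) (E (g k))) \<longlonglongrightarrow>
      measure (PiM I M) {\<omega>\<in>space (PiM I M). \<forall>i. \<omega> i \<in> E i}"
    by (simp only:)
  show "{\<omega>\<in>space (PiM I M). \<forall>i. \<omega> i \<in> E i} \<in> sets (PiM I M)"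
    unfolding S_Int[symmetric] using S_sets by (intro sets.countable_INT) auto
qed

text \<open>Independent cells are superposed, one for each location measure \<open>\<kappa> a\<close> and each unit interval of heights. The
point \<open>j\<close> of the configuration occupies the real coordinates \<open>2 * j\<close> (location) and \<open>2 * j + 1\<close> (height) of a sample. Points beyond
the Poisson number of their cell are moved to the location 0, which the condition \<open>\<phi> 0 = 0\<close> makes invisible.\<close>

lemma poisson_points_exist:
  fixes \<kappa> :: "nat \<Rightarrow> real measure"
  assumes \<kappa>: "\<And>a. prob_space (\<kappa> a)" and sets_\<kappa>: "\<And>a. sets (\<kappa> a) = sets borel"
  obtains Q :: "(nat \<Rightarrow> real) measure"
  where "prob_space Q" "sets Q = sets (\<Pi>\<^sub>M i\<in>UNIV. borel)"
    "\<And>\<phi>. \<phi> \<in> borel_measurable borel \<Longrightarrow> \<phi> 0 = 0 \<Longrightarrow>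
      measure Q {x\<in>space Q. \<forall>j. \<phi> (x (2 * j)) \<le> ennreal (x (2 * j + 1))} = ennexp (\<Sum>a. \<integral>\<^sup>+s. \<phi> s \<partial>\<kappa> a)"
proof -
  define C where "C c = poisson_cell (\<kappa> (fst c)) (snd c)" for c :: "nat \<times> nat"
  have C_prob: "prob_space (C c)" for c
    unfolding C_def by (rule poisson_cell_void(2)[OF \<kappa> sets_\<kappa>, of "\<lambda>_. 0"]) simp
  interpret \<Omega>: product_prob_space C UNIV
    by (intro product_prob_spaceI C_prob)
  define \<Omega> where "\<Omega> = PiM UNIV C"
  have C_sets: "sets (C c) = sets (count_space UNIV \<Otimes>\<^sub>M (\<Pi>\<^sub>M i\<in>UNIV. borel \<Otimes>\<^sub>M borel))" for c
    unfolding C_def poisson_cell_def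
    by (intro sets_pair_measure_cong sets_PiM_cong) (simp_all add: sets_\<kappa>)
  define pt where "pt \<omega> j = (case prod_decode j of (c, i) \<Rightarrow>
      (let z = \<omega> (prod_decode c) in if i < fst z then snd z i else (0, 0)))"
    for \<omega> :: "nat \<times> nat \<Rightarrow> nat \<times> (nat \<Rightarrow> real \<times> real)" and j
  define X where "X \<omega> k = (if even k then fst (pt \<omega> (k div 2)) else snd (pt \<omega> (k div 2)))" for \<omega> k
  have comp [measurable]: "(\<lambda>\<omega>. \<omega> c) \<in> measurable \<Omega> (count_space UNIV \<Otimes>\<^sub>M (\<Pi>\<^sub>M i\<in>UNIV. borel \<Otimes>\<^sub>M borel))" for c
    using measurable_component_singleton[of c UNIV C]
    unfolding \<Omega>_def by (simp add: measurable_cong_sets[OF refl C_sets])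
  have pt_meas: "(\<lambda>\<omega>. pt \<omega> j) \<in> measurable \<Omega> (borel \<Otimes>\<^sub>M borel)" for j
  proof -
    obtain c i where j: "prod_decode j = (c, i)" by (cases "prod_decode j")
    have n: "(\<lambda>\<omega>. fst (\<omega> (prod_decode c))) \<in> measurable \<Omega> (count_space UNIV)"
      and p: "(\<lambda>\<omega>. snd (\<omega> (prod_decode c)) i) \<in> measurable \<Omega> (borel \<Otimes>\<^sub>M borel)"
      using comp[of "prod_decode c"]
      by (auto intro!: measurable_compose[OF measurable_compose[OF _ measurable_snd] measurable_component_singleton])
    have "{\<omega>\<in>space \<Omega>. i < fst (\<omega> (prod_decode c))} \<in> sets \<Omega>" using n by measurable
    then show ?thesis unfolding pt_def j using p by (simp add: Let_def)
  qed
  have X_meas: "X \<in> measurable \<Omega> (\<Pi>\<^sub>M i\<in>UNIV. borel)"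
    unfolding X_def[abs_def] using pt_meas
    by (intro measurable_PiM_single') (auto intro: measurable_compose[OF _ measurable_fst] measurable_compose[OF _ measurable_snd])
  define Q where "Q = distr \<Omega> (\<Pi>\<^sub>M i\<in>UNIV. borel) X"
  interpret \<Omega>': prob_space \<Omega> unfolding \<Omega>_def by (rule \<Omega>.P.prob_space_axioms)
  show thesis
  proof (rule that[of Q])
    show "prob_space Q" unfolding Q_def by (rule \<Omega>'.prob_space_distr[OF X_meas])
    show "sets Q = sets (\<Pi>\<^sub>M i\<in>UNIV. borel)" by (simp add: Q_def)
    fix \<phi> :: "real \<Rightarrow> ennreal" assume \<phi> [measurable]: "\<phi> \<in> borel_measurable borel" and \<phi>0: "\<phi> 0 = 0"
    define V where "V c = {z\<in>space (C c). \<forall>i<fst z. \<phi> (fst (snd z i)) \<le> ennreal (snd (snd z i))}" for c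
    have V_sets: "V c \<in> sets (C c)"
      and V_measure: "measure (C c) (V c) = ennexp (\<integral>\<^sup>+s. min 1 (\<phi> s - of_nat (snd c)) \<partial>\<kappa> (fst c))" for c
      unfolding V_def C_def by (intro poisson_cell_void[OF \<kappa> sets_\<kappa> \<phi>])+
    have comp': "(\<lambda>x::nat \<Rightarrow> real. x k) \<in> borel_measurable (\<Pi>\<^sub>M i\<in>UNIV. borel)" for k
      by (rule measurable_component_singleton) simp
    have "{x\<in>space (\<Pi>\<^sub>M i\<in>UNIV. borel). \<forall>j. \<phi> (x (2 * j)) \<le> ennreal (x (2 * j + 1))} \<in> sets (\<Pi>\<^sub>M i\<in>(UNIV::nat set). borel)"
      by (intro sets.sets_Collect_countable_All borel_measurable_le measurable_compose[OF comp' \<phi>]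
          measurable_compose[OF comp' measurable_ennreal])
    then have "measure Q {x\<in>space Q. \<forall>j. \<phi> (x (2 * j)) \<le> ennreal (x (2 * j + 1))}
        = measure \<Omega> {\<omega>\<in>space \<Omega>. \<forall>j. \<phi> (X \<omega> (2 * j)) \<le> ennreal (X \<omega> (2 * j + 1))}"
      unfolding Q_def using X_meas
      by (subst measure_distr) (auto intro!: arg_cong[where f = "measure \<Omega>"] simp: space_PiM)
    also have "{\<omega>\<in>space \<Omega>. \<forall>j. \<phi> (X \<omega> (2 * j)) \<le> ennreal (X \<omega> (2 * j + 1))}
        = {\<omega>\<in>space \<Omega>. \<forall>c. \<omega> c \<in> V c}"
    proof (intro Collect_cong conj_cong refl)
      fix \<omega> assume \<omega>: "\<omega> \<in> space \<Omega>"
      have "(\<forall>j. \<phi> (X \<omega> (2 * j)) \<le> ennreal (X \<omega> (2 * j + 1)))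
         \<longleftrightarrow> (\<forall>j. \<phi> (fst (pt \<omega> j)) \<le> ennreal (snd (pt \<omega> j)))"
        by (simp add: X_def)
      also have "\<dots> \<longleftrightarrow> (\<forall>c i. \<phi> (fst (pt \<omega> (prod_encode (prod_encode c, i)))) \<le> ennreal (snd (pt \<omega> (prod_encode (prod_encode c, i)))))"
        by (metis prod_decode_inverse surj_pair)
      also have "\<dots> \<longleftrightarrow> (\<forall>c. \<forall>i<fst (\<omega> c). \<phi> (fst (snd (\<omega> c) i)) \<le> ennreal (snd (snd (\<omega> c) i)))"
        by (simp add: pt_def Let_def \<phi>0 if_distrib cong: if_cong)
      also have "\<dots> \<longleftrightarrow> (\<forall>c. \<omega> c \<in> V c)"
        using \<omega> by (auto simp: V_def \<Omega>_def space_PiM)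
      finally show "(\<forall>j. \<phi> (X \<omega> (2 * j)) \<le> ennreal (X \<omega> (2 * j + 1))) \<longleftrightarrow> (\<forall>c. \<omega> c \<in> V c)" .
    qed
    also have "measure \<Omega> \<dots> = ennexp (\<Sum>k. \<integral>\<^sup>+s. min 1 (\<phi> s - of_nat (snd (prod_decode k))) \<partial>\<kappa> (fst (prod_decode k)))"
      using \<Omega>.measure_PiM_countable_box(1)[OF refl bij_prod_decode V_sets]
      unfolding V_measure \<Omega>_def[symmetric] by (rule LIMSEQ_unique[OF _ ennexp_suminf])
    also have "(\<Sum>k. \<integral>\<^sup>+s. min 1 (\<phi> s - of_nat (snd (prod_decode k))) \<partial>\<kappa> (fst (prod_decode k)))
        = (\<Sum>a. \<integral>\<^sup>+s. \<phi> s \<partial>\<kappa> a)"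
    proof (rule suminf_ennreal_2dimen[of _ "\<lambda>c. \<integral>\<^sup>+s. min 1 (\<phi> s - of_nat (snd c)) \<partial>\<kappa> (fst c)"])
      fix a
      have "(\<Sum>j. \<integral>\<^sup>+s. min 1 (\<phi> s - of_nat j) \<partial>\<kappa> a) = (\<integral>\<^sup>+s. (\<Sum>j. min 1 (\<phi> s - of_nat j)) \<partial>\<kappa> a)"
        by (intro nn_integral_suminf[symmetric]) (simp add: measurable_cong_sets[OF sets_\<kappa> refl])
      then show "(\<integral>\<^sup>+s. \<phi> s \<partial>\<kappa> a) = (\<Sum>n. \<integral>\<^sup>+s. min 1 (\<phi> s - of_nat (snd (a, n))) \<partial>\<kappa> (fst (a, n)))"
        by (simp add: suminf_min_1_minus)
    qed
    finally show "measure Q {x\<in>space Q. \<forall>j. \<phi> (x (2 * j)) \<le> ennreal (x (2 * j + 1))} = ennexp (\<Sum>a. \<integral>\<^sup>+s. \<phi> s \<partial>\<kappa> a)" .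
  qed
qed

section \<open>Random sup-measures and extremal integrals from Poisson points\<close>

text \<open>The power \<open>x powr (- \<alpha>)\<close> on \<open>[0, \<infinity>]\<close>, decreasing from \<open>\<infinity>\<close> to 0.\<close>

definition frechet_level :: "real \<Rightarrow> ennreal \<Rightarrow> ennreal" where
  "frechet_level \<alpha> x = (if x = 0 then \<top> else if x = \<top> then 0 else ennreal (enn2real x powr (- \<alpha>)))"

text \<open>The inverse of \<open>frechet_level\<close> on positive numbers. The value \<open>\<top>\<close> at other arguments, where no point lies almost surely,
makes \<open>frechet_height_le_iff\<close> hold for all \<open>r\<close> and avoids a null set.\<close>

definition frechet_height :: "real \<Rightarrow> real \<Rightarrow> ennreal" where
  "frechet_height \<alpha> r = (if 0 < r then ennreal (r powr (- 1 / \<alpha>)) else \<top>)"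

lemma frechet_height_le_iff:
  assumes "0 < \<alpha>"
  shows "frechet_height \<alpha> r \<le> x \<longleftrightarrow> frechet_level \<alpha> x \<le> ennreal r"
proof (cases "0 < r")
  case False
  then have "frechet_height \<alpha> r = \<top>" "ennreal r = 0" by (auto simp: frechet_height_def ennreal_neg)
  moreover have "frechet_level \<alpha> x = 0 \<longleftrightarrow> x = \<top>"
    by (auto simp: frechet_level_def enn2real_eq_0_iff)
  ultimately show ?thesis by (simp add: top_unique)
next
  case True
  show ?thesis
  proof (cases x)
    case (real t)
    show ?thesis
    proof (cases "t = 0")
      case True
      then show ?thesis using real \<open>0 < r\<close> by (simp add: frechet_height_def frechet_level_def top_unique)
    next
      case False
      then have t: "0 < t" using real by simp
      have "r powr (- 1 / \<alpha>) \<le> t \<longleftrightarrow> t powr (- \<alpha>) \<le> r"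
      proof
        assume "r powr (- 1 / \<alpha>) \<le> t"
        then have "t powr (- \<alpha>) \<le> (r powr (- 1 / \<alpha>)) powr (- \<alpha>)"
          using assms True by (intro powr_mono2') auto
        then show "t powr (- \<alpha>) \<le> r" using assms True by (simp add: powr_powr)
      next
        assume "t powr (- \<alpha>) \<le> r"
        then have "r powr (- 1 / \<alpha>) \<le> (t powr (- \<alpha>)) powr (- 1 / \<alpha>)"
          using assms t by (intro powr_mono2') auto
        then show "r powr (- 1 / \<alpha>) \<le> t" using assms t by (simp add: powr_powr)
      qed
      then show ?thesis using real t True by (simp add: frechet_height_def frechet_level_def)
    qed
  qed (simp add: frechet_level_def)
qed

lemma scaled_frechet_height_le_iff:
  assumes "0 < \<alpha>" "0 \<le> a" "0 < y"
  shows "ennreal a * frechet_height \<alpha> r \<le> ennreal y \<longleftrightarrow> ennreal ((a / y) powr \<alpha>) \<le> ennreal r"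
proof (cases "a = 0")
  case False
  then have a: "0 < a" using assms by simp
  have "ennreal a * frechet_height \<alpha> r \<le> ennreal y \<longleftrightarrow> frechet_height \<alpha> r \<le> ennreal (y / a)"
  proof (cases "frechet_height \<alpha> r")
    case (real h)
    then show ?thesis using a assms by (simp add: ennreal_mult[symmetric] field_simps)
  qed (use a assms in \<open>simp add: ennreal_mult_top top_unique\<close>)
  also have "frechet_level \<alpha> (ennreal (y / a)) = ennreal ((a / y) powr \<alpha>)"
    using a assms by (simp add: frechet_level_def powr_minus_divide powr_divide)
  ultimately show ?thesis using frechet_height_le_iff[OF assms(1)] by simp
qed simp

lemma frechet_height_measurable [measurable]: "frechet_height \<alpha> \<in> borel_measurable borel"
  unfolding frechet_height_def[abs_def] by measurable

lemma borel_eq_atMost_ennreal: "(borel :: ennreal measure) = sigma UNIV (range atMost)"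
proof (rule borel_eq_sigmaI1[OF borel_Ioi])
  fix B :: "ennreal set" assume "B \<in> range greaterThan"
  then obtain x where B: "B = {x<..}" by blast
  have "{x<..} = UNIV - {..x}" by auto
  also have "\<dots> \<in> sets (sigma UNIV (range atMost))"
  proof -
    have "{..x} \<in> sets (sigma UNIV (range atMost))" by auto
    from sets.compl_sets[OF this] show ?thesis by simp
  qed
  finally show "B \<in> sets (sigma UNIV (range atMost))" unfolding B .
qed auto

text \<open>The function \<open>exp (- x)\<close> is 1-Lipschitz on the nonnegative numbers.\<close>

lemma exp_minus_diff_le:
  "exp (- a) - exp (- b) \<le> b - (a :: real)" if "0 \<le> a" "a \<le> b"
proof -
  have "exp (- a) - exp (- b) = exp (- a) * (1 - exp (- (b - a)))"
    by (simp add: algebra_simps exp_add[symmetric])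
  also have "\<dots> \<le> 1 * (1 - exp (- (b - a)))" using that by (intro mult_right_mono) auto
  also have "\<dots> \<le> b - a" using exp_ge_add_one_self[of "a - b"]
    by (simp only: minus_diff_eq mult_1)
  finally show ?thesis .
qed

text \<open>Points with locations \<open>L j\<close> and heights \<open>R j\<close> that form a Poisson process of intensity \<open>\<mu>\<close> times Lebesgue measure,
as far as void probabilities of regions below graphs are concerned. Locations outside the space of \<open>\<mu>\<close> count
as absent.\<close>

locale frechet_points = prob_space Q for Q :: "'v measure" +
  fixes \<alpha> :: real and \<mu> :: "real measure" and L R :: "nat \<Rightarrow> 'v \<Rightarrow> real"
  assumes alpha_pos: "0 < \<alpha>"
    and sets_control: "sets \<mu> = sets (restrict_space borel (space \<mu>))"
    and space_control: "space \<mu> \<in> sets borel"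
    and L_measurable [measurable]: "\<And>j. L j \<in> borel_measurable Q"
    and R_measurable [measurable]: "\<And>j. R j \<in> borel_measurable Q"
    and void: "\<And>\<phi>. \<phi> \<in> borel_measurable \<mu> \<Longrightarrow>
      prob {w\<in>space Q. \<forall>j. L j w \<in> space \<mu> \<longrightarrow> \<phi> (L j w) \<le> ennreal (R j w)} = ennexp (\<integral>\<^sup>+s. \<phi> s \<partial>\<mu>)"
begin

definition sup_measure :: "real set \<Rightarrow> 'v \<Rightarrow> ennreal" where
  "sup_measure A w = (SUP j. if L j w \<in> A then frechet_height \<alpha> (R j w) else 0)"

definition extremal :: "(real \<Rightarrow> real) \<Rightarrow> 'v \<Rightarrow> ennreal" where
  "extremal g w = (SUP j. if L j w \<in> space \<mu> then ennreal (g (L j w)) * frechet_height \<alpha> (R j w) else 0)"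

lemma control_borel: "A \<in> sets \<mu> \<Longrightarrow> A \<in> sets borel"
  using space_control by (auto simp: sets_control sets_restrict_space_iff)

lemma sup_measure_measurable:
  assumes "A \<in> sets \<mu>"
  shows "sup_measure A \<in> borel_measurable Q"
proof -
  have [measurable]: "A \<in> sets borel" using assms by (rule control_borel)
  show ?thesis unfolding sup_measure_def[abs_def] by measurable
qed

lemma extremal_measurable:
  assumes "g \<in> borel_measurable \<mu>"
  shows "extremal g \<in> borel_measurable Q"
proof -
  define g' where "g' s = (if s \<in> space \<mu> then g s else 0)" for s
  note [measurable] = space_control
  have "g \<in> borel_measurable (restrict_space borel (space \<mu>))"
    using assms by (simp add: measurable_cong_sets[OF sets_control refl])
  then have [measurable]: "g' \<in> borel_measurable borel"
    unfolding g'_def[abs_def] using space_control by (subst (asm) measurable_restrict_space_iff[where c = 0]) auto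
  have "extremal g = (\<lambda>w. SUP j. if L j w \<in> space \<mu> then ennreal (g' (L j w)) * frechet_height \<alpha> (R j w) else 0)"
    unfolding extremal_def[abs_def] g'_def by (auto intro!: ext SUP_cong)
  also have "\<dots> \<in> borel_measurable Q" by measurable
  finally show ?thesis .
qed

text \<open>The event says that there is no point below the graph of the function which equals \<open>frechet_level \<alpha> (x i)\<close> on \<open>A i\<close>. The
integral of that function splits over the disjoint sets, so that the probability is a product.\<close>

lemma prob_sup_measure_le:
  assumes J: "finite J" "\<And>i. i \<in> J \<Longrightarrow> A i \<in> sets \<mu>" "disjoint_family_on A J"
  shows "prob {w\<in>space Q. \<forall>i\<in>J. sup_measure (A i) w \<le> x i}
    = (\<Prod>i\<in>J. ennexp (frechet_level \<alpha> (x i) * emeasure \<mu> (A i)))"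
proof -
  define \<phi> where "\<phi> s = (\<Sum>i\<in>J. frechet_level \<alpha> (x i) * indicator (A i) s)" for s
  have [measurable]: "\<phi> \<in> borel_measurable \<mu>" unfolding \<phi>_def using J by measurable
  have "(\<forall>i\<in>J. sup_measure (A i) w \<le> x i) \<longleftrightarrow>
      (\<forall>j. L j w \<in> space \<mu> \<longrightarrow> \<phi> (L j w) \<le> ennreal (R j w))" for w
  proof -
    have on: "\<phi> s = frechet_level \<alpha> (x i)" if "i \<in> J" "s \<in> A i" for s i
      unfolding \<phi>_def using J that by (intro sum_indicator_disjoint_family)
    have off: "\<phi> s = 0" if "\<forall>i\<in>J. s \<notin> A i" for s
      unfolding \<phi>_def using that by (intro sum.neutral) auto
    have sub: "A i \<subseteq> space \<mu>" if "i \<in> J" for i using J(2)[OF that] by (rule sets.sets_into_space)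
    have "(\<forall>i\<in>J. sup_measure (A i) w \<le> x i) \<longleftrightarrow>
        (\<forall>j. \<forall>i\<in>J. L j w \<in> A i \<longrightarrow> frechet_level \<alpha> (x i) \<le> ennreal (R j w))"
      unfolding sup_measure_def SUP_le_iff frechet_height_le_iff[OF alpha_pos, symmetric] by auto
    also have "\<dots> \<longleftrightarrow> (\<forall>j. L j w \<in> space \<mu> \<longrightarrow> \<phi> (L j w) \<le> ennreal (R j w))"
    proof (intro all_cong1 iffI impI)
      fix j assume *: "\<forall>i\<in>J. L j w \<in> A i \<longrightarrow> frechet_level \<alpha> (x i) \<le> ennreal (R j w)"
      show "\<phi> (L j w) \<le> ennreal (R j w)"
        using * on off[of "L j w"] by (cases "\<exists>i\<in>J. L j w \<in> A i") auto
    next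
      fix j assume "L j w \<in> space \<mu> \<longrightarrow> \<phi> (L j w) \<le> ennreal (R j w)"
      then show "\<forall>i\<in>J. L j w \<in> A i \<longrightarrow> frechet_level \<alpha> (x i) \<le> ennreal (R j w)"
        using on sub by fastforce
    qed
    finally show ?thesis .
  qed
  then have "prob {w\<in>space Q. \<forall>i\<in>J. sup_measure (A i) w \<le> x i} = ennexp (\<integral>\<^sup>+s. \<phi> s \<partial>\<mu>)"
    using void[of \<phi>] by simp
  also have "(\<integral>\<^sup>+s. \<phi> s \<partial>\<mu>) = (\<Sum>i\<in>J. frechet_level \<alpha> (x i) * emeasure \<mu> (A i))"
    unfolding \<phi>_def using J(2) by (subst nn_integral_sum) (auto simp: nn_integral_cmult_indicator)
  finally show ?thesis by (simp add: ennexp_sum)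
qed

lemma prob_sup_measure_le_single:
  assumes "A \<in> sets \<mu>"
  shows "prob {w\<in>space Q. sup_measure A w \<le> x} = ennexp (frechet_level \<alpha> x * emeasure \<mu> A)"
  using prob_sup_measure_le[of "{()}" "\<lambda>_. A" "\<lambda>_. x"] assms by (simp add: disjoint_family_on_def)

lemma sup_measure_UN: "sup_measure (\<Union>i. A i) w = (SUP i. sup_measure (A i) w)"
proof -
  have "(if L j w \<in> (\<Union>i. A i) then frechet_height \<alpha> (R j w) else 0)
      = (SUP i. if L j w \<in> A i then frechet_height \<alpha> (R j w) else 0)" for j
  proof (cases "L j w \<in> (\<Union>i. A i)")
    case True
    then obtain i where "L j w \<in> A i" by blast
    then show ?thesis by (intro antisym SUP_upper2[of i] SUP_least) auto
  qed simp
  then have "sup_measure (\<Union>i. A i) w = (SUP j. SUP i. if L j w \<in> A i then frechet_height \<alpha> (R j w) else 0)"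
    by (simp add: sup_measure_def)
  also have "\<dots> = (SUP i. sup_measure (A i) w)"
    unfolding sup_measure_def by (rule SUP_commute)
  finally show ?thesis .
qed

text \<open>The sets \<open>{..x}\<close> form a generator of the Borel sets of \<open>[0, \<infinity>]\<close> that is stable under intersections, so it suffices that
joint distribution functions factorize.\<close>

lemma sup_measure_indep:
  assumes A: "range A \<subseteq> sets \<mu>" "disjoint_family A"
  shows "indep_vars (\<lambda>_. borel) (\<lambda>i::nat. sup_measure (A i)) UNIV"
proof -
  have meas: "sup_measure (A i) \<in> borel_measurable Q" for i
    using A by (intro sup_measure_measurable) auto
  define E where "E i = {sup_measure (A i) -` B \<inter> space Q | B. B \<in> range atMost}" for i
  have E_events: "{w\<in>space Q. sup_measure (A i) w \<le> x} \<in> events" for i x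
    using meas by (intro borel_measurable_le) auto
  have E_alt: "E i = range (\<lambda>x. {w\<in>space Q. sup_measure (A i) w \<le> x})" for i
  proof -
    have "{w\<in>space Q. sup_measure (A i) w \<le> x} = sup_measure (A i) -` {..x} \<inter> space Q" for x by auto
    then show ?thesis unfolding E_def by blast
  qed
  have "indep_sets E UNIV"
  proof (rule indep_setsI)
    show "E i \<subseteq> events" for i unfolding E_alt using E_events by auto
    fix B J assume J: "J \<noteq> {}" "J \<subseteq> UNIV" "finite J" "\<forall>j\<in>J. B j \<in> E j"
    then have "\<forall>j\<in>J. \<exists>x. B j = {w\<in>space Q. sup_measure (A j) w \<le> x}" unfolding E_alt by blast
    then obtain x where x: "\<And>j. j \<in> J \<Longrightarrow> B j = {w\<in>space Q. sup_measure (A j) w \<le> x j}" by metis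
    have "(\<Inter>j\<in>J. B j) = {w\<in>space Q. \<forall>j\<in>J. sup_measure (A j) w \<le> x j}"
      using x J by auto
    then have "prob (\<Inter>j\<in>J. B j) = (\<Prod>j\<in>J. ennexp (frechet_level \<alpha> (x j) * emeasure \<mu> (A j)))"
      using prob_sup_measure_le[of J A x] J A by (auto simp: disjoint_family_on_def)
    also have "\<dots> = (\<Prod>j\<in>J. prob (B j))"
      using x A by (intro prod.cong) (auto simp: prob_sup_measure_le_single)
    finally show "prob (\<Inter>j\<in>J. B j) = (\<Prod>j\<in>J. prob (B j))" .
  qed
  moreover have "Int_stable (E i)" for i
  proof (rule Int_stableI)
    fix B C assume "B \<in> E i" "C \<in> E i"
    then obtain x y where "B = {w\<in>space Q. sup_measure (A i) w \<le> x}" "C = {w\<in>space Q. sup_measure (A i) w \<le> y}"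
      unfolding E_alt by blast
    then have "B \<inter> C = {w\<in>space Q. sup_measure (A i) w \<le> min x y}" by auto
    then show "B \<inter> C \<in> E i" unfolding E_alt by blast
  qed
  ultimately have "indep_sets (\<lambda>i. sigma_sets (space Q) (E i)) UNIV"
    by (rule indep_sets_sigma)
  moreover have "sigma_sets (space Q) (E i) = {sup_measure (A i) -` B \<inter> space Q | B. B \<in> sets borel}" for i
    unfolding E_def borel_eq_atMost_ennreal
    by (subst sigma_sets_vimage_commute[symmetric]) auto
  ultimately show ?thesis unfolding indep_vars_def2 using meas by simp
qed

lemma sup_measure_frechet: "frechet_sup_measure \<alpha> \<mu> Q sup_measure"
  unfolding frechet_sup_measure_def
proof (intro conjI allI ballI impI)
  show "prob_space Q" by (rule prob_space_axioms)
  show "A \<in> sets \<mu> \<Longrightarrow> sup_measure A \<in> borel_measurable Q" for A by (rule sup_measure_measurable)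
  show "indep_vars (\<lambda>_. borel) (\<lambda>i. sup_measure (A i)) UNIV"
    if "range A \<subseteq> sets \<mu> \<and> disjoint_family A" for A :: "nat \<Rightarrow> real set"
    using that by (intro sup_measure_indep) auto
  show "AE w in Q. sup_measure (\<Union>i. A i) w = (SUP i. sup_measure (A i) w)" for A :: "nat \<Rightarrow> real set"
    by (simp add: sup_measure_UN)
  fix A assume A: "A \<in> sets \<mu>"
  {
    fix x :: real assume x: "0 < x" and fin: "emeasure \<mu> A < \<infinity>"
    then have "emeasure \<mu> A = ennreal (measure \<mu> A)" by (simp add: emeasure_eq_ennreal_measure)
    then show "prob {w\<in>space Q. sup_measure A w \<le> ennreal x} = frechet_cdf \<alpha> (measure \<mu> A powr (1 / \<alpha>)) x"
      using x alpha_pos A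
      by (simp add: prob_sup_measure_le_single frechet_level_def frechet_cdf_def powr_powr ennreal_mult[symmetric] mult.commute)
  }
  {
    assume inf: "emeasure \<mu> A = \<infinity>"
    have "AE w in Q. \<not> sup_measure A w \<le> of_nat n" for n
    proof -
      have "frechet_level \<alpha> (of_nat n) * emeasure \<mu> A = \<top>"
        using inf by (auto simp: frechet_level_def ennreal_mult_top enn2real_eq_0_iff)
      then have "prob {w\<in>space Q. sup_measure A w \<le> of_nat n} = 0"
        using A by (simp add: prob_sup_measure_le_single)
      then show ?thesis
        using sup_measure_measurable[OF A] by (subst (asm) prob_eq_0) auto
    qed
    then have "AE w in Q. \<forall>n. \<not> sup_measure A w \<le> of_nat n" by (simp add: AE_all_countable)
    then show "AE w in Q. sup_measure A w = \<infinity>"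
    proof eventually_elim
      case (elim w)
      then show ?case
        using ennreal_Ex_less_of_nat[of "sup_measure A w"]
        by (metis infinity_ennreal_def less_imp_le less_top)
    qed
  }
qed

text \<open>For a simple function the two suprema, over the levels and over the points, can be interchanged; each
point belongs to exactly one level set.\<close>

lemma simple_extremal_integral_eq:
  "simple_extremal_integral \<mu> sup_measure g w = enn2real (extremal g w)"
proof -
  have "(SUP a\<in>g ` space \<mu>. ennreal a * sup_measure {s\<in>space \<mu>. g s = a} w)
      = (SUP a\<in>g ` space \<mu>. SUP j. ennreal a * (if L j w \<in> {s\<in>space \<mu>. g s = a} then frechet_height \<alpha> (R j w) else 0))"
    unfolding sup_measure_def by (intro SUP_cong refl SUP_mult_left_ennreal)
  also have "\<dots> = (SUP j. SUP a\<in>g ` space \<mu>. ennreal a * (if L j w \<in> {s\<in>space \<mu>. g s = a} then frechet_height \<alpha> (R j w) else 0))"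
    by (rule SUP_commute)
  also have "\<dots> = extremal g w"
    unfolding extremal_def
  proof (rule SUP_cong[OF refl])
    fix j
    show "(SUP a\<in>g ` space \<mu>. ennreal a * (if L j w \<in> {s\<in>space \<mu>. g s = a} then frechet_height \<alpha> (R j w) else 0))
        = (if L j w \<in> space \<mu> then ennreal (g (L j w)) * frechet_height \<alpha> (R j w) else 0)"
    proof (cases "L j w \<in> space \<mu>")
      case True
      then show ?thesis by (intro antisym SUP_least SUP_upper2[of "g (L j w)"]) auto
    next
      case False
      then show ?thesis by (intro antisym SUP_least) auto
    qed
  qed
  finally show ?thesis by (simp add: simple_extremal_integral_def)
qed

text \<open>The event says that there is no point below the graph of the maximum of the functions \<open>(g i / y i) powr \<alpha>\<close>.\<close>

lemma prob_extremal_le: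
  assumes F: "finite F" "F \<noteq> {}" and g: "\<And>i. i \<in> F \<Longrightarrow> g i \<in> Lplus \<alpha> \<mu>" and y: "\<And>i. i \<in> F \<Longrightarrow> 0 < y i"
  shows "prob {w\<in>space Q. \<forall>i\<in>F. extremal (g i) w \<le> ennreal (y i)}
    = exp (- (\<integral>s. (MAX i\<in>F. (g i s / y i) powr \<alpha>) \<partial>\<mu>))"
    and "integrable \<mu> (\<lambda>s. MAX i\<in>F. (g i s / y i) powr \<alpha>)"
proof -
  define m where "m s = (MAX i\<in>F. (g i s / y i) powr \<alpha>)" for s
  have gm [measurable]: "i \<in> F \<Longrightarrow> g i \<in> borel_measurable \<mu>" for i using g by (auto simp: Lplus_def)
  have [measurable]: "m \<in> borel_measurable \<mu>" unfolding m_def[abs_def] using F by measurable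
  have m_nonneg: "0 \<le> m s" for s unfolding m_def using F by (intro MAX_nonneg) auto
  have m_int: "integrable \<mu> m"
  proof (rule Bochner_Integration.integrable_bound)
    show "integrable \<mu> (\<lambda>s. \<Sum>i\<in>F. g i s powr \<alpha> / y i powr \<alpha>)"
      using g by (intro Bochner_Integration.integrable_sum integrable_divide) (auto simp: Lplus_def)
    show "AE s in \<mu>. norm (m s) \<le> norm (\<Sum>i\<in>F. g i s powr \<alpha> / y i powr \<alpha>)"
    proof (rule AE_I2)
      fix s assume s: "s \<in> space \<mu>"
      have "m s \<le> (\<Sum>i\<in>F. (g i s / y i) powr \<alpha>)" unfolding m_def using F by (intro MAX_le_sum) auto
      also have "\<dots> = (\<Sum>i\<in>F. g i s powr \<alpha> / y i powr \<alpha>)"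
        using g y s by (intro sum.cong) (auto simp: powr_divide Lplus_def less_imp_le)
      finally show "norm (m s) \<le> norm (\<Sum>i\<in>F. g i s powr \<alpha> / y i powr \<alpha>)"
        using m_nonneg[of s] by simp
    qed
  qed simp
  then show "integrable \<mu> (\<lambda>s. MAX i\<in>F. (g i s / y i) powr \<alpha>)" by (simp add: m_def[abs_def])
  have "(\<forall>i\<in>F. extremal (g i) w \<le> ennreal (y i)) \<longleftrightarrow>
      (\<forall>j. L j w \<in> space \<mu> \<longrightarrow> ennreal (m (L j w)) \<le> ennreal (R j w))" for w
  proof -
    have "(\<forall>i\<in>F. extremal (g i) w \<le> ennreal (y i)) \<longleftrightarrow>
        (\<forall>j. L j w \<in> space \<mu> \<longrightarrow> (\<forall>i\<in>F. ennreal (g i (L j w)) * frechet_height \<alpha> (R j w) \<le> ennreal (y i)))"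
      unfolding extremal_def SUP_le_iff by auto
    also have "\<dots> \<longleftrightarrow> (\<forall>j. L j w \<in> space \<mu> \<longrightarrow> (\<forall>i\<in>F. ennreal ((g i (L j w) / y i) powr \<alpha>) \<le> ennreal (R j w)))"
      using g y by (intro all_cong1 imp_cong refl ball_cong scaled_frechet_height_le_iff alpha_pos) (auto simp: Lplus_def)
    also have "\<dots> \<longleftrightarrow> (\<forall>j. L j w \<in> space \<mu> \<longrightarrow> ennreal (m (L j w)) \<le> ennreal (R j w))"
    proof (intro all_cong1 imp_cong refl)
      fix j
      have "m (L j w) \<in> (\<lambda>i. (g i (L j w) / y i) powr \<alpha>) ` F"
        unfolding m_def using F by (intro Max_in) auto
      then obtain i where "i \<in> F" "m (L j w) = (g i (L j w) / y i) powr \<alpha>" by blast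
      moreover have "(g i (L j w) / y i) powr \<alpha> \<le> m (L j w)" if "i \<in> F" for i
        unfolding m_def using F that by (intro Max_ge) auto
      ultimately show "(\<forall>i\<in>F. ennreal ((g i (L j w) / y i) powr \<alpha>) \<le> ennreal (R j w)) \<longleftrightarrow> ennreal (m (L j w)) \<le> ennreal (R j w)"
        by (metis ennreal_leI order_trans)
    qed
    finally show ?thesis .
  qed
  then have "prob {w\<in>space Q. \<forall>i\<in>F. extremal (g i) w \<le> ennreal (y i)} = ennexp (\<integral>\<^sup>+s. ennreal (m s) \<partial>\<mu>)"
    using void[of "\<lambda>s. ennreal (m s)"] by simp
  also have "(\<integral>\<^sup>+s. ennreal (m s) \<partial>\<mu>) = ennreal (\<integral>s. m s \<partial>\<mu>)"
    using m_int m_nonneg by (intro nn_integral_eq_integral) auto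
  also have "ennexp (ennreal (\<integral>s. m s \<partial>\<mu>)) = exp (- (\<integral>s. m s \<partial>\<mu>))"
    using m_nonneg by (simp add: Bochner_Integration.integral_nonneg)
  finally show "prob {w\<in>space Q. \<forall>i\<in>F. extremal (g i) w \<le> ennreal (y i)}
    = exp (- (\<integral>s. (MAX i\<in>F. (g i s / y i) powr \<alpha>) \<partial>\<mu>))" by (simp add: m_def)
qed

text \<open>The distribution function of \<open>extremal g\<close> tends to 1 at infinity.\<close>

lemma extremal_finite:
  assumes g: "g \<in> Lplus \<alpha> \<mu>"
  shows "AE w in Q. extremal g w < \<top>"
proof -
  have [measurable]: "extremal g \<in> borel_measurable Q"
    using g by (intro extremal_measurable) (auto simp: Lplus_def)
  define c where "c = (\<integral>s. g s powr \<alpha> \<partial>\<mu>)"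
  have "prob {w\<in>space Q. extremal g w = \<top>} \<le> 1 - exp (- (c * y powr (- \<alpha>)))" if y: "0 < y" for y
  proof -
    have "prob {w\<in>space Q. extremal g w \<le> ennreal y} = exp (- (\<integral>s. (g s / y) powr \<alpha> \<partial>\<mu>))"
      using prob_extremal_le(1)[of "{()}" "\<lambda>_. g" "\<lambda>_. y"] g y by simp
    also have "(\<integral>s. (g s / y) powr \<alpha> \<partial>\<mu>) = (\<integral>s. g s powr \<alpha> * y powr (- \<alpha>) \<partial>\<mu>)"
      using g y by (intro Bochner_Integration.integral_cong)
        (auto simp: Lplus_def powr_divide less_imp_le powr_minus_divide)
    also have "\<dots> = c * y powr (- \<alpha>)" by (simp add: c_def)
    finally have le: "prob {w\<in>space Q. extremal g w \<le> ennreal y} = exp (- (c * y powr (- \<alpha>)))" .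
    have "prob {w\<in>space Q. extremal g w = \<top>} \<le> prob {w\<in>space Q. \<not> extremal g w \<le> ennreal y}"
      by (rule finite_measure_mono) (auto simp: top_unique)
    also have "\<dots> = 1 - prob {w\<in>space Q. extremal g w \<le> ennreal y}"
      by (rule prob_neg) measurable
    finally show ?thesis by (simp add: le)
  qed
  then have *: "prob {w\<in>space Q. extremal g w = \<top>} \<le> 1 - exp (- (c * real (Suc n) powr (- \<alpha>)))" for n
    by simp
  have "(\<lambda>n. 1 - exp (- (c * real (Suc n) powr (- \<alpha>)))) \<longlonglongrightarrow> 1 - exp (- (c * 0))"
    using alpha_pos by (intro tendsto_intros) real_asymp
  from tendsto_lowerbound[OF this] * have "prob {w\<in>space Q. extremal g w = \<top>} \<le> 0" by simp
  then have "prob {w\<in>space Q. extremal g w = \<top>} = 0" by (simp add: measure_le_0_iff)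
  then have "AE w in Q. extremal g w \<noteq> \<top>" by (subst (asm) prob_eq_0) auto
  then show ?thesis by (simp add: less_top)
qed

lemma prob_real_extremal_le:
  assumes F: "finite F" "F \<noteq> {}" and g: "\<And>i. i \<in> F \<Longrightarrow> g i \<in> Lplus \<alpha> \<mu>" and y: "\<And>i. i \<in> F \<Longrightarrow> 0 < y i"
  shows "prob {w\<in>space Q. \<forall>i\<in>F. enn2real (extremal (g i) w) \<le> y i}
    = exp (- (\<integral>s. (MAX i\<in>F. (g i s / y i) powr \<alpha>) \<partial>\<mu>))"
proof -
  have [measurable]: "i \<in> F \<Longrightarrow> extremal (g i) \<in> borel_measurable Q" for i
    using g by (intro extremal_measurable) (auto simp: Lplus_def)
  have "AE w in Q. \<forall>i\<in>F. extremal (g i) w < \<top>"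
    using F g by (intro AE_finite_allI extremal_finite) auto
  then have "AE w in Q. (\<forall>i\<in>F. enn2real (extremal (g i) w) \<le> y i) \<longleftrightarrow> (\<forall>i\<in>F. extremal (g i) w \<le> ennreal (y i))"
  proof eventually_elim
    case (elim w)
    have "enn2real (extremal (g i) w) \<le> y i \<longleftrightarrow> extremal (g i) w \<le> ennreal (y i)" if "i \<in> F" for i
      using elim that y[OF that] by (cases "extremal (g i) w") auto
    then show ?case by auto
  qed
  then have "prob {w\<in>space Q. \<forall>i\<in>F. enn2real (extremal (g i) w) \<le> y i}
      = prob {w\<in>space Q. \<forall>i\<in>F. extremal (g i) w \<le> ennreal (y i)}"
    using F by (intro prob_eq_AE) (auto intro!: sets.sets_Collect_finite_All borel_measurable_le)
  then show ?thesis using prob_extremal_le(1)[OF assms] by simp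
qed

end

lemma rho_commute: "rho \<alpha> \<mu> f g = rho \<alpha> \<mu> g f"
  unfolding rho_def by (intro Bochner_Integration.integral_cong) auto

context frechet_points
begin

text \<open>The real version of \<open>extremal g\<close>, from which it differs on a null set only.\<close>

definition extremal_value :: "(real \<Rightarrow> real) \<Rightarrow> 'v \<Rightarrow> real" where
  "extremal_value g w = enn2real (extremal g w)"

lemma extremal_value_measurable: "g \<in> Lplus \<alpha> \<mu> \<Longrightarrow> extremal_value g \<in> borel_measurable Q"
  unfolding extremal_value_def[abs_def]
  by (intro measurable_compose[OF extremal_measurable] borel_measurable_enn2real) (auto simp: Lplus_def)

lemma prob_extremal_value_le:
  assumes g: "g \<in> Lplus \<alpha> \<mu>" and y: "0 < y"
  shows "prob {w\<in>space Q. extremal_value g w \<le> y} = exp (- (y powr (- \<alpha>) * (\<integral>s. g s powr \<alpha> \<partial>\<mu>)))"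
proof -
  have "prob {w\<in>space Q. extremal_value g w \<le> y} = exp (- (\<integral>s. (g s / y) powr \<alpha> \<partial>\<mu>))"
    using prob_real_extremal_le[of "{()}" "\<lambda>_. g" "\<lambda>_. y"] g y by (simp add: extremal_value_def)
  also have "(\<integral>s. (g s / y) powr \<alpha> \<partial>\<mu>) = (\<integral>s. y powr (- \<alpha>) * g s powr \<alpha> \<partial>\<mu>)"
    using g y by (intro Bochner_Integration.integral_cong)
      (auto simp: Lplus_def powr_divide less_imp_le powr_minus_divide)
  finally show ?thesis by simp
qed

text \<open>The probability is the difference of two values of \<open>exp\<close>, whose arguments differ by the integral of the excess of
the maximum of \<open>f\<close> and \<open>g\<close> over \<open>f\<close>, scaled by \<open>x powr (- \<alpha>)\<close>. This integral is at most \<open>rho \<alpha> \<mu> f g\<close>.\<close>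

lemma prob_extremal_value_separated:
  assumes f: "f \<in> Lplus \<alpha> \<mu>" and g: "g \<in> Lplus \<alpha> \<mu>" and x: "0 < x"
  shows "prob {w\<in>space Q. extremal_value f w \<le> x \<and> x < extremal_value g w} \<le> x powr (- \<alpha>) * rho \<alpha> \<mu> f g"
proof -
  note [measurable] = extremal_value_measurable[OF f] extremal_value_measurable[OF g]
  define h where "h i = (if i then f else g)" for i :: bool
  have h: "h i \<in> Lplus \<alpha> \<mu>" for i using f g by (simp add: h_def)
  define a where "a = (\<integral>s. (f s / x) powr \<alpha> \<partial>\<mu>)"
  define b where "b = (\<integral>s. (MAX i\<in>UNIV. (h i s / x) powr \<alpha>) \<partial>\<mu>)"
  have max: "(MAX i\<in>UNIV. (h i s / x) powr \<alpha>) = max ((g s / x) powr \<alpha>) ((f s / x) powr \<alpha>)" for s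
    by (simp add: UNIV_bool h_def)
  have int_f: "integrable \<mu> (\<lambda>s. (f s / x) powr \<alpha>)"
    using prob_extremal_le(2)[of "{()}" "\<lambda>_. f" "\<lambda>_. x"] f x by simp
  have int_max: "integrable \<mu> (\<lambda>s. (MAX i\<in>UNIV. (h i s / x) powr \<alpha>))"
    using h x by (intro prob_extremal_le(2)) auto
  have ab: "0 \<le> a" "a \<le> b"
    unfolding a_def b_def using int_f int_max by (auto intro!: Bochner_Integration.integral_nonneg integral_mono simp: max)
  have "prob {w\<in>space Q. extremal_value f w \<le> x} = exp (- a)"
    using prob_real_extremal_le[of "{()}" "\<lambda>_. f" "\<lambda>_. x"] f x by (simp add: extremal_value_def a_def)
  moreover have "prob {w\<in>space Q. extremal_value f w \<le> x \<and> extremal_value g w \<le> x} = exp (- b)"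
    using prob_real_extremal_le[of UNIV h "\<lambda>_. x"] h x
    by (simp add: extremal_value_def b_def UNIV_bool h_def conj_commute ex_bool_eq)
  moreover have "prob {w\<in>space Q. extremal_value f w \<le> x \<and> x < extremal_value g w}
      = prob {w\<in>space Q. extremal_value f w \<le> x} - prob {w\<in>space Q. extremal_value f w \<le> x \<and> extremal_value g w \<le> x}"
    by (subst finite_measure_Diff[symmetric]) (auto intro!: arg_cong[where f = prob])
  ultimately have "prob {w\<in>space Q. extremal_value f w \<le> x \<and> x < extremal_value g w} \<le> b - a"
    using exp_minus_diff_le[OF ab] by simp
  also have "b - a = (\<integral>s. (MAX i\<in>UNIV. (h i s / x) powr \<alpha>) - (f s / x) powr \<alpha> \<partial>\<mu>)"
    unfolding a_def b_def using int_f int_max by simp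
  also have "\<dots> \<le> (\<integral>s. x powr (- \<alpha>) * \<bar>f s powr \<alpha> - g s powr \<alpha>\<bar> \<partial>\<mu>)"
  proof (rule integral_mono)
    show "integrable \<mu> (\<lambda>s. (MAX i\<in>UNIV. (h i s / x) powr \<alpha>) - (f s / x) powr \<alpha>)"
      using int_f int_max by simp
    show "integrable \<mu> (\<lambda>s. x powr (- \<alpha>) * \<bar>f s powr \<alpha> - g s powr \<alpha>\<bar>)"
      using f g by (auto simp: Lplus_def)
    fix s assume "s \<in> space \<mu>"
    then have "(f s / x) powr \<alpha> = x powr (- \<alpha>) * f s powr \<alpha>" "(g s / x) powr \<alpha> = x powr (- \<alpha>) * g s powr \<alpha>"
      using f g x by (auto simp: Lplus_def powr_divide powr_minus_divide)
    then have "(MAX i\<in>UNIV. (h i s / x) powr \<alpha>) - (f s / x) powr \<alpha>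
        = max (x powr (- \<alpha>) * (g s powr \<alpha> - f s powr \<alpha>)) 0"
      unfolding max by (simp add: max_def algebra_simps)
    also have "\<dots> \<le> x powr (- \<alpha>) * \<bar>f s powr \<alpha> - g s powr \<alpha>\<bar>"
      by (intro max.boundedI mult_left_mono) auto
    finally show "(MAX i\<in>UNIV. (h i s / x) powr \<alpha>) - (f s / x) powr \<alpha>
        \<le> x powr (- \<alpha>) * \<bar>f s powr \<alpha> - g s powr \<alpha>\<bar>" .
  qed
  also have "\<dots> = x powr (- \<alpha>) * rho \<alpha> \<mu> f g" by (simp add: rho_def)
  finally show ?thesis .
qed

text \<open>If the two values differ by more than \<open>2 * d\<close> then a multiple of \<open>d\<close> separates them. Unless the value at \<open>f\<close> exceeds
\<open>Suc m * d\<close>, one of the first few multiples does, and \<open>prob_extremal_value_separated\<close> applies to each of these.\<close>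

lemma prob_extremal_value_distance:
  assumes f: "f \<in> Lplus \<alpha> \<mu>" and g: "g \<in> Lplus \<alpha> \<mu>" and d: "0 < d"
  shows "prob {w\<in>space Q. \<bar>extremal_value g w - extremal_value f w\<bar> > 2 * d}
    \<le> 1 - exp (- ((real (Suc m) * d) powr (- \<alpha>) * (\<integral>s. f s powr \<alpha> \<partial>\<mu>)))
      + 2 * (\<Sum>i\<le>Suc m. (real (Suc i) * d) powr (- \<alpha>)) * rho \<alpha> \<mu> g f"
proof -
  note [measurable] = extremal_value_measurable[OF f] extremal_value_measurable[OF g]
  define x where "x i = real (Suc i) * d" for i
  have x_pos: "0 < x i" for i using d by (simp add: x_def)
  define big where "big = {w\<in>space Q. \<not> extremal_value f w \<le> x m}"
  define S1 where "S1 i = {w\<in>space Q. extremal_value f w \<le> x i \<and> x i < extremal_value g w}" for i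
  define S2 where "S2 i = {w\<in>space Q. extremal_value g w \<le> x i \<and> x i < extremal_value f w}" for i
  have S [measurable]: "big \<in> events" "S1 i \<in> events" "S2 i \<in> events" for i
    unfolding big_def S1_def S2_def by measurable
  have "{w\<in>space Q. \<bar>extremal_value g w - extremal_value f w\<bar> > 2 * d} \<subseteq> big \<union> ((\<Union>i\<le>Suc m. S1 i) \<union> (\<Union>i\<le>Suc m. S2 i))"
  proof
    fix w assume "w \<in> {w\<in>space Q. \<bar>extremal_value g w - extremal_value f w\<bar> > 2 * d}"
    then have w: "w \<in> space Q" "\<bar>extremal_value g w - extremal_value f w\<bar> > 2 * d" by auto
    show "w \<in> big \<union> ((\<Union>i\<le>Suc m. S1 i) \<union> (\<Union>i\<le>Suc m. S2 i))"
    proof (cases "w \<in> big")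
      case False
      then have fm: "extremal_value f w \<le> x m" using w by (simp add: big_def)
      define v where "v = min (extremal_value f w) (extremal_value g w)"
      \<comment> \<open>The grid point \<open>x i = Suc i * d\<close> is the first multiple of \<open>d\<close> above the smaller value \<open>v\<close>.\<close>
      define i where "i = nat \<lfloor>v / d\<rfloor>"
      have v: "0 \<le> v" "v \<le> x m" using fm by (auto simp: v_def extremal_value_def)
      have fl: "real i \<le> v / d" "v / d < real i + 1"
        using v(1) d unfolding i_def by (auto simp: divide_nonneg_pos)
      have "real i * d \<le> v" "v < x i" using fl d by (auto simp: x_def field_simps)
      then have "x i \<le> v + d" "v \<le> x i" by (auto simp: x_def algebra_simps)
      moreover have "i \<le> Suc m"
      proof -
        have "real i \<le> v / d" by (rule fl)
        also have "\<dots> \<le> real (Suc m)" using v(2) d by (simp add: x_def field_simps)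
        finally show ?thesis by simp
      qed
      moreover have "v + d < max (extremal_value f w) (extremal_value g w)"
        using w(2) d unfolding v_def by (auto simp: min_def max_def abs_if split: if_splits)
      ultimately have "w \<in> S1 i \<or> w \<in> S2 i" using w(1)
        unfolding S1_def S2_def v_def by (auto simp: min_def max_def split: if_splits)
      with \<open>i \<le> Suc m\<close> show ?thesis by blast
    qed simp
  qed
  then have "prob {w\<in>space Q. \<bar>extremal_value g w - extremal_value f w\<bar> > 2 * d}
      \<le> prob (big \<union> ((\<Union>i\<le>Suc m. S1 i) \<union> (\<Union>i\<le>Suc m. S2 i)))"
    by (intro finite_measure_mono) auto
  also have "\<dots> \<le> prob big + (prob (\<Union>i\<le>Suc m. S1 i) + prob (\<Union>i\<le>Suc m. S2 i))"
    by (intro order_trans[OF measure_Un_le] add_left_mono measure_Un_le) auto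
  also have "\<dots> \<le> prob big + ((\<Sum>i\<le>Suc m. prob (S1 i)) + (\<Sum>i\<le>Suc m. prob (S2 i)))"
    by (intro add_left_mono add_mono finite_measure_subadditive_finite) auto
  also have "\<dots> \<le> prob big + ((\<Sum>i\<le>Suc m. x i powr (- \<alpha>) * rho \<alpha> \<mu> g f) + (\<Sum>i\<le>Suc m. x i powr (- \<alpha>) * rho \<alpha> \<mu> g f))"
    unfolding S1_def S2_def
    using prob_extremal_value_separated[OF f g x_pos] prob_extremal_value_separated[OF g f x_pos]
    by (intro add_left_mono add_mono sum_mono) (auto simp: rho_commute[of \<alpha> \<mu> f g])
  also have "prob big = 1 - prob {w\<in>space Q. extremal_value f w \<le> x m}"
    unfolding big_def by (rule prob_neg) measurable
  also have "prob {w\<in>space Q. extremal_value f w \<le> x m} = exp (- (x m powr (- \<alpha>) * (\<integral>s. f s powr \<alpha> \<partial>\<mu>)))"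
    by (rule prob_extremal_value_le[OF f x_pos])
  finally show ?thesis
    unfolding x_def sum_distrib_right[symmetric] by (simp only: mult.assoc mult_2 ring_distribs)
qed

text \<open>In \<open>prob_extremal_value_distance\<close> choose \<open>m\<close> first, to make the tail of the value at \<open>f\<close> small; the remaining
term is then a constant multiple of the distance \<open>rho\<close>, which tends to 0.\<close>

lemma has_extremal_integral_extremal_value:
  assumes f: "f \<in> Lplus \<alpha> \<mu>"
  shows "has_extremal_integral \<alpha> \<mu> Q sup_measure f (extremal_value f)"
  unfolding has_extremal_integral_def
proof (intro conjI allI impI f extremal_value_measurable)
  fix g :: "nat \<Rightarrow> real \<Rightarrow> real"
  assume "(\<forall>n. simple_function \<mu> (g n) \<and> g n \<in> Lplus \<alpha> \<mu>) \<and> (\<lambda>n. rho \<alpha> \<mu> (g n) f) \<longlonglongrightarrow> 0"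
  then have g: "\<And>n. g n \<in> Lplus \<alpha> \<mu>" and lim: "(\<lambda>n. rho \<alpha> \<mu> (g n) f) \<longlonglongrightarrow> 0" by auto
  have eq: "simple_extremal_integral \<mu> sup_measure (g n) = extremal_value (g n)" for n
    by (simp add: simple_extremal_integral_eq extremal_value_def fun_eq_iff)
  show "tendsto_in_prob Q (\<lambda>n. simple_extremal_integral \<mu> sup_measure (g n)) (extremal_value f)"
    unfolding eq tendsto_in_prob_def
  proof (intro allI impI)
    fix \<epsilon> :: real assume "0 < \<epsilon>"
    define d where "d = \<epsilon> / 2"
    have d: "0 < d" using \<open>0 < \<epsilon>\<close> by (simp add: d_def)
    define T where "T m = 1 - exp (- ((real (Suc m) * d) powr (- \<alpha>) * (\<integral>s. f s powr \<alpha> \<partial>\<mu>)))" for m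
    define K where "K m = 2 * (\<Sum>i\<le>Suc m. (real (Suc i) * d) powr (- \<alpha>))" for m
    have T_lim: "T \<longlonglongrightarrow> 0"
    proof -
      have "(\<lambda>m. (real (Suc m) * d) powr (- \<alpha>)) \<longlonglongrightarrow> 0" using alpha_pos d by real_asymp
      then have "T \<longlonglongrightarrow> 1 - exp (- (0 * (\<integral>s. f s powr \<alpha> \<partial>\<mu>)))"
        unfolding T_def by (intro tendsto_intros)
      then show ?thesis by simp
    qed
    show "(\<lambda>n. prob {w\<in>space Q. \<epsilon> < \<bar>extremal_value (g n) w - extremal_value f w\<bar>}) \<longlonglongrightarrow> 0"
    proof (rule LIMSEQ_I)
      fix e :: real assume "0 < e"
      then have "\<forall>\<^sub>F m in sequentially. T m < e / 2" using T_lim by (intro order_tendstoD) auto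
      then obtain m where m: "T m < e / 2" by (auto simp: eventually_sequentially)
      have "(\<lambda>n. K m * rho \<alpha> \<mu> (g n) f) \<longlonglongrightarrow> K m * 0" by (intro tendsto_intros lim)
      then have "\<forall>\<^sub>F n in sequentially. K m * rho \<alpha> \<mu> (g n) f < e / 2"
        using \<open>0 < e\<close> by (intro order_tendstoD) auto
      then obtain no where no: "\<And>n. no \<le> n \<Longrightarrow> K m * rho \<alpha> \<mu> (g n) f < e / 2"
        by (auto simp: eventually_sequentially)
      have "prob {w\<in>space Q. \<epsilon> < \<bar>extremal_value (g n) w - extremal_value f w\<bar>} < e" if "no \<le> n" for n
        using prob_extremal_value_distance[OF f g d, of n m] no[OF that] m
        by (simp add: T_def K_def d_def)
      then show "\<exists>no. \<forall>n\<ge>no. norm (prob {w\<in>space Q. \<epsilon> < \<bar>extremal_value (g n) w - extremal_value f w\<bar>} - 0) < e"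
        by (auto intro!: exI[of _ no])
    qed
  qed
qed

end

text \<open>One cell family for the interval and one for each atom; absent components use the location 0, which belongs
to no standardized space.\<close>

lemma frechet_points_std_measure:
  assumes "0 < \<alpha>"
  obtains Q :: "(nat \<Rightarrow> real) measure" and L R
  where "frechet_points Q \<alpha> (std_measure I N) L R"
proof -
  define \<kappa> where "\<kappa> a = (if a = 0 then (if I = 1 then uniform_measure lborel {0<..<1} else return borel 0)
      else return borel (if enat a \<le> N then real a else 0))" for a :: nat
  have sets_\<kappa>: "sets (\<kappa> a) = sets borel" for a by (simp add: \<kappa>_def)
  have \<kappa>_prob: "prob_space (\<kappa> a)" for a
    unfolding \<kappa>_def by (auto intro!: prob_space_uniform_measure prob_space_return)
  obtain Q :: "(nat \<Rightarrow> real) measure" where Q: "prob_space Q" and sets_Q: "sets Q = sets (\<Pi>\<^sub>M i\<in>UNIV. borel)"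
    and void: "\<And>\<phi>. \<phi> \<in> borel_measurable borel \<Longrightarrow> \<phi> 0 = 0 \<Longrightarrow>
      measure Q {x\<in>space Q. \<forall>j. \<phi> (x (2 * j)) \<le> ennreal (x (2 * j + 1))} = ennexp (\<Sum>a. \<integral>\<^sup>+s. \<phi> s \<partial>\<kappa> a)"
    using poisson_points_exist[of \<kappa>, OF \<kappa>_prob sets_\<kappa>] by blast
  let ?S = "std_set I N"
  have S0: "0 \<notin> ?S" by (auto simp: std_set_def)
  have comp: "(\<lambda>x. x k) \<in> borel_measurable Q" for k
    unfolding measurable_cong_sets[OF sets_Q refl] by (rule measurable_component_singleton) simp
  have "frechet_points Q \<alpha> (std_measure I N) (\<lambda>j x. x (2 * j)) (\<lambda>j x. x (2 * j + 1))"
    unfolding frechet_points_def frechet_points_axioms_def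
  proof (intro conjI allI impI Q comp assms)
    fix \<phi> :: "real \<Rightarrow> ennreal" assume \<phi>: "\<phi> \<in> borel_measurable (std_measure I N)"
    define \<psi> where "\<psi> s = (if s \<in> ?S then \<phi> s else 0)" for s
    have \<psi>_meas [measurable]: "\<psi> \<in> borel_measurable borel"
      unfolding \<psi>_def[abs_def] using \<phi>
      by (simp add: measurable_restrict_space_iff[symmetric] measurable_cong_sets[OF sets_std_measure refl])
    have "measure Q {x\<in>space Q. \<forall>j. x (2 * j) \<in> space (std_measure I N) \<longrightarrow> \<phi> (x (2 * j)) \<le> ennreal (x (2 * j + 1))}
        = measure Q {x\<in>space Q. \<forall>j. \<psi> (x (2 * j)) \<le> ennreal (x (2 * j + 1))}"
      by (intro arg_cong[where f = "measure Q"] Collect_cong conj_cong refl all_cong1) (simp add: \<psi>_def)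
    also have "\<dots> = ennexp (\<Sum>a. \<integral>\<^sup>+s. \<psi> s \<partial>\<kappa> a)"
      using S0 by (intro void \<psi>_meas) (simp add: \<psi>_def)
    also have "(\<Sum>a. \<integral>\<^sup>+s. \<psi> s \<partial>\<kappa> a) = (\<integral>\<^sup>+s. \<phi> s \<partial>std_measure I N)"
    proof -
      define A where "A = (if I = 1 then \<integral>\<^sup>+s. \<phi> s * indicator {0<..<1} s \<partial>lborel else 0)"
      have "(\<integral>\<^sup>+s. \<psi> s \<partial>\<kappa> a) = (if a = 0 then A else 0) + (if 1 \<le> a \<and> enat a \<le> N then \<phi> (real a) else 0)" for a
      proof (cases "a = 0")
        case True
        show ?thesis
        proof (cases "I = 1")
          case I: True
          have "(\<integral>\<^sup>+s. \<psi> s \<partial>\<kappa> a) = (\<integral>\<^sup>+s. \<psi> s * indicator {0<..<1} s \<partial>lborel) / emeasure lborel {0<..<1::real}"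
            using True I by (simp add: \<kappa>_def nn_integral_uniform_measure)
          also have "\<dots> = A" unfolding A_def using I
            by (auto intro!: nn_integral_cong simp: \<psi>_def std_set_def divide_ennreal_def split: split_indicator)
          finally show ?thesis using True by simp
        next
          case False
          then show ?thesis using True S0 by (simp add: \<kappa>_def A_def nn_integral_return[OF _ \<psi>_meas] \<psi>_def[of 0])
        qed
      next
        case False
        have "enat a \<le> N \<Longrightarrow> real a \<in> ?S" using False by (auto simp: std_set_def)
        then show ?thesis using False S0 by (simp add: \<kappa>_def nn_integral_return[OF _ \<psi>_meas] \<psi>_def[of 0] \<psi>_def[of "real a"])
      qed
      then have "(\<Sum>a. \<integral>\<^sup>+s. \<psi> s \<partial>\<kappa> a) = (\<Sum>a. if a = 0 then A else 0) + (\<Sum>a. if 1 \<le> a \<and> enat a \<le> N then \<phi> (real a) else 0)"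
        by (simp add: suminf_add)
      also have "(\<Sum>a. if a = 0 then A else 0) = A"
        using sums_unique[OF sums_single[of 0 "\<lambda>_. A"]] by simp
      finally show ?thesis by (simp add: nn_integral_std_measure[OF \<phi>] A_def)
    qed
    finally show "measure Q {x\<in>space Q. \<forall>j. x (2 * j) \<in> space (std_measure I N) \<longrightarrow> \<phi> (x (2 * j)) \<le> ennreal (x (2 * j + 1))}
      = ennexp (\<integral>\<^sup>+s. \<phi> s \<partial>std_measure I N)" .
  qed simp_all
  then show thesis by (rule that)
qed

section \<open>Convergence in probability and joint distributions\<close>

text \<open>A subsequence converges almost everywhere, and Fatou's lemma bounds the distance to its limit.\<close>

lemma L1_complete:
  fixes s :: "nat \<Rightarrow> 'a \<Rightarrow> real"
  assumes s [measurable]: "\<And>n. integrable M (s n)"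
    and cauchy: "\<And>e. 0 < e \<Longrightarrow> \<exists>N. \<forall>i\<ge>N. \<forall>j\<ge>N. (\<integral>x. \<bar>s i x - s j x\<bar> \<partial>M) < e"
  obtains g where "integrable M g" "(\<lambda>n. \<integral>x. \<bar>s n x - g x\<bar> \<partial>M) \<longlonglongrightarrow> 0"
proof -
  obtain r where r: "strict_mono r" and ae: "AE x in M. Cauchy (\<lambda>i. s (r i) x)"
    using cauchy_L1_AE_cauchy_subseq[of M s] s cauchy by auto
  define g where "g x = lim (\<lambda>i. s (r i) x)" for x
  have [measurable]: "s n \<in> borel_measurable M" for n using s by auto
  have g_meas [measurable]: "g \<in> borel_measurable M" unfolding g_def[abs_def] by measurable
  have lim: "AE x in M. (\<lambda>i. s (r i) x) \<longlonglongrightarrow> g x"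
    using ae by eventually_elim (simp add: g_def Cauchy_convergent_iff convergent_LIMSEQ_iff)
  have bound: "(\<integral>\<^sup>+x. ennreal \<bar>s n x - g x\<bar> \<partial>M) \<le> ennreal e"
    if N: "\<forall>i\<ge>N. \<forall>j\<ge>N. (\<integral>x. \<bar>s i x - s j x\<bar> \<partial>M) < e" and "N \<le> n" for N n e
  proof -
    have "(\<integral>\<^sup>+x. ennreal \<bar>s n x - g x\<bar> \<partial>M) = (\<integral>\<^sup>+x. liminf (\<lambda>i. ennreal \<bar>s n x - s (r i) x\<bar>) \<partial>M)"
    proof (rule nn_integral_cong_AE)
      show "AE x in M. ennreal \<bar>s n x - g x\<bar> = liminf (\<lambda>i. ennreal \<bar>s n x - s (r i) x\<bar>)"
        using lim
      proof eventually_elim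
        case (elim x)
        then have "(\<lambda>i. ennreal \<bar>s n x - s (r i) x\<bar>) \<longlonglongrightarrow> ennreal \<bar>s n x - g x\<bar>"
          by (intro tendsto_ennrealI tendsto_intros)
        then show ?case by (intro lim_imp_Liminf[symmetric]) auto
      qed
    qed
    also have "\<dots> \<le> liminf (\<lambda>i. \<integral>\<^sup>+x. ennreal \<bar>s n x - s (r i) x\<bar> \<partial>M)"
      by (rule nn_integral_liminf) measurable
    also have "\<dots> \<le> limsup (\<lambda>i. \<integral>\<^sup>+x. ennreal \<bar>s n x - s (r i) x\<bar> \<partial>M)"
      by (intro Liminf_le_Limsup) auto
    also have "\<dots> \<le> ennreal e"
    proof (rule Limsup_bounded)
      show "\<forall>\<^sub>F i in sequentially. (\<integral>\<^sup>+x. ennreal \<bar>s n x - s (r i) x\<bar> \<partial>M) \<le> ennreal e"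
        using eventually_ge_at_top[of N]
      proof eventually_elim
        case (elim i)
        then have "N \<le> r i" using seq_suble[OF r, of i] by simp
        then have "(\<integral>x. \<bar>s n x - s (r i) x\<bar> \<partial>M) < e" using N \<open>N \<le> n\<close> by blast
        moreover have "(\<integral>\<^sup>+x. ennreal \<bar>s n x - s (r i) x\<bar> \<partial>M) = ennreal (\<integral>x. \<bar>s n x - s (r i) x\<bar> \<partial>M)"
          using s by (intro nn_integral_eq_integral) auto
        ultimately show ?case by (simp add: ennreal_leI)
      qed
    qed
    finally show ?thesis .
  qed
  have int_diff: "integrable M (\<lambda>x. s n x - g x)" if "\<forall>i\<ge>N. \<forall>j\<ge>N. (\<integral>x. \<bar>s i x - s j x\<bar> \<partial>M) < e" "N \<le> n" for N n e
    using bound[OF that] by (intro integrableI_bounded) (auto simp: le_less_trans)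
  obtain N1 where N1: "\<forall>i\<ge>N1. \<forall>j\<ge>N1. (\<integral>x. \<bar>s i x - s j x\<bar> \<partial>M) < 1" using cauchy[of 1] by auto
  have g_int: "integrable M g"
    using Bochner_Integration.integrable_diff[OF s[of N1] int_diff[OF N1 order_refl]] by simp
  have "(\<lambda>n. \<integral>x. \<bar>s n x - g x\<bar> \<partial>M) \<longlonglongrightarrow> 0"
  proof (rule LIMSEQ_I)
    fix e :: real assume "0 < e"
    then obtain N where N: "\<forall>i\<ge>N. \<forall>j\<ge>N. (\<integral>x. \<bar>s i x - s j x\<bar> \<partial>M) < e / 2"
      using cauchy[of "e / 2"] by auto
    have "(\<integral>x. \<bar>s n x - g x\<bar> \<partial>M) < e" if "N \<le> n" for n
    proof -
      have "ennreal (\<integral>x. \<bar>s n x - g x\<bar> \<partial>M) = (\<integral>\<^sup>+x. ennreal \<bar>s n x - g x\<bar> \<partial>M)"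
        using s g_int by (intro nn_integral_eq_integral[symmetric]) auto
      also have "\<dots> \<le> ennreal (e / 2)" by (rule bound[OF N that])
      finally show ?thesis using \<open>0 < e\<close> by (subst (asm) ennreal_le_iff) auto
    qed
    then show "\<exists>no. \<forall>n\<ge>no. norm ((\<integral>x. \<bar>s n x - g x\<bar> \<partial>M) - 0) < e"
      by (auto intro!: exI[of _ N])
  qed
  with g_int show thesis by (rule that)
qed

text \<open>The filter \<open>Fl\<close> is arbitrary in order to cover double sequences, which occur in a Cauchy condition.
Enlarging and shrinking the box by a factor \<open>1 + \<delta>\<close> and \<open>1 - \<delta>\<close> absorbs the deviations of \<open>Y\<close> from \<open>Z\<close>, except on a set
of small probability.\<close>

lemma (in prob_space) prob_le_tendsto:
  fixes Y :: "'k \<Rightarrow> 'i \<Rightarrow> 'a \<Rightarrow> real"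
  assumes F: "finite F" and [measurable]: "\<And>k i. i \<in> F \<Longrightarrow> Y k i \<in> borel_measurable M"
    and [measurable]: "\<And>i. i \<in> F \<Longrightarrow> Z i \<in> borel_measurable M"
    and x: "\<And>i. i \<in> F \<Longrightarrow> 0 < x i"
    and conv: "\<And>i \<epsilon>. i \<in> F \<Longrightarrow> 0 < \<epsilon> \<Longrightarrow> ((\<lambda>k. prob {w\<in>space M. \<bar>Y k i w - Z i w\<bar> > \<epsilon>}) \<longlongrightarrow> 0) Fl"
    and cont: "isCont (\<lambda>y. prob {w\<in>space M. \<forall>i\<in>F. Z i w \<le> y * x i}) 1"
  shows "((\<lambda>k. prob {w\<in>space M. \<forall>i\<in>F. Y k i w \<le> x i}) \<longlongrightarrow> prob {w\<in>space M. \<forall>i\<in>F. Z i w \<le> x i}) Fl"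
proof (rule tendstoI)
  fix e :: real assume e: "0 < e"
  define G where "G y = prob {w\<in>space M. \<forall>i\<in>F. Z i w \<le> y * x i}" for y
  have "\<exists>d>0. \<forall>y. dist y 1 < d \<longrightarrow> dist (G y) (G 1) < e / 2"
    using cont e unfolding G_def[symmetric] continuous_at_eps_delta by (metis half_gt_zero)
  then obtain d where d: "0 < d" "\<And>y. dist y 1 < d \<Longrightarrow> dist (G y) (G 1) < e / 2" by blast
  define \<delta> where "\<delta> = d / 2"
  have \<delta>: "0 < \<delta>" "\<bar>G (1 + \<delta>) - G 1\<bar> < e / 2" "\<bar>G (1 - \<delta>) - G 1\<bar> < e / 2"
    using d(1) d(2)[of "1 + \<delta>"] d(2)[of "1 - \<delta>"] by (auto simp: \<delta>_def dist_real_def)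
  define B where "B k i = {w\<in>space M. \<bar>Y k i w - Z i w\<bar> > \<delta> * x i}" for k i
  have B [measurable]: "i \<in> F \<Longrightarrow> B k i \<in> events" for k i unfolding B_def by measurable
  have "((\<lambda>k. \<Sum>i\<in>F. prob (B k i)) \<longlongrightarrow> (\<Sum>i\<in>F. 0)) Fl"
    unfolding B_def using \<delta>(1) x by (intro tendsto_sum conv) auto
  then have "\<forall>\<^sub>F k in Fl. (\<Sum>i\<in>F. prob (B k i)) < e / 2"
    using e by (intro order_tendstoD(2)) auto
  then show "\<forall>\<^sub>F k in Fl. dist (prob {w\<in>space M. \<forall>i\<in>F. Y k i w \<le> x i}) (prob {w\<in>space M. \<forall>i\<in>F. Z i w \<le> x i}) < e"
  proof eventually_elim
    case (elim k)
    define U where "U = (\<Union>i\<in>F. B k i)"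
    have U [measurable]: "U \<in> events" unfolding U_def using F by (intro sets.finite_UN) auto
    have "prob U \<le> (\<Sum>i\<in>F. prob (B k i))"
      unfolding U_def using F by (intro finite_measure_subadditive_finite) auto
    then have U_small: "prob U < e / 2" using elim by simp
    have Z_sets: "{w\<in>space M. \<forall>i\<in>F. Z i w \<le> y * x i} \<in> events" for y
      using F by (intro sets.sets_Collect_finite_All borel_measurable_le) auto
    have Y_sets: "{w\<in>space M. \<forall>i\<in>F. Y k i w \<le> x i} \<in> events"
      using F by (intro sets.sets_Collect_finite_All borel_measurable_le) auto
    have near: "\<bar>Y k i w - Z i w\<bar> \<le> \<delta> * x i" if "w \<in> space M" "w \<notin> U" "i \<in> F" for w i
      using that by (auto simp: U_def B_def not_less)
    have "prob {w\<in>space M. \<forall>i\<in>F. Y k i w \<le> x i} \<le> prob ({w\<in>space M. \<forall>i\<in>F. Z i w \<le> (1 + \<delta>) * x i} \<union> U)"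
    proof (rule finite_measure_mono)
      show "{w\<in>space M. \<forall>i\<in>F. Y k i w \<le> x i} \<subseteq> {w\<in>space M. \<forall>i\<in>F. Z i w \<le> (1 + \<delta>) * x i} \<union> U"
      proof safe
        fix w i assume "w \<in> space M" "\<forall>i\<in>F. Y k i w \<le> x i" "w \<notin> U" "i \<in> F"
        then have "Y k i w \<le> x i" "\<bar>Y k i w - Z i w\<bar> \<le> \<delta> * x i" using near by auto
        then show "Z i w \<le> (1 + \<delta>) * x i" by (simp add: algebra_simps abs_le_iff)
      qed
    qed (use Z_sets in auto)
    also have "\<dots> \<le> G (1 + \<delta>) + prob U" unfolding G_def by (intro measure_Un_le Z_sets U)
    finally have upper: "prob {w\<in>space M. \<forall>i\<in>F. Y k i w \<le> x i} \<le> G (1 + \<delta>) + prob U" .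
    have "G (1 - \<delta>) \<le> prob ({w\<in>space M. \<forall>i\<in>F. Y k i w \<le> x i} \<union> U)"
      unfolding G_def
    proof (rule finite_measure_mono)
      show "{w\<in>space M. \<forall>i\<in>F. Z i w \<le> (1 - \<delta>) * x i} \<subseteq> {w\<in>space M. \<forall>i\<in>F. Y k i w \<le> x i} \<union> U"
      proof safe
        fix w i assume "w \<in> space M" "\<forall>i\<in>F. Z i w \<le> (1 - \<delta>) * x i" "w \<notin> U" "i \<in> F"
        then have "Z i w \<le> (1 - \<delta>) * x i" "\<bar>Y k i w - Z i w\<bar> \<le> \<delta> * x i" using near by auto
        then show "Y k i w \<le> x i" by (simp add: algebra_simps abs_le_iff)
      qed
    qed (use Y_sets in auto)
    also have "\<dots> \<le> prob {w\<in>space M. \<forall>i\<in>F. Y k i w \<le> x i} + prob U" by (intro measure_Un_le Y_sets U)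
    finally have lower: "G (1 - \<delta>) \<le> prob {w\<in>space M. \<forall>i\<in>F. Y k i w \<le> x i} + prob U" .
    have "prob {w\<in>space M. \<forall>i\<in>F. Z i w \<le> x i} = G 1" by (simp add: G_def)
    then show ?case using upper lower U_small \<delta>(2,3) unfolding dist_real_def by linarith
  qed
qed

lemma frechet_process_measurable:
  assumes "frechet_process P \<alpha> T X" "t \<in> T"
  shows "X t \<in> borel_measurable P"
proof -
  have "\<forall>F a. finite F \<and> F \<noteq> {} \<and> F \<subseteq> T \<and> (\<forall>t\<in>F. (a t :: real) > 0) \<longrightarrow>
      (\<exists>\<sigma>. frechet_rv P \<alpha> \<sigma> (\<lambda>w. MAX t\<in>F. a t * X t w))"
    using assms(1) by (simp add: frechet_process_def)
  from this[rule_format, of "{t}" "\<lambda>_. 1"] show ?thesis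
    using assms(2) by (auto simp: frechet_rv_def)
qed

text \<open>A joint distribution function of the process is the distribution function of a max-linear combination.\<close>

lemma frechet_process_joint_cdf:
  assumes X: "frechet_process P \<alpha> T X" and \<alpha>: "0 < \<alpha>"
    and F: "finite F" "F \<noteq> {}" "F \<subseteq> T" "\<And>t. t \<in> F \<Longrightarrow> 0 < x t"
  obtains c where "0 < c"
    "\<And>y. 0 < y \<Longrightarrow> measure P {w\<in>space P. \<forall>t\<in>F. X t w \<le> y * x t} = exp (- c * y powr (- \<alpha>))"
proof -
  have "\<forall>F a. finite F \<and> F \<noteq> {} \<and> F \<subseteq> T \<and> (\<forall>t\<in>F. (a t :: real) > 0) \<longrightarrow>
      (\<exists>\<sigma>. frechet_rv P \<alpha> \<sigma> (\<lambda>w. MAX t\<in>F. a t * X t w))"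
    using X by (simp add: frechet_process_def)
  from this[rule_format, of F "\<lambda>t. 1 / x t"] obtain \<sigma>
    where \<sigma>: "frechet_rv P \<alpha> \<sigma> (\<lambda>w. MAX t\<in>F. 1 / x t * X t w)" using F by auto
  show thesis
  proof (rule that[of "\<sigma> powr \<alpha>"])
    show "0 < \<sigma> powr \<alpha>" using \<sigma> by (simp add: frechet_rv_def)
    fix y :: real assume y: "0 < y"
    have "(\<forall>t\<in>F. X t w \<le> y * x t) \<longleftrightarrow> (MAX t\<in>F. 1 / x t * X t w) \<le> y" for w
      using F by (auto simp: Max_le_iff field_simps)
    then show "measure P {w\<in>space P. \<forall>t\<in>F. X t w \<le> y * x t} = exp (- (\<sigma> powr \<alpha>) * y powr (- \<alpha>))"
      using \<sigma> y by (simp add: frechet_rv_def frechet_cdf_def)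
  qed
qed

lemma frechet_process_joint_cdf_continuous:
  assumes X: "frechet_process P \<alpha> T X" and \<alpha>: "0 < \<alpha>"
    and F: "finite F" "F \<subseteq> T" "\<And>t. t \<in> F \<Longrightarrow> 0 < x t"
  shows "isCont (\<lambda>y. measure P {w\<in>space P. \<forall>t\<in>F. X t w \<le> y * x t}) 1"
proof (cases "F = {}")
  case False
  obtain c where c: "\<And>y. 0 < y \<Longrightarrow> measure P {w\<in>space P. \<forall>t\<in>F. X t w \<le> y * x t} = exp (- c * y powr (- \<alpha>))"
    using frechet_process_joint_cdf[where x = x, OF X \<alpha> F(1) False F(2) F(3)] by blast
  have "isCont (\<lambda>y. exp (- c * y powr (- \<alpha>))) 1" by (intro continuous_intros) auto
  moreover have "\<forall>\<^sub>F y in nhds 1. exp (- c * y powr (- \<alpha>)) = measure P {w\<in>space P. \<forall>t\<in>F. X t w \<le> y * x t}"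
    using eventually_nhds_in_open[of "{0<..}" "1::real"] by (auto elim!: eventually_mono simp: c)
  ultimately show ?thesis by (subst (asm) isCont_cong)
qed simp

section \<open>From a dense index set to the whole process\<close>

text \<open>A spectral representation read at the level of distribution functions. It is stated for the \<open>\<alpha>\<close>-th powers \<open>q t\<close> of
the spectral functions, which are integrable and on which limits and densities act linearly.\<close>

definition represents_cdfs ::
  "real \<Rightarrow> 's measure \<Rightarrow> 't set \<Rightarrow> ('t \<Rightarrow> 's \<Rightarrow> real) \<Rightarrow> 'w measure \<Rightarrow> ('t \<Rightarrow> 'w \<Rightarrow> real) \<Rightarrow> bool" where
  "represents_cdfs \<alpha> \<mu> T q P X \<longleftrightarrow>
     (\<forall>t\<in>T. integrable \<mu> (q t)) \<and> (\<forall>t\<in>T. \<forall>s. 0 \<le> q t s) \<and>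
     (\<forall>F x. finite F \<and> F \<noteq> {} \<and> F \<subseteq> T \<and> (\<forall>t\<in>F. 0 < x t) \<longrightarrow>
        measure P {w\<in>space P. \<forall>t\<in>F. X t w \<le> x t} = exp (- (\<integral>s. (MAX t\<in>F. q t s / x t powr \<alpha>) \<partial>\<mu>)))"

lemma represents_cdfs_joint:
  assumes "represents_cdfs \<alpha> \<mu> T q P X"
    and "finite F" "F \<noteq> {}" "F \<subseteq> T" "\<And>t. t \<in> F \<Longrightarrow> 0 < x t"
  shows "measure P {w\<in>space P. \<forall>t\<in>F. X t w \<le> x t} = exp (- (\<integral>s. (MAX t\<in>F. q t s / x t powr \<alpha>) \<partial>\<mu>))"
  using assms by (simp add: represents_cdfs_def)

text \<open>The indices \<open>\<tau> j\<close> may coincide; among equal ones the smallest bound decides. Families arise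
when several variables are approximated at the same time.\<close>

lemma represents_cdfs_family:
  assumes q: "represents_cdfs \<alpha> \<mu> T q P X" and \<alpha>: "0 < \<alpha>"
    and J: "finite J" "J \<noteq> {}" "\<And>j. j \<in> J \<Longrightarrow> \<tau> j \<in> T" "\<And>j. j \<in> J \<Longrightarrow> 0 < x j"
  shows "measure P {w\<in>space P. \<forall>j\<in>J. X (\<tau> j) w \<le> x j} = exp (- (\<integral>s. (MAX j\<in>J. q (\<tau> j) s / x j powr \<alpha>) \<partial>\<mu>))"
proof -
  define x' where "x' t = Min (x ` {j\<in>J. \<tau> j = t})" for t
  have fin: "finite (x ` {j\<in>J. \<tau> j = t})" for t using J by simp
  have x'_le: "x' (\<tau> j) \<le> x j" if "j \<in> J" for j
    unfolding x'_def using that fin by (intro Min_le) auto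
  have x'_in: "\<exists>j\<in>J. \<tau> j = t \<and> x' t = x j" if "t \<in> \<tau> ` J" for t
  proof -
    have "x' t \<in> x ` {j\<in>J. \<tau> j = t}" unfolding x'_def using that fin by (intro Min_in) auto
    then show ?thesis by auto
  qed
  have x'_pos: "0 < x' t" if "t \<in> \<tau> ` J" for t using x'_in[OF that] J(4) by auto
  have "(\<forall>j\<in>J. X (\<tau> j) w \<le> x j) \<longleftrightarrow> (\<forall>t\<in>\<tau> ` J. X t w \<le> x' t)" for w
  proof
    assume *: "\<forall>j\<in>J. X (\<tau> j) w \<le> x j"
    show "\<forall>t\<in>\<tau> ` J. X t w \<le> x' t"
    proof
      fix t assume "t \<in> \<tau> ` J"
      then obtain j where "j \<in> J" "\<tau> j = t" "x' t = x j" using x'_in by blast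
      then show "X t w \<le> x' t" using * by auto
    qed
  next
    assume *: "\<forall>t\<in>\<tau> ` J. X t w \<le> x' t"
    show "\<forall>j\<in>J. X (\<tau> j) w \<le> x j"
    proof
      fix j assume "j \<in> J"
      then show "X (\<tau> j) w \<le> x j" using * x'_le[of j] by (meson imageI order_trans)
    qed
  qed
  then have "measure P {w\<in>space P. \<forall>j\<in>J. X (\<tau> j) w \<le> x j} = measure P {w\<in>space P. \<forall>t\<in>\<tau> ` J. X t w \<le> x' t}"
    by simp
  also have "\<dots> = exp (- (\<integral>s. (MAX t\<in>\<tau> ` J. q t s / x' t powr \<alpha>) \<partial>\<mu>))"
    using J x'_pos by (intro represents_cdfs_joint[OF q]) auto
  also have "(\<lambda>s. MAX t\<in>\<tau> ` J. q t s / x' t powr \<alpha>) = (\<lambda>s. MAX j\<in>J. q (\<tau> j) s / x j powr \<alpha>)"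
  proof
    fix s show "(MAX t\<in>\<tau> ` J. q t s / x' t powr \<alpha>) = (MAX j\<in>J. q (\<tau> j) s / x j powr \<alpha>)"
  proof (rule antisym)
    show "(MAX t\<in>\<tau> ` J. q t s / x' t powr \<alpha>) \<le> (MAX j\<in>J. q (\<tau> j) s / x j powr \<alpha>)"
    proof (rule Max.boundedI)
      fix a assume "a \<in> (\<lambda>t. q t s / x' t powr \<alpha>) ` \<tau> ` J"
      then obtain t where t: "t \<in> \<tau> ` J" "a = q t s / x' t powr \<alpha>" by blast
      then obtain j where "j \<in> J" "\<tau> j = t" "x' t = x j" using x'_in by blast
      then show "a \<le> (MAX j\<in>J. q (\<tau> j) s / x j powr \<alpha>)" using t J by (intro Max_ge) auto
    qed (use J in auto)
    show "(MAX j\<in>J. q (\<tau> j) s / x j powr \<alpha>) \<le> (MAX t\<in>\<tau> ` J. q t s / x' t powr \<alpha>)"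
    proof (rule Max.boundedI)
      fix a assume "a \<in> (\<lambda>j. q (\<tau> j) s / x j powr \<alpha>) ` J"
      then obtain j where j: "j \<in> J" "a = q (\<tau> j) s / x j powr \<alpha>" by blast
      have "0 \<le> q (\<tau> j) s" using q J(3)[OF j(1)] by (simp add: represents_cdfs_def)
      then have "a \<le> q (\<tau> j) s / x' (\<tau> j) powr \<alpha>"
        unfolding j(2) using x'_le[OF j(1)] x'_pos[of "\<tau> j"] j(1) \<alpha>
        by (intro divide_left_mono powr_mono2 mult_pos_pos) auto
      also have "\<dots> \<le> (MAX t\<in>\<tau> ` J. q t s / x' t powr \<alpha>)" using j J by (intro Max_ge) auto
      finally show "a \<le> (MAX t\<in>\<tau> ` J. q t s / x' t powr \<alpha>)" .
    qed (use J in auto)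
  qed
  qed
  finally show ?thesis .
qed

lemma abs_MAX_diff_le_sum:
  fixes f g :: "'i \<Rightarrow> real"
  assumes F: "finite F" "F \<noteq> {}"
  shows "\<bar>(MAX i\<in>F. f i) - (MAX i\<in>F. g i)\<bar> \<le> (\<Sum>i\<in>F. \<bar>f i - g i\<bar>)"
proof -
  have "(MAX i\<in>F. f i) \<le> (MAX i\<in>F. g i) + (\<Sum>i\<in>F. \<bar>f i - g i\<bar>)" for f g :: "'i \<Rightarrow> real"
  proof (rule Max.boundedI)
    fix a assume "a \<in> f ` F"
    then obtain i where i: "i \<in> F" "a = f i" by blast
    have "\<bar>f i - g i\<bar> \<le> (\<Sum>i\<in>F. \<bar>f i - g i\<bar>)" using i F by (intro member_le_sum) auto
    moreover have "g i \<le> (MAX i\<in>F. g i)" using i F by (intro Max_ge) auto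
    ultimately show "a \<le> (MAX i\<in>F. g i) + (\<Sum>i\<in>F. \<bar>f i - g i\<bar>)" using i by linarith
  qed (use F in auto)
  from this[of f g] this[of g f] show ?thesis by (simp add: abs_minus_commute abs_le_iff)
qed

text \<open>For \<open>t\<close> outside \<open>T0\<close> the function \<open>q' t\<close> is the limit in \<open>L\<^sup>1\<close> of the functions \<open>q (u n)\<close> for a sequence \<open>u\<close> along which the
process converges to \<open>X t\<close> in probability. For \<open>t \<in> T0\<close> the constant sequence is taken, which keeps \<open>q t\<close>
itself and not just a version of it: the ratios of these functions generate a \<open>\<sigma>\<close>-algebra that must not change.\<close>

lemma represents_cdfs_extend:
  fixes X :: "'t \<Rightarrow> 'w \<Rightarrow> real" and q :: "'t \<Rightarrow> 's \<Rightarrow> real"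
  assumes X: "frechet_process P \<alpha> T X" and \<alpha>: "0 < \<alpha>" and T0: "T0 \<subseteq> T"
    and dense: "\<And>t. t \<in> T \<Longrightarrow> \<exists>u::nat \<Rightarrow> 't. (\<forall>n. u n \<in> T0) \<and> tendsto_in_prob P (\<lambda>n. X (u n)) (X t)"
    and q: "represents_cdfs \<alpha> \<mu> T0 q P X"
  obtains q' where "represents_cdfs \<alpha> \<mu> T q' P X" "\<And>t. t \<in> T0 \<Longrightarrow> q' t = q t"
proof -
  interpret P: prob_space P using X by (simp add: frechet_process_def)
  have X_meas: "t \<in> T \<Longrightarrow> X t \<in> borel_measurable P" for t by (rule frechet_process_measurable[OF X])
  have q_int: "t \<in> T0 \<Longrightarrow> integrable \<mu> (q t)" and q_nonneg: "t \<in> T0 \<Longrightarrow> 0 \<le> q t s" for t s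
    using q by (auto simp: represents_cdfs_def)
  have ex: "\<exists>u h. (\<forall>n::nat. u n \<in> T0) \<and> tendsto_in_prob P (\<lambda>n. X (u n)) (X t) \<and>
      integrable \<mu> h \<and> (\<forall>s. 0 \<le> h s) \<and> (\<lambda>n. \<integral>s. \<bar>q (u n) s - h s\<bar> \<partial>\<mu>) \<longlonglongrightarrow> 0 \<and> (t \<in> T0 \<longrightarrow> h = q t)"
    if t: "t \<in> T" for t
  proof (cases "t \<in> T0")
    case True
    have "tendsto_in_prob P (\<lambda>n. X t) (X t)" by (simp add: tendsto_in_prob_def)
    then show ?thesis using True q_int q_nonneg by (intro exI[of _ "\<lambda>_. t"] exI[of _ "q t"]) auto
  next
    case False
    obtain u :: "nat \<Rightarrow> 't" where u: "\<And>n. u n \<in> T0" "tendsto_in_prob P (\<lambda>n. X (u n)) (X t)"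
      using dense[OF t] by blast
    define p where "p = P.prob {w\<in>space P. X t w \<le> 1}"
    obtain c where c: "\<And>y. 0 < y \<Longrightarrow> P.prob {w\<in>space P. \<forall>t\<in>{t}. X t w \<le> y * 1} = exp (- c * y powr (- \<alpha>))"
      using frechet_process_joint_cdf[where x = "\<lambda>_. 1" and F = "{t}", OF X \<alpha>] t by auto
    have p: "p = exp (- c)" using c[of 1] by (simp add: p_def)
    then have p_nonzero: "p \<noteq> 0" by simp
    have cont: "isCont (\<lambda>y. P.prob {w\<in>space P. X t w \<le> y * 1}) 1"
      using frechet_process_joint_cdf_continuous[OF X \<alpha>, of "{t}" "\<lambda>_. 1"] t by simp
    have ufilter: "filterlim (\<lambda>k. fst k) sequentially (sequentially \<times>\<^sub>F sequentially)"
      "filterlim (\<lambda>k. snd k) sequentially (sequentially \<times>\<^sub>F sequentially)"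
      by (rule filterlim_fst filterlim_snd)+
    have pair: "((\<lambda>k. P.prob {w\<in>space P. \<forall>i\<in>UNIV. X (u (if i then fst k else snd k)) w \<le> 1})
        \<longlongrightarrow> P.prob {w\<in>space P. \<forall>i\<in>(UNIV::bool set). X t w \<le> 1}) (sequentially \<times>\<^sub>F sequentially)"
    proof (rule P.prob_le_tendsto)
      fix i :: bool and \<epsilon> :: real assume "0 < \<epsilon>"
      then have *: "(\<lambda>n. P.prob {w\<in>space P. \<bar>X (u n) w - X t w\<bar> > \<epsilon>}) \<longlonglongrightarrow> 0"
        using u(2) by (simp add: tendsto_in_prob_def)
      show "((\<lambda>k. P.prob {w\<in>space P. \<bar>X (u (if i then fst k else snd k)) w - X t w\<bar> > \<epsilon>}) \<longlongrightarrow> 0) (sequentially \<times>\<^sub>F sequentially)"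
        using filterlim_compose[OF * ufilter(1)] filterlim_compose[OF * ufilter(2)] by (cases i) auto
    qed (use X_meas u(1) t T0 cont in auto)
    have one: "(\<lambda>k. P.prob {w\<in>space P. \<forall>i\<in>{()}. X (u k) w \<le> 1}) \<longlonglongrightarrow> P.prob {w\<in>space P. \<forall>i\<in>{()}. X t w \<le> 1}"
      by (rule P.prob_le_tendsto) (use X_meas u t T0 cont in \<open>auto simp: tendsto_in_prob_def\<close>)
    define I1 where "I1 n = (\<integral>s. q (u n) s \<partial>\<mu>)" for n
    define I2 where "I2 m n = (\<integral>s. max (q (u m) s) (q (u n) s) \<partial>\<mu>)" for m n
    have "P.prob {w\<in>space P. \<forall>i\<in>{()}. X (u k) w \<le> 1} = exp (- I1 k)" for k
      using represents_cdfs_family[OF q \<alpha>, of "{()}" "\<lambda>_. u k" "\<lambda>_. 1"] u by (simp add: I1_def)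
    then have "(\<lambda>k. exp (- I1 k)) \<longlonglongrightarrow> p" using one by (simp add: p_def)
    then have "(\<lambda>k. - ln (exp (- I1 k))) \<longlonglongrightarrow> - ln p" by (intro tendsto_intros p_nonzero)
    then have I1_lim: "I1 \<longlonglongrightarrow> c" by (simp add: p)
    have "P.prob {w\<in>space P. \<forall>i\<in>UNIV. X (u (if i then fst k else snd k)) w \<le> 1} = exp (- I2 (fst k) (snd k))" for k
      using represents_cdfs_family[OF q \<alpha>, of UNIV "\<lambda>i. u (if i then fst k else snd k)" "\<lambda>_. 1"] u
      by (simp add: I2_def UNIV_bool max.commute)
    then have "((\<lambda>k. exp (- I2 (fst k) (snd k))) \<longlongrightarrow> p) (sequentially \<times>\<^sub>F sequentially)" using pair by (simp add: p_def)
    then have "((\<lambda>k. - ln (exp (- I2 (fst k) (snd k)))) \<longlongrightarrow> - ln p) (sequentially \<times>\<^sub>F sequentially)"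
      by (intro tendsto_intros p_nonzero)
    then have I2_lim: "((\<lambda>k. I2 (fst k) (snd k)) \<longlongrightarrow> c) (sequentially \<times>\<^sub>F sequentially)" by (simp add: p)
    have dist: "(\<integral>s. \<bar>q (u m) s - q (u n) s\<bar> \<partial>\<mu>) = 2 * I2 m n - I1 m - I1 n" for m n
    proof -
      have int: "integrable \<mu> (q (u m))" "integrable \<mu> (q (u n))" using q_int u by auto
      have "(\<integral>s. \<bar>q (u m) s - q (u n) s\<bar> \<partial>\<mu>) = (\<integral>s. 2 * max (q (u m) s) (q (u n) s) - q (u m) s - q (u n) s \<partial>\<mu>)"
        by (intro Bochner_Integration.integral_cong) (auto simp: max_def)
      also have "\<dots> = 2 * I2 m n - I1 m - I1 n"
        unfolding I1_def I2_def using int by simp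
      finally show ?thesis .
    qed
    have "((\<lambda>k. 2 * I2 (fst k) (snd k) - I1 (fst k) - I1 (snd k)) \<longlongrightarrow> 2 * c - c - c) (sequentially \<times>\<^sub>F sequentially)"
      by (intro tendsto_intros I2_lim filterlim_compose[OF I1_lim] ufilter)
    then have lim0: "((\<lambda>k. \<integral>s. \<bar>q (u (fst k)) s - q (u (snd k)) s\<bar> \<partial>\<mu>) \<longlongrightarrow> 0) (sequentially \<times>\<^sub>F sequentially)"
      by (simp add: dist)
    have "\<exists>N. \<forall>i\<ge>N. \<forall>j\<ge>N. (\<integral>s. \<bar>q (u i) s - q (u j) s\<bar> \<partial>\<mu>) < e" if "0 < e" for e
      using order_tendstoD(2)[OF lim0 that] by (simp add: eventually_prod_sequentially)  blast
    then obtain h0 where h0: "integrable \<mu> h0" "(\<lambda>n. \<integral>s. \<bar>q (u n) s - h0 s\<bar> \<partial>\<mu>) \<longlonglongrightarrow> 0"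
      using L1_complete[of \<mu> "\<lambda>n. q (u n)"] q_int u by blast
    \<comment> \<open>The limit is determined almost everywhere only; this version is nonnegative everywhere.\<close>
    define h where "h s = max 0 (h0 s)" for s
    have h_int: "integrable \<mu> h" unfolding h_def[abs_def] using h0(1) by auto
    have "(\<lambda>n. \<integral>s. \<bar>q (u n) s - h s\<bar> \<partial>\<mu>) \<longlonglongrightarrow> 0"
    proof (rule tendsto_sandwich[OF _ _ tendsto_const h0(2)])
      show "\<forall>\<^sub>F n in sequentially. (\<integral>s. \<bar>q (u n) s - h s\<bar> \<partial>\<mu>) \<le> (\<integral>s. \<bar>q (u n) s - h0 s\<bar> \<partial>\<mu>)"
      proof (intro always_eventually allI integral_mono)
        fix n s
        show "\<bar>q (u n) s - h s\<bar> \<le> \<bar>q (u n) s - h0 s\<bar>"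
          using q_nonneg[OF u(1)[of n], of s] by (auto simp: h_def max_def abs_if)
      qed (use q_int u h_int h0(1) in auto)
    qed (auto intro!: always_eventually Bochner_Integration.integral_nonneg)
    then show ?thesis using u h_int False
      by (intro exI[of _ u] exI[of _ h]) (auto simp: h_def)
  qed
  then have "\<forall>t\<in>T. \<exists>u h. (\<forall>n::nat. u n \<in> T0) \<and> tendsto_in_prob P (\<lambda>n. X (u n)) (X t) \<and>
      integrable \<mu> h \<and> (\<forall>s. 0 \<le> h s) \<and> (\<lambda>n. \<integral>s. \<bar>q (u n) s - h s\<bar> \<partial>\<mu>) \<longlonglongrightarrow> 0 \<and> (t \<in> T0 \<longrightarrow> h = q t)"
    by blast
  then obtain u where "\<forall>t\<in>T. \<exists>h. (\<forall>n::nat. u t n \<in> T0) \<and> tendsto_in_prob P (\<lambda>n. X (u t n)) (X t) \<and>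
      integrable \<mu> h \<and> (\<forall>s. 0 \<le> h s) \<and> (\<lambda>n. \<integral>s. \<bar>q (u t n) s - h s\<bar> \<partial>\<mu>) \<longlonglongrightarrow> 0 \<and> (t \<in> T0 \<longrightarrow> h = q t)"
    by (rule bchoice[THEN exE])
  then obtain h where uh: "\<forall>t\<in>T. (\<forall>n::nat. u t n \<in> T0) \<and> tendsto_in_prob P (\<lambda>n. X (u t n)) (X t) \<and>
      integrable \<mu> (h t) \<and> (\<forall>s. 0 \<le> h t s) \<and> (\<lambda>n. \<integral>s. \<bar>q (u t n) s - h t s\<bar> \<partial>\<mu>) \<longlonglongrightarrow> 0 \<and> (t \<in> T0 \<longrightarrow> h t = q t)"
    by (rule bchoice[THEN exE])
  have "represents_cdfs \<alpha> \<mu> T h P X"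
    unfolding represents_cdfs_def
  proof (intro conjI allI impI ballI)
    fix F :: "'t set" and x :: "'t \<Rightarrow> real"
    assume "finite F \<and> F \<noteq> {} \<and> F \<subseteq> T \<and> (\<forall>t\<in>F. 0 < x t)"
    then have F: "finite F" "F \<noteq> {}" "F \<subseteq> T" "\<And>t. t \<in> F \<Longrightarrow> 0 < x t" by auto
    have uF: "u t n \<in> T0" "integrable \<mu> (h t)" "(\<lambda>n. \<integral>s. \<bar>q (u t n) s - h t s\<bar> \<partial>\<mu>) \<longlonglongrightarrow> 0"
      "tendsto_in_prob P (\<lambda>n. X (u t n)) (X t)" if "t \<in> F" for t n
      using uh F(3) that by auto
    define K where "K n = (\<integral>s. (MAX t\<in>F. q (u t n) s / x t powr \<alpha>) \<partial>\<mu>)" for n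
    define K0 where "K0 = (\<integral>s. (MAX t\<in>F. h t s / x t powr \<alpha>) \<partial>\<mu>)"
    have "(\<lambda>n. P.prob {w\<in>space P. \<forall>t\<in>F. X (u t n) w \<le> x t}) \<longlonglongrightarrow> P.prob {w\<in>space P. \<forall>t\<in>F. X t w \<le> x t}"
    proof (rule P.prob_le_tendsto)
      show "isCont (\<lambda>y. P.prob {w\<in>space P. \<forall>t\<in>F. X t w \<le> y * x t}) 1"
        using F by (intro frechet_process_joint_cdf_continuous[OF X \<alpha>]) auto
    qed (use F uF T0 X_meas in \<open>auto simp: tendsto_in_prob_def subset_iff\<close>)
    moreover have "P.prob {w\<in>space P. \<forall>t\<in>F. X (u t n) w \<le> x t} = exp (- K n)" for n
      unfolding K_def using F uF by (intro represents_cdfs_family[OF q \<alpha>]) auto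
    ultimately have lim1: "(\<lambda>n. exp (- K n)) \<longlonglongrightarrow> P.prob {w\<in>space P. \<forall>t\<in>F. X t w \<le> x t}" by simp
    have int_MAX: "integrable \<mu> (\<lambda>s. MAX t\<in>F. g t s)" if g: "\<And>t. t \<in> F \<Longrightarrow> integrable \<mu> (g t)" for g :: "'t \<Rightarrow> 's \<Rightarrow> real"
      using F(1,2) g
    proof (induction F rule: finite_ne_induct)
      case (insert a F)
      then have "integrable \<mu> (\<lambda>s. max (g a s) (MAX t\<in>F. g t s))" by (intro integrable_max) auto
      then show ?case using insert by simp
    qed simp
    have "(\<lambda>n. K n - K0) \<longlonglongrightarrow> 0"
    proof (rule Lim_null_comparison)
      show "\<forall>\<^sub>F n in sequentially. norm (K n - K0) \<le> (\<Sum>t\<in>F. (\<integral>s. \<bar>q (u t n) s - h t s\<bar> \<partial>\<mu>) / x t powr \<alpha>)"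
      proof (intro always_eventually allI)
        fix n
        have i1: "integrable \<mu> (\<lambda>s. MAX t\<in>F. q (u t n) s / x t powr \<alpha>)" "integrable \<mu> (\<lambda>s. MAX t\<in>F. h t s / x t powr \<alpha>)"
          using uF q_int by (auto intro!: int_MAX)
        have "norm (K n - K0) = \<bar>\<integral>s. (MAX t\<in>F. q (u t n) s / x t powr \<alpha>) - (MAX t\<in>F. h t s / x t powr \<alpha>) \<partial>\<mu>\<bar>"
          unfolding K_def K0_def using i1 by simp
        also have "\<dots> \<le> (\<integral>s. \<bar>(MAX t\<in>F. q (u t n) s / x t powr \<alpha>) - (MAX t\<in>F. h t s / x t powr \<alpha>)\<bar> \<partial>\<mu>)"
          by (rule integral_abs_bound)
        also have "\<dots> \<le> (\<integral>s. (\<Sum>t\<in>F. \<bar>q (u t n) s - h t s\<bar> / x t powr \<alpha>) \<partial>\<mu>)"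
        proof (rule integral_mono)
          fix s
          have "\<bar>(MAX t\<in>F. q (u t n) s / x t powr \<alpha>) - (MAX t\<in>F. h t s / x t powr \<alpha>)\<bar>
              \<le> (\<Sum>t\<in>F. \<bar>q (u t n) s / x t powr \<alpha> - h t s / x t powr \<alpha>\<bar>)"
            by (rule abs_MAX_diff_le_sum[OF F(1,2)])
          also have "\<dots> = (\<Sum>t\<in>F. \<bar>q (u t n) s - h t s\<bar> / x t powr \<alpha>)"
            by (intro sum.cong) (auto simp: diff_divide_distrib[symmetric] abs_divide)
          finally show "\<bar>(MAX t\<in>F. q (u t n) s / x t powr \<alpha>) - (MAX t\<in>F. h t s / x t powr \<alpha>)\<bar> \<le> (\<Sum>t\<in>F. \<bar>q (u t n) s - h t s\<bar> / x t powr \<alpha>)" .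
        qed (use i1 uF q_int in auto)
        also have "\<dots> = (\<Sum>t\<in>F. (\<integral>s. \<bar>q (u t n) s - h t s\<bar> \<partial>\<mu>) / x t powr \<alpha>)"
          using uF q_int by (subst Bochner_Integration.integral_sum) auto
        finally show "norm (K n - K0) \<le> (\<Sum>t\<in>F. (\<integral>s. \<bar>q (u t n) s - h t s\<bar> \<partial>\<mu>) / x t powr \<alpha>)" .
      qed
      have "(\<lambda>n. \<Sum>t\<in>F. (\<integral>s. \<bar>q (u t n) s - h t s\<bar> \<partial>\<mu>) / x t powr \<alpha>) \<longlonglongrightarrow> (\<Sum>t\<in>F. 0 / x t powr \<alpha>)"
        by (intro tendsto_sum tendsto_divide uF tendsto_const) (auto dest!: F(4))
      then show "(\<lambda>n. \<Sum>t\<in>F. (\<integral>s. \<bar>q (u t n) s - h t s\<bar> \<partial>\<mu>) / x t powr \<alpha>) \<longlonglongrightarrow> 0" by simp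
    qed
    then have "K \<longlonglongrightarrow> K0" by (simp add: LIM_zero_iff)
    then have "(\<lambda>n. exp (- K n)) \<longlonglongrightarrow> exp (- K0)" by (intro tendsto_intros)
    from LIMSEQ_unique[OF lim1 this]
    show "P.prob {w\<in>space P. \<forall>t\<in>F. X t w \<le> x t} = exp (- (\<integral>s. (MAX t\<in>F. h t s / x t powr \<alpha>) \<partial>\<mu>))"
      by (simp add: K0_def)
  qed (use uh in auto)
  then show thesis using uh T0 by (intro that[of h]) auto
qed

section \<open>Minimal spectral functions on a countable index set\<close>

text \<open>No \<open>u k\<close> exceeds 1, so no ratio is below \<open>u n\<close>; and ratios to coordinates \<open>u k\<close> close to 1 are close to \<open>u n\<close>. This
recovers the normalized coordinates from their ratios.\<close>

lemma INF_ratios_of_unit_supremum: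
  fixes u :: "nat \<Rightarrow> real"
  assumes u: "\<And>k. 0 \<le> u k" and sup: "(SUP k. u k) = 1" and bdd: "bdd_above (range u)"
    and D: "\<And>k. k \<notin> D \<Longrightarrow> u k = 0" and n: "n \<in> D"
  shows "(INF k\<in>D. ennreal (u n) / ennreal (u k)) = ennreal (u n)"
proof (rule antisym)
  have u1: "u k \<le> 1" for k unfolding sup[symmetric] using bdd by (intro cSUP_upper) auto
  define \<rho> where "\<rho> = (INF k\<in>D. ennreal (u n) / ennreal (u k))"
  show "ennreal (u n) \<le> (INF k\<in>D. ennreal (u n) / ennreal (u k))"
  proof (rule INF_greatest)
    fix k
    show "ennreal (u n) \<le> ennreal (u n) / ennreal (u k)"
    proof (cases "u k = 0")
      case True
      then show ?thesis by (cases "u n = 0") (auto simp: divide_ennreal_def ennreal_mult_top u)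
    next
      case False
      then have "0 < u k" using u[of k] by simp
      moreover have "u n \<le> u n / u k"
        using \<open>0 < u k\<close> u1[of k] u[of n] by (simp add: pos_le_divide_eq mult_left_le)
      ultimately show ?thesis using u[of n] by (simp add: divide_ennreal ennreal_leI)
    qed
  qed
  show "(INF k\<in>D. ennreal (u n) / ennreal (u k)) \<le> ennreal (u n)"
  proof (cases "u n = 0")
    case True
    then show ?thesis using n by (intro INF_lower2[of n]) auto
  next
    case False
    then have un: "0 < u n" using u[of n] by simp
    have "\<rho> \<le> ennreal (u n) / ennreal (u n)" unfolding \<rho>_def using n by (intro INF_lower)
    also have "\<dots> = 1" using un by (intro ennreal_divide_self) auto
    finally obtain r where r: "\<rho> = ennreal r" "0 \<le> r" by (cases \<rho>) (auto simp: top_unique)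
    have "r \<le> u n"
    proof (rule field_le_mult_one_interval)
      fix z :: real assume z: "0 < z" "z < 1"
      then obtain k where k: "z < u k" using sup bdd less_cSUP_iff[of UNIV u z] by auto
      then have "k \<in> D" using D[of k] z by auto
      then have "\<rho> \<le> ennreal (u n) / ennreal (u k)" unfolding \<rho>_def by (intro INF_lower)
      also have "\<dots> = ennreal (u n / u k)" using un z k by (intro divide_ennreal) auto
      finally have "r \<le> u n / u k" using r un z k by (simp add: ennreal_le_iff)
      then have "r * u k \<le> u n" using z k by (simp add: field_simps)
      moreover have "z * r \<le> r * u k" using k r(2) by (simp add: mult.commute mult_left_mono)
      ultimately show "z * r \<le> u n" by simp
    qed
    then show ?thesis using r by (simp add: \<rho>_def ennreal_leI)
  qed
qed

text \<open>Combines \<open>spectral_measure_exists\<close> and \<open>normalized_spectral_measure\<close> for the \<open>\<alpha>\<close>-th powers of a Frechet family indexed by \<open>D\<close>.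
Coordinates outside \<open>D\<close> belong to variables that are identically 0; in this way finite and infinite
index sets are treated alike.\<close>

lemma sequence_spectral_measure:
  fixes Y :: "nat \<Rightarrow> 'w \<Rightarrow> real"
  assumes "prob_space P" and \<alpha>: "0 < \<alpha>" and Y: "\<And>n. n \<in> D \<Longrightarrow> Y n \<in> borel_measurable P"
    and cdf: "\<And>F x. \<lbrakk>finite F; F \<noteq> {}; F \<subseteq> D; \<forall>n\<in>F. 0 < x n\<rbrakk> \<Longrightarrow>
      \<exists>c>0. \<forall>y>0. measure P {w\<in>space P. \<forall>n\<in>F. Y n w \<le> y * x n} = exp (- c * y powr (- \<alpha>))"
  obtains m and c :: "nat \<Rightarrow> real" where "finite_measure m" "sets m = sets borel" "\<And>n. 0 < c n"
    "AE y in m. encode (\<lambda>n. coord n y) = y" "AE y in m. (SUP n. coord n y) = 1"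
    "\<And>n. n \<notin> D \<Longrightarrow> AE y in m. coord n y = 0"
    "\<And>F x. \<lbrakk>finite F; F \<noteq> {}; F \<subseteq> D; \<forall>n\<in>F. 0 < x n\<rbrakk> \<Longrightarrow>
      measure P {w\<in>space P. \<forall>n\<in>F. Y n w \<le> x n} = exp (- (\<integral>y. (MAX n\<in>F. coord n y / (c n * x n powr \<alpha>)) \<partial>m))"
proof -
  interpret P: prob_space P by fact
  define Z where "Z n w = (if n \<in> D then max 0 (Y n w) powr \<alpha> else 0)" for n w
  \<comment> \<open>If \<open>F\<close> does not meet \<open>D\<close> then the event is the whole space and \<open>v F b\<close> is 0.\<close>
  define v where "v F b = - ln (P.prob {w\<in>space P. \<forall>n\<in>F \<inter> D. Y n w \<le> b n powr (- 1 / \<alpha>)})" for F b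
  have v: "P.prob {w\<in>space P. \<forall>n\<in>F \<inter> D. Y n w \<le> y powr (1 / \<alpha>) * b n powr (- 1 / \<alpha>)} = exp (- v F b / y) \<and> 0 \<le> v F b"
    if F: "finite F" "\<forall>n\<in>F. 0 < b n" "0 < y" for F b y
  proof (cases "F \<inter> D = {}")
    case True
    then show ?thesis by (simp add: v_def P.prob_space)
  next
    case False
    have "\<forall>n\<in>F \<inter> D. 0 < b n powr (- 1 / \<alpha>)" using F(2) by fastforce
    then obtain c where c: "0 < c" "\<And>y. 0 < y \<Longrightarrow> P.prob {w\<in>space P. \<forall>n\<in>F \<inter> D. Y n w \<le> y * b n powr (- 1 / \<alpha>)} = exp (- c * y powr (- \<alpha>))"
      using cdf[of "F \<inter> D" "\<lambda>n. b n powr (- 1 / \<alpha>)"] F False by blast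
    have "v F b = c" using c(2)[of 1] by (simp add: v_def)
    moreover have "(y powr (1 / \<alpha>)) powr (- \<alpha>) = 1 / y" using F \<alpha> by (simp add: powr_powr powr_minus_divide)
    ultimately show ?thesis using c(1) c(2)[of "y powr (1 / \<alpha>)"] F by simp
  qed
  have Z_meas: "Z n \<in> borel_measurable P" for n
    unfolding Z_def[abs_def] using Y[of n] by (cases "n \<in> D") simp_all
  have Z_le: "b * Z n w \<le> y \<longleftrightarrow> Y n w \<le> y powr (1 / \<alpha>) * b powr (- 1 / \<alpha>)" if "n \<in> D" "0 < b" "0 < y" for b y n w
  proof -
    have "b * Z n w \<le> y \<longleftrightarrow> max 0 (Y n w) powr \<alpha> \<le> y / b" using that by (simp add: Z_def field_simps)
    also have "\<dots> \<longleftrightarrow> max 0 (Y n w) \<le> (y / b) powr (1 / \<alpha>)"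
    proof
      assume "max 0 (Y n w) powr \<alpha> \<le> y / b"
      then have "(max 0 (Y n w) powr \<alpha>) powr (1 / \<alpha>) \<le> (y / b) powr (1 / \<alpha>)"
        using \<alpha> by (intro powr_mono2) auto
      then show "max 0 (Y n w) \<le> (y / b) powr (1 / \<alpha>)" using \<alpha> by (simp add: powr_powr)
    next
      assume "max 0 (Y n w) \<le> (y / b) powr (1 / \<alpha>)"
      then have "max 0 (Y n w) powr \<alpha> \<le> ((y / b) powr (1 / \<alpha>)) powr \<alpha>"
        using \<alpha> by (intro powr_mono2) auto
      then show "max 0 (Y n w) powr \<alpha> \<le> y / b" using \<alpha> that by (simp add: powr_powr)
    qed
    also have "(y / b) powr (1 / \<alpha>) = y powr (1 / \<alpha>) * b powr (- 1 / \<alpha>)"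
      using that by (simp add: powr_divide powr_minus_divide)
    finally show ?thesis by simp
  qed
  have Z_cdf: "P.prob {w\<in>space P. (MAX n\<in>F. b n * Z n w) \<le> y} = exp (- v F b / y)"
    if F: "finite F" "F \<noteq> {}" "\<forall>n\<in>F. 0 < b n" "0 < y" for F b y
  proof -
    have "(MAX n\<in>F. b n * Z n w) \<le> y \<longleftrightarrow> (\<forall>n\<in>F \<inter> D. Y n w \<le> y powr (1 / \<alpha>) * b n powr (- 1 / \<alpha>))" for w
    proof -
      have "(MAX n\<in>F. b n * Z n w) \<le> y \<longleftrightarrow> (\<forall>n\<in>F. b n * Z n w \<le> y)" using F by auto
      also have "\<dots> \<longleftrightarrow> (\<forall>n\<in>F \<inter> D. b n * Z n w \<le> y)" using F(4) by (auto simp: Z_def)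
      finally show ?thesis using F Z_le by auto
    qed
    then show ?thesis using v[OF F(1,3,4)] by simp
  qed
  obtain c m0 where c: "\<And>n. 0 < c n" and m0: "finite_measure m0" "sets m0 = sets borel"
    and m0_v: "\<And>F b. \<lbrakk>finite F; F \<noteq> {}; \<forall>n\<in>F. 0 < b n\<rbrakk> \<Longrightarrow> (\<integral>y. (MAX n\<in>F. b n * coord n y) \<partial>m0) = v F (\<lambda>n. b n * c n)"
  proof (rule spectral_measure_exists[where Z = Z and v = v])
    show "0 \<le> Z n w" for n w by (simp add: Z_def)
    show "0 \<le> v F b" if "finite F" "F \<noteq> {}" "\<forall>n\<in>F. 0 < b n" for F b using v[of F b 1] that by auto
    show "P.prob {w\<in>space P. (MAX n\<in>F. b n * Z n w) \<le> y} = exp (- v F b / y)"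
      if "finite F" "F \<noteq> {}" "\<forall>n\<in>F. 0 < b n" "0 < y" for F b y using that by (rule Z_cdf)
    fix c m0
    assume "\<And>n. 0 < c n" "finite_measure m0" "sets m0 = sets borel"
      "\<And>F b. \<lbrakk>finite F; F \<noteq> {}; \<forall>n\<in>F. 0 < b n\<rbrakk> \<Longrightarrow> (\<integral>y. (MAX n\<in>F. b n * coord n y) \<partial>m0) = v F (\<lambda>n. b n * c n)"
    then show thesis by (rule that)
  qed (intro \<open>prob_space P\<close> Z_meas)+
  obtain m where m: "finite_measure m" "sets m = sets borel"
    "AE y in m. encode (\<lambda>n. coord n y) = y" "AE y in m. (SUP n. coord n y) = 1"
    and m_v: "\<And>F b. \<lbrakk>finite F; F \<noteq> {}; \<forall>n\<in>F. 0 < b n\<rbrakk> \<Longrightarrow> (\<integral>y. (MAX n\<in>F. b n * coord n y) \<partial>m) = (\<integral>y. (MAX n\<in>F. b n * coord n y) \<partial>m0)"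
    using that by (rule normalized_spectral_measure[OF m0])
  interpret m: finite_measure m by (rule m)
  show thesis
  proof (rule that[of m c])
    fix n assume "n \<notin> D"
    then have "v {n} (\<lambda>n. 1 * c n) = 0" by (simp add: v_def P.prob_space)
    then have zero: "(\<integral>y. coord n y \<partial>m) = 0"
      using m_v[of "{n}" "\<lambda>_. 1"] m0_v[of "{n}" "\<lambda>_. 1"] by simp
    have [measurable]: "coord n \<in> borel_measurable m"
      by (simp add: measurable_cong_sets[OF m(2) refl])
    have "integrable m (coord n)"
      by (rule m.integrable_const_bound[of _ 1]) (use coord_bounds in auto)
    then show "AE y in m. coord n y = 0"
      using zero coord_bounds(1) by (subst (asm) integral_nonneg_eq_0_iff_AE) auto
  next
    fix F :: "nat set" and x :: "nat \<Rightarrow> real"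
    assume F: "finite F" "F \<noteq> {}" "F \<subseteq> D" "\<forall>n\<in>F. 0 < x n"
    define b where "b n = 1 / (c n * x n powr \<alpha>)" for n
    have b: "\<forall>n\<in>F. 0 < b n" using F c by (auto simp: b_def)
    have "(b n * c n) powr (- 1 / \<alpha>) = x n" if "n \<in> F" for n
    proof -
      have "b n * c n = x n powr (- \<alpha>)" using c[of n] by (simp add: b_def powr_minus_divide)
      moreover have "0 < x n" using F that by auto
      ultimately show ?thesis using \<alpha> by (simp add: powr_powr)
    qed
    then have "(\<forall>n\<in>F \<inter> D. Y n w \<le> 1 powr (1 / \<alpha>) * (b n * c n) powr (- 1 / \<alpha>)) \<longleftrightarrow> (\<forall>n\<in>F. Y n w \<le> x n)" for w
      using F by auto
    then have "P.prob {w\<in>space P. \<forall>n\<in>F. Y n w \<le> x n} = exp (- v F (\<lambda>n. b n * c n))"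
      using v[of F "\<lambda>n. b n * c n" 1] F b c by auto
    also have "v F (\<lambda>n. b n * c n) = (\<integral>y. (MAX n\<in>F. b n * coord n y) \<partial>m)"
      using m_v m0_v F b by simp
    finally show "P.prob {w\<in>space P. \<forall>n\<in>F. Y n w \<le> x n} = exp (- (\<integral>y. (MAX n\<in>F. coord n y / (c n * x n powr \<alpha>)) \<partial>m))"
      by (simp add: b_def)
  qed (use m c in auto)
qed

text \<open>With \<open>G\<close> and \<open>w\<close> from \<open>std_measure_standardizes\<close>, the function \<open>q t\<close> is \<open>w\<close> times the coordinate of \<open>G\<close> that belongs to \<open>t\<close>, up to
a constant. The function \<open>w\<close> is almost everywhere the supremum of the scaled \<open>q t\<close>, which will show that the support is full. For the
\<open>\<sigma>\<close>-algebra, the weight \<open>w\<close> cancels from the ratios, so these determine the coordinates of \<open>G\<close> and with them \<open>G\<close>, and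
\<open>G\<close> generates all measurable sets modulo null sets.\<close>

lemma standardized_spectral_functions:
  fixes X :: "'t \<Rightarrow> 'w \<Rightarrow> real"
  assumes X: "frechet_process P \<alpha> T X" and \<alpha>: "0 < \<alpha>" and T0: "T0 \<subseteq> T" "countable T0"
  obtains I N and q :: "'t \<Rightarrow> real \<Rightarrow> real" and w where "I \<in> {0, 1::nat}"
    "represents_cdfs \<alpha> (std_measure I N) T0 q P X"
    "integrable (std_measure I N) w" "\<And>s. 0 < w s"
    "\<And>\<epsilon>. 0 < \<epsilon> \<Longrightarrow> \<exists>h\<in>max_linear T0 (\<lambda>t s. q t s powr (1 / \<alpha>)). (\<integral>s. \<bar>h s powr \<alpha> - w s\<bar> \<partial>std_measure I N) < \<epsilon>"
    "\<And>B. B \<in> sets (std_measure I N) \<Longrightarrow>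
      \<exists>A\<in>ratio_sigma (std_measure I N) T0 (\<lambda>t s. q t s powr (1 / \<alpha>)). emeasure (std_measure I N) ((A - B) \<union> (B - A)) = 0"
proof -
  have "prob_space P" using X by (simp add: frechet_process_def)
  define \<kappa> where "\<kappa> = to_nat_on T0"
  define D where "D = \<kappa> ` T0"
  define \<tau> where "\<tau> = inv_into T0 \<kappa>"
  have inj: "inj_on \<kappa> T0" unfolding \<kappa>_def using T0(2) by (rule inj_on_to_nat_on)
  have \<tau>\<kappa>: "\<tau> (\<kappa> t) = t" if "t \<in> T0" for t unfolding \<tau>_def using inj that by (rule inv_into_f_f)
  have \<tau>_mem: "\<tau> n \<in> T0" if "n \<in> D" for n using that \<tau>\<kappa> by (auto simp: D_def)
  have \<kappa>\<tau>: "\<kappa> (\<tau> n) = n" if "n \<in> D" for n using that \<tau>\<kappa> by (auto simp: D_def)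
  obtain m c where m: "finite_measure m" "sets m = sets borel" and c: "\<And>n. 0 < c n"
    and m_enc: "AE y in m. encode (\<lambda>n. coord n y) = y" and m_sup: "AE y in m. (SUP n. coord n y) = 1"
    and m_off: "\<And>n. n \<notin> D \<Longrightarrow> AE y in m. coord n y = 0"
    and m_cdf: "\<And>F x. \<lbrakk>finite F; F \<noteq> {}; F \<subseteq> D; \<forall>n\<in>F. 0 < x n\<rbrakk> \<Longrightarrow>
      measure P {w\<in>space P. \<forall>n\<in>F. X (\<tau> n) w \<le> x n} = exp (- (\<integral>y. (MAX n\<in>F. coord n y / (c n * x n powr \<alpha>)) \<partial>m))"
  proof (rule sequence_spectral_measure[OF \<open>prob_space P\<close> \<alpha>, of D "\<lambda>n. X (\<tau> n)"])
    show "X (\<tau> n) \<in> borel_measurable P" if "n \<in> D" for n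
      using frechet_process_measurable[OF X] \<tau>_mem[OF that] T0 by auto
    fix F :: "nat set" and x :: "nat \<Rightarrow> real"
    assume F: "finite F" "F \<noteq> {}" "F \<subseteq> D" "\<forall>n\<in>F. 0 < x n"
    have im: "\<tau> ` F \<subseteq> T" using F \<tau>_mem T0 by auto
    have pos: "0 < x (\<kappa> t)" if "t \<in> \<tau> ` F" for t using that F \<kappa>\<tau> by auto
    obtain e where e: "0 < e" "\<And>y. 0 < y \<Longrightarrow> measure P {w\<in>space P. \<forall>t\<in>\<tau> ` F. X t w \<le> y * x (\<kappa> t)} = exp (- e * y powr (- \<alpha>))"
      using frechet_process_joint_cdf[where x = "\<lambda>t. x (\<kappa> t)" and F = "\<tau> ` F", OF X \<alpha> _ _ im pos] F by auto
    have "(\<forall>t\<in>\<tau> ` F. X t w \<le> y * x (\<kappa> t)) \<longleftrightarrow> (\<forall>n\<in>F. X (\<tau> n) w \<le> y * x n)" for w y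
      using F \<kappa>\<tau> by (auto simp: subset_iff)
    then show "\<exists>c>0. \<forall>y>0. measure P {w\<in>space P. \<forall>n\<in>F. X (\<tau> n) w \<le> y * x n} = exp (- c * y powr (- \<alpha>))"
      using e by auto
  next
    fix m and c :: "nat \<Rightarrow> real"
    assume "finite_measure m" "sets m = sets borel" "\<And>n. 0 < c n"
      "AE y in m. encode (\<lambda>n. coord n y) = y" "AE y in m. (SUP n. coord n y) = 1"
      "\<And>n. n \<notin> D \<Longrightarrow> AE y in m. coord n y = 0"
      "\<And>F x. \<lbrakk>finite F; F \<noteq> {}; F \<subseteq> D; \<forall>n\<in>F. 0 < x n\<rbrakk> \<Longrightarrow>
        measure P {w\<in>space P. \<forall>n\<in>F. X (\<tau> n) w \<le> x n} = exp (- (\<integral>y. (MAX n\<in>F. coord n y / (c n * x n powr \<alpha>)) \<partial>m))"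
    then show thesis by (rule that)
  qed
  interpret m: finite_measure m by (rule m)
  obtain I N G w where I: "I \<in> {0, 1::nat}" and G [measurable]: "G \<in> borel_measurable (std_measure I N)"
    and w [measurable]: "w \<in> borel_measurable (std_measure I N)" and w_pos: "\<And>s. 0 < (w s :: real)"
    and m_eq: "distr (density (std_measure I N) (\<lambda>s. ennreal (w s))) borel G = m"
    and pull: "\<And>B. B \<in> sets (std_measure I N) \<Longrightarrow> \<exists>C\<in>sets borel. AE s in std_measure I N. s \<in> B \<longleftrightarrow> G s \<in> C"
    using that by (rule std_measure_standardizes[OF m])
  define \<mu> where "\<mu> = std_measure I N"
  note [measurable] = G[folded \<mu>_def] w[folded \<mu>_def]
  define u where "u n s = coord n (G s)" for n s
  have u_meas [measurable]: "u n \<in> borel_measurable \<mu>" for n unfolding u_def[abs_def] by measurable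
  have u01: "0 \<le> u n s" "u n s \<le> 1" for n s using coord_bounds by (auto simp: u_def)
  define q where "q t s = w s * u (\<kappa> t) s / c (\<kappa> t)" for t s
  define f where "f t s = q t s powr (1 / \<alpha>)" for t s
  have q_nonneg: "0 \<le> q t s" for t s
    using w_pos[of s] u01(1)[of "\<kappa> t" s] c[of "\<kappa> t"] by (auto simp: q_def intro!: divide_nonneg_pos mult_nonneg_nonneg)
  have q_meas [measurable]: "q t \<in> borel_measurable \<mu>" for t unfolding q_def[abs_def] by measurable
  have f_meas [measurable]: "f t \<in> borel_measurable \<mu>" for t unfolding f_def[abs_def] by measurable

  have AE_transfer: "AE s in \<mu>. R (G s)" if R: "AE y in m. R y" and "{y. R y} \<in> sets borel" for R
  proof -
    have "AE s in density \<mu> (\<lambda>s. ennreal (w s)). R (G s)"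
      using R that(2) unfolding m_eq[folded \<mu>_def, symmetric] by (subst (asm) AE_distr_iff) auto
    then show ?thesis using w_pos by (subst (asm) AE_density) auto
  qed
  have integral_transfer: "(\<integral>y. g y \<partial>m) = (\<integral>s. w s * g (G s) \<partial>\<mu>)" if [measurable]: "g \<in> borel_measurable borel" for g :: "real \<Rightarrow> real"
  proof -
    have "(\<integral>y. g y \<partial>m) = (\<integral>s. g (G s) \<partial>density \<mu> (\<lambda>s. ennreal (w s)))"
      unfolding m_eq[folded \<mu>_def, symmetric] by (rule integral_distr) auto
    also have "\<dots> = (\<integral>s. w s * g (G s) \<partial>\<mu>)"
      using w_pos by (subst integral_density) (auto simp: less_imp_le)
    finally show ?thesis .
  qed
  have w_int: "integrable \<mu> w"
  proof (rule integrableI_nonneg)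
    have "(\<integral>\<^sup>+s. ennreal (w s) \<partial>\<mu>) = emeasure (density \<mu> (\<lambda>s. ennreal (w s))) (G -` UNIV \<inter> space \<mu>)"
      by (subst emeasure_density) (auto intro!: nn_integral_cong)
    also have "\<dots> = emeasure m UNIV"
      unfolding m_eq[folded \<mu>_def, symmetric] by (subst emeasure_distr) auto
    finally show "(\<integral>\<^sup>+s. ennreal (w s) \<partial>\<mu>) < \<infinity>" by (simp add: m.emeasure_eq_measure)
  qed (use w_pos in \<open>auto simp: less_imp_le\<close>)
  have ae_off: "AE s in \<mu>. \<forall>n. n \<notin> D \<longrightarrow> u n s = 0"
  proof -
    have "AE s in \<mu>. n \<notin> D \<longrightarrow> u n s = 0" for n
    proof (cases "n \<in> D")
      case False
      have "{y \<in> space borel. coord n y = 0} \<in> sets borel" by measurable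
      then show ?thesis using AE_transfer[OF m_off[OF False]] by (simp add: u_def)
    qed simp
    then show ?thesis by (simp add: AE_all_countable)
  qed
  have ae_sup: "AE s in \<mu>. (SUP n. u n s) = 1"
  proof -
    have "(\<lambda>y. SUP n. coord n y) \<in> borel_measurable borel"
      by (intro borel_measurable_cSUP) (auto intro!: bdd_aboveI[of _ 1] coord_bounds)
    then have "{y \<in> space borel. (SUP n. coord n y) = 1} \<in> sets borel" by measurable
    then show ?thesis using AE_transfer[OF m_sup] by (simp add: u_def)
  qed
  have ae_enc: "AE s in \<mu>. encode (\<lambda>n. u n s) = G s"
  proof -
    have "{y \<in> space borel. encode (\<lambda>n. coord n y) = y} \<in> sets borel" by measurable
    then show ?thesis using AE_transfer[OF m_enc] by (simp add: u_def)
  qed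
  have u_bdd: "bdd_above (range (\<lambda>n. u n s))" for s using u01 by (auto intro!: bdd_aboveI[of _ 1])

  have cdfs: "represents_cdfs \<alpha> \<mu> T0 q P X"
    unfolding represents_cdfs_def
  proof (intro conjI ballI allI impI q_nonneg)
    fix t
    show "integrable \<mu> (q t)"
    proof (rule Bochner_Integration.integrable_bound)
      show "integrable \<mu> (\<lambda>s. w s / c (\<kappa> t))" using w_int by simp
      show "AE s in \<mu>. norm (q t s) \<le> norm (w s / c (\<kappa> t))"
        using u01 w_pos c[of "\<kappa> t"]
        by (intro AE_I2) (auto simp: q_def abs_mult abs_of_nonneg less_imp_le intro!: divide_right_mono mult_left_le)
    qed measurable
  next
    fix F :: "'t set" and x :: "'t \<Rightarrow> real"
    assume "finite F \<and> F \<noteq> {} \<and> F \<subseteq> T0 \<and> (\<forall>t\<in>F. 0 < x t)"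
    then have F: "finite F" "F \<noteq> {}" "F \<subseteq> T0" "\<forall>t\<in>F. 0 < x t" by auto
    define J where "J = \<kappa> ` F"
    have J: "finite J" "J \<noteq> {}" "J \<subseteq> D" using F by (auto simp: J_def D_def)
    have tau_kappa_F: "\<tau> (\<kappa> t) = t" if "t \<in> F" for t using that F \<tau>\<kappa> by auto
    have "(\<forall>t\<in>F. X t v \<le> x t) \<longleftrightarrow> (\<forall>n\<in>J. X (\<tau> n) v \<le> x (\<tau> n))" for v
      using tau_kappa_F by (auto simp: J_def)
    then have "measure P {v\<in>space P. \<forall>t\<in>F. X t v \<le> x t} = exp (- (\<integral>y. (MAX n\<in>J. coord n y / (c n * x (\<tau> n) powr \<alpha>)) \<partial>m))"
      using m_cdf[OF J, of "\<lambda>n. x (\<tau> n)"] F tau_kappa_F by (auto simp: J_def)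
    also have "(\<integral>y. (MAX n\<in>J. coord n y / (c n * x (\<tau> n) powr \<alpha>)) \<partial>m)
        = (\<integral>s. w s * (MAX n\<in>J. u n s / (c n * x (\<tau> n) powr \<alpha>)) \<partial>\<mu>)"
      unfolding u_def using J by (intro integral_transfer) measurable
    also have "\<dots> = (\<integral>s. (MAX t\<in>F. q t s / x t powr \<alpha>) \<partial>\<mu>)"
    proof (rule Bochner_Integration.integral_cong[OF refl])
      fix s
      have "w s * (MAX n\<in>J. u n s / (c n * x (\<tau> n) powr \<alpha>)) = (MAX n\<in>J. w s * (u n s / (c n * x (\<tau> n) powr \<alpha>)))"
        using J w_pos by (intro MAX_mult_left) (auto simp: less_imp_le)
      also have "(\<lambda>n. w s * (u n s / (c n * x (\<tau> n) powr \<alpha>))) ` J = (\<lambda>t. q t s / x t powr \<alpha>) ` F"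
        unfolding J_def image_image using tau_kappa_F by (intro image_cong refl) (simp add: q_def)
      finally show "w s * (MAX n\<in>J. u n s / (c n * x (\<tau> n) powr \<alpha>)) = (MAX t\<in>F. q t s / x t powr \<alpha>)" .
    qed
    finally show "measure P {v\<in>space P. \<forall>t\<in>F. X t v \<le> x t} = exp (- (\<integral>s. (MAX t\<in>F. q t s / x t powr \<alpha>) \<partial>\<mu>))" .
  qed

  have approx: "\<exists>h\<in>max_linear T0 f. (\<integral>s. \<bar>h s powr \<alpha> - w s\<bar> \<partial>\<mu>) < \<epsilon>" if \<epsilon>: "0 < \<epsilon>" for \<epsilon>
  proof -
    define FN where "FN K = \<tau> ` (D \<inter> {..K})" for K :: nat
    define U where "U K s = Max (insert 0 ((\<lambda>n. u n s) ` (D \<inter> {..K})))" for K s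
    define h where "h K s = Max (insert 0 ((\<lambda>t. c (\<kappa> t) powr (1 / \<alpha>) * f t s) ` FN K))" for K s
    have h_mem: "h K \<in> max_linear T0 f" for K
      unfolding max_linear_def h_def[abs_def] FN_def using \<tau>_mem c[THEN less_imp_neq]
      by (intro CollectI exI[of _ "\<lambda>t. c (\<kappa> t) powr (1 / \<alpha>)"] exI[of _ "\<tau> ` (D \<inter> {..K})"]) auto
    have U01: "0 \<le> U K s" "U K s \<le> 1" for K s using u01 by (auto simp: U_def)
    have h_powr: "h K s powr \<alpha> = w s * U K s" for K s
    proof -
      \<comment> \<open>The cut at 0 makes the power monotone on the whole line, so that it commutes with maxima.\<close>
      define g where "g x = max 0 x powr (1 / \<alpha>)" for x :: real
      have "mono g" unfolding g_def using \<alpha> by (intro monoI powr_mono2) auto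
      have img: "(\<lambda>t. c (\<kappa> t) powr (1 / \<alpha>) * f t s) ` FN K = (\<lambda>n. g (w s * u n s)) ` (D \<inter> {..K})"
        unfolding FN_def image_image
      proof (rule image_cong[OF refl])
        fix n assume "n \<in> D \<inter> {..K}"
        then have "\<kappa> (\<tau> n) = n" using \<kappa>\<tau> by auto
        moreover have "c n powr (1 / \<alpha>) * (w s * u n s / c n) powr (1 / \<alpha>) = (w s * u n s) powr (1 / \<alpha>)"
          using c[of n] w_pos[of s] u01[of n s] by (simp add: powr_divide less_imp_le)
        ultimately show "c (\<kappa> (\<tau> n)) powr (1 / \<alpha>) * f (\<tau> n) s = g (w s * u n s)"
          using w_pos[of s] u01[of n s] by (simp add: f_def q_def g_def less_imp_le max_def)
      qed
      have "w s * U K s = Max (insert 0 ((\<lambda>n. w s * u n s) ` (D \<inter> {..K})))"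
      proof -
        have "mono (\<lambda>x. w s * x)" using w_pos[of s] by (intro monoI mult_left_mono) auto
        then show ?thesis unfolding U_def by (subst mono_Max_commute) (auto simp: image_image)
      qed
      then have "g (w s * U K s) = Max (insert 0 ((\<lambda>n. g (w s * u n s)) ` (D \<inter> {..K})))"
        by (simp only:) (subst mono_Max_commute[OF \<open>mono g\<close>], auto simp: image_image g_def)
      then have "h K s = g (w s * U K s)" unfolding h_def img by simp
      also have "\<dots> powr \<alpha> = w s * U K s"
        using w_pos[of s] U01[of K s] \<alpha> by (simp add: g_def powr_powr less_imp_le max_def)
      finally show ?thesis .
    qed
    have U_meas [measurable]: "U K \<in> borel_measurable \<mu>" for K
    proof -
      have "U K = (\<lambda>s. MAX i\<in>insert None (Some ` (D \<inter> {..K})). case i of None \<Rightarrow> 0 | Some n \<Rightarrow> u n s)"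
        unfolding U_def[abs_def] by (simp add: image_image)
      also have "\<dots> \<in> borel_measurable \<mu>"
        by (intro borel_measurable_MAX) (auto split: option.split)
      finally show ?thesis .
    qed
    have "(\<lambda>K. \<integral>s. \<bar>w s * U K s - w s\<bar> \<partial>\<mu>) \<longlonglongrightarrow> (\<integral>s. 0 \<partial>\<mu>)"
    proof (rule integral_dominated_convergence[where w = w])
      show "AE s in \<mu>. (\<lambda>K. \<bar>w s * U K s - w s\<bar>) \<longlonglongrightarrow> 0"
        using ae_off ae_sup
      proof eventually_elim
        case (elim s)
        have "(\<lambda>K. U K s) \<longlonglongrightarrow> 1"
        proof (rule LIMSEQ_I)
          fix e :: real assume e: "0 < e"
          define z where "z = max 0 (1 - e)"
          have z: "0 \<le> z" "z < 1" "1 - e \<le> z" using e by (auto simp: z_def)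
          then obtain n where n: "z < u n s" using elim(2) less_cSUP_iff[OF UNIV_not_empty u_bdd[of s], of z] by auto
          then have "n \<in> D" using elim(1) z by auto
          have "norm (U K s - 1) < e" if "n \<le> K" for K
          proof -
            have "u n s \<le> U K s" unfolding U_def using that \<open>n \<in> D\<close> by (intro Max_ge) auto
            then show ?thesis using U01[of K s] n z by simp
          qed
          then show "\<exists>no. \<forall>K\<ge>no. norm (U K s - 1) < e" by blast
        qed
        then have "(\<lambda>K. \<bar>w s * U K s - w s\<bar>) \<longlonglongrightarrow> \<bar>w s * 1 - w s\<bar>" by (intro tendsto_intros)
        then show ?case by simp
      qed
      show "AE s in \<mu>. norm \<bar>w s * U K s - w s\<bar> \<le> w s" for K
      proof (rule AE_I2)
        fix s
        have "\<bar>w s * U K s - w s\<bar> = w s * (1 - U K s)"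
          using w_pos[of s] U01[of K s] mult_left_le[of "U K s" "w s"] by (simp add: algebra_simps)
        also have "\<dots> \<le> w s" using w_pos[of s] U01[of K s] by (intro mult_left_le) auto
        finally show "norm \<bar>w s * U K s - w s\<bar> \<le> w s" by simp
      qed
    qed (use w_int in auto)
    then have "\<forall>\<^sub>F K in sequentially. (\<integral>s. \<bar>w s * U K s - w s\<bar> \<partial>\<mu>) < \<epsilon>"
      using \<epsilon> by (intro order_tendstoD(2)) auto
    then obtain K where "(\<integral>s. \<bar>h K s powr \<alpha> - w s\<bar> \<partial>\<mu>) < \<epsilon>"
      unfolding h_powr by (auto simp: eventually_sequentially)
    then show ?thesis using h_mem by blast
  qed

  have gen: "\<exists>A\<in>ratio_sigma \<mu> T0 f. emeasure \<mu> ((A - B) \<union> (B - A)) = 0" if B: "B \<in> sets \<mu>" for B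
  proof -
    define gens where "gens = {(\<lambda>s. ennreal (f t s) / ennreal (f t' s)) -` B \<inter> space \<mu> | t t' B.
        t \<in> T0 \<and> t' \<in> T0 \<and> B \<in> sets (borel :: ennreal measure)}"
    define \<Sigma> where "\<Sigma> = sigma (space \<mu>) gens"
    have gens_sub: "gens \<subseteq> sets \<mu>" unfolding gens_def by (auto intro!: measurable_sets)
    then have "gens \<subseteq> Pow (space \<mu>)" using sets.space_closed by blast
    then have sets_\<Sigma>: "sets \<Sigma> = ratio_sigma \<mu> T0 f" and space_\<Sigma>: "space \<Sigma> = space \<mu>"
      unfolding \<Sigma>_def ratio_sigma_def gens_def[symmetric] by (auto simp: space_measure_of)
    have \<Sigma>_sub: "sets \<Sigma> \<subseteq> sets \<mu>"
      unfolding sets_\<Sigma> ratio_sigma_def gens_def[symmetric] by (rule sets.sigma_sets_subset[OF gens_sub])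
    \<comment> \<open>Extends the power \<open>\<alpha>\<close> to ratios; it turns a ratio of spectral functions into a ratio of their \<open>\<alpha>\<close>-th powers.\<close>
    define epow where "epow r = (if r = \<top> then \<top> else ennreal (enn2real r powr \<alpha>))" for r :: ennreal
    have epow_meas: "epow \<in> borel_measurable borel" unfolding epow_def[abs_def] by measurable
    define R where "R t t' s = ennreal (f t s) / ennreal (f t' s)" for t t' s
    have R_meas: "R t t' \<in> borel_measurable \<Sigma>" if "t \<in> T0" "t' \<in> T0" for t t'
    proof (rule measurableI)
      fix A :: "ennreal set" assume "A \<in> sets borel"
      then have "R t t' -` A \<inter> space \<mu> \<in> gens" unfolding gens_def R_def[abs_def] using that by blast
      then show "R t t' -` A \<inter> space \<Sigma> \<in> sets \<Sigma>"
        unfolding sets_\<Sigma> space_\<Sigma> ratio_sigma_def gens_def[symmetric] by (rule sigma_sets.Basic)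
    qed simp
    define \<rho> where "\<rho> n s = (if n \<in> D then enn2real (INF k\<in>D. epow (R (\<tau> n) (\<tau> k) s) * ennreal (c n / c k)) else 0)" for n s
    have \<rho>_meas: "\<rho> n \<in> borel_measurable \<Sigma>" for n
    proof (cases "n \<in> D")
      case True
      have "(\<lambda>s. INF k\<in>D. epow (R (\<tau> n) (\<tau> k) s) * ennreal (c n / c k)) \<in> borel_measurable \<Sigma>"
        using True \<tau>_mem by (intro borel_measurable_INF borel_measurable_times_ennreal borel_measurable_const
          measurable_compose[OF R_meas epow_meas]) auto
      then show ?thesis using True by (simp add: \<rho>_def[abs_def])
    qed (simp add: \<rho>_def[abs_def])
    have ae_G: "AE s in \<mu>. encode (\<lambda>n. \<rho> n s) = G s"
      using ae_off ae_sup ae_enc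
    proof eventually_elim
      case (elim s)
      have "\<rho> n s = u n s" for n
      proof (cases "n \<in> D")
        case True
        have "epow (R (\<tau> n) (\<tau> k) s) * ennreal (c n / c k) = ennreal (u n s) / ennreal (u k s)" if k: "k \<in> D" for k
        proof -
          have fn: "f (\<tau> i) s = (w s * u i s / c i) powr (1 / \<alpha>)" if "i \<in> D" for i
            using \<kappa>\<tau>[OF that] by (simp add: f_def q_def)
          show ?thesis
          proof (cases "u k s = 0")
            case u0: True
            then have "f (\<tau> k) s = 0" using fn[OF k] by simp
            moreover have "f (\<tau> n) s = 0 \<longleftrightarrow> u n s = 0" using fn[OF True] w_pos[of s] c[of n] by auto
            ultimately show ?thesis using u0 u01[of n s] c[of n] c[of k] fn[OF True]
              by (cases "u n s = 0") (auto simp: R_def epow_def divide_ennreal_def ennreal_mult_top ennreal_top_mult)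
          next
            case False
            then have uk: "0 < u k s" using u01[of k s] by simp
            then have fk: "0 < f (\<tau> k) s" using fn[OF k] w_pos[of s] c[of k] by simp
            have "R (\<tau> n) (\<tau> k) s = ennreal (f (\<tau> n) s / f (\<tau> k) s)"
              unfolding R_def using fk fn[OF True] by (intro divide_ennreal) auto
            also have "f (\<tau> n) s / f (\<tau> k) s = ((w s * u n s / c n) / (w s * u k s / c k)) powr (1 / \<alpha>)"
              unfolding fn[OF True] fn[OF k] by (rule powr_divide[symmetric])
            also have "(w s * u n s / c n) / (w s * u k s / c k) = u n s / u k s * (c k / c n)"
              using w_pos[of s] c[of n] c[of k] uk by (simp add: field_simps)
            finally have "epow (R (\<tau> n) (\<tau> k) s) = ennreal (u n s / u k s * (c k / c n))"
              using \<alpha> u01[of n s] uk c[of n] c[of k] by (simp add: epow_def powr_powr less_imp_le)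
            then have "epow (R (\<tau> n) (\<tau> k) s) * ennreal (c n / c k) = ennreal (u n s / u k s * (c k / c n) * (c n / c k))"
              using u01[of n s] uk c[of n] c[of k] by (subst ennreal_mult) (auto simp: less_imp_le)
            also have "u n s / u k s * (c k / c n) * (c n / c k) = u n s / u k s"
              using c[of n] c[of k] by simp
            finally show ?thesis using u01[of n s] uk by (simp add: divide_ennreal)
          qed
        qed
        then have "\<rho> n s = enn2real (INF k\<in>D. ennreal (u n s) / ennreal (u k s))"
          using True by (simp add: \<rho>_def)
        also have "(INF k\<in>D. ennreal (u n s) / ennreal (u k s)) = ennreal (u n s)"
          using u01 elim True by (intro INF_ratios_of_unit_supremum u_bdd) auto
        finally show ?thesis using u01 by simp
      next
        case False
        then show ?thesis using elim by (simp add: \<rho>_def)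
      qed
      then show ?case using elim by simp
    qed
    obtain C where C: "C \<in> sets borel" "AE s in \<mu>. s \<in> B \<longleftrightarrow> G s \<in> C"
      using pull[of B] B unfolding \<mu>_def by blast
    define A where "A = (\<lambda>s. encode (\<lambda>n. \<rho> n s)) -` C \<inter> space \<Sigma>"
    have "AE s in \<mu>. s \<in> A \<longleftrightarrow> s \<in> B"
      using ae_G C(2) AE_space[of \<mu>] by eventually_elim (simp add: A_def space_\<Sigma>)
    then have ae: "AE s in \<mu>. s \<notin> (A - B) \<union> (B - A)" by eventually_elim auto
    have A: "A \<in> sets \<Sigma>" unfolding A_def using \<rho>_meas C(1) by (intro measurable_sets[OF encode_measurable])
    then have "(A - B) \<union> (B - A) \<in> sets \<mu>" using B \<Sigma>_sub by auto
    with ae have "emeasure \<mu> ((A - B) \<union> (B - A)) = 0"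
      using AE_iff_null_sets by blast
    then show ?thesis using A sets_\<Sigma> by blast
  qed
  show thesis
    using that[of I N q w] I cdfs w_int w_pos approx gen unfolding \<mu>_def f_def by blast
qed

section \<open>The representation theorem\<close>

text \<open>Lower orthants suffice: a half space is a countable union of orthants because the index set is finite.\<close>

lemma sets_PiM_real_boxes:
  assumes F: "finite (F :: 't set)"
  shows "sets (\<Pi>\<^sub>M t\<in>F. (borel :: real measure)) =
    sigma_sets (\<Pi>\<^sub>E t\<in>F. UNIV) (range (\<lambda>x. \<Pi>\<^sub>E t\<in>F. {..x t}))"
proof (rule antisym)
  let ?\<Omega> = "\<Pi>\<^sub>E t\<in>F. (UNIV :: real set)" and ?E = "range (\<lambda>x. \<Pi>\<^sub>E t\<in>F. {..x t :: real})"
  have E_sub: "?E \<subseteq> Pow ?\<Omega>" by (auto simp: PiE_def)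
  show "sigma_sets ?\<Omega> ?E \<subseteq> sets (\<Pi>\<^sub>M t\<in>F. borel)"
  proof -
    have "?E \<subseteq> sets (\<Pi>\<^sub>M t\<in>F. borel)" using F by (auto intro!: sets_PiM_I_finite)
    from sets.sigma_sets_subset[OF this] show ?thesis by (simp add: space_PiM)
  qed
  define S where "S = sigma ?\<Omega> ?E"
  have S: "sets S = sigma_sets ?\<Omega> ?E" "space S = ?\<Omega>"
    unfolding S_def using E_sub by (simp_all add: space_measure_of)
  have coordinate: "(\<lambda>f. f i) \<in> borel_measurable S" if i: "i \<in> F" for i
  proof (rule borel_measurableI_le)
    fix a :: real
    have "{f \<in> space S. f i \<le> a} = (\<Union>n. \<Pi>\<^sub>E t\<in>F. {..(if t = i then a else real n)})"
    proof (rule antisym; rule subsetI)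
      fix f assume "f \<in> {f \<in> space S. f i \<le> a}"
      then have f: "f \<in> ?\<Omega>" "f i \<le> a" by (auto simp: S)
      obtain n where n: "(\<Sum>t\<in>F. \<bar>f t\<bar>) \<le> real n" using real_arch_simple by blast
      have "f t \<le> real n" if "t \<in> F" for t
      proof -
        have "\<bar>f t\<bar> \<le> (\<Sum>t\<in>F. \<bar>f t\<bar>)" using that F by (intro member_le_sum) auto
        then show ?thesis using n by simp
      qed
      then have "f \<in> (\<Pi>\<^sub>E t\<in>F. {..(if t = i then a else real n)})"
        using f by (auto simp: PiE_iff)
      then show "f \<in> (\<Union>n. \<Pi>\<^sub>E t\<in>F. {..(if t = i then a else real n)})" by blast
    next
      fix f assume "f \<in> (\<Union>n. \<Pi>\<^sub>E t\<in>F. {..(if t = i then a else real n)})"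
      then obtain n where "f \<in> (\<Pi>\<^sub>E t\<in>F. {..(if t = i then a else real n)})" by blast
      then show "f \<in> {f \<in> space S. f i \<le> a}" using i unfolding S by (force simp: PiE_iff)
    qed
    moreover have "(\<Pi>\<^sub>E t\<in>F. {..(if t = i then a else real n)}) \<in> sets S" for n
      unfolding S by (intro sigma_sets.Basic range_eqI[where x = "\<lambda>t. if t = i then a else real n"]) simp
    ultimately show "{f \<in> space S. f i \<le> a} \<in> sets S" by auto
  qed
  show "sets (\<Pi>\<^sub>M t\<in>F. borel) \<subseteq> sigma_sets ?\<Omega> ?E"
  proof -
    have "{{f \<in> \<Pi>\<^sub>E i\<in>F. space borel. f i \<in> A} |i A. i \<in> F \<and> A \<in> sets (borel :: real measure)} \<subseteq> sets S"
    proof clarify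
      fix i and A :: "real set" assume "i \<in> F" "A \<in> sets borel"
      from measurable_sets[OF coordinate[OF this(1)] this(2)]
      show "{f \<in> \<Pi>\<^sub>E i\<in>F. space borel. f i \<in> A} \<in> sets S"
        by (simp add: S(2) vimage_def Int_def conj_commute)
    qed
    from sets.sigma_sets_subset[OF this] show ?thesis
      by (simp add: sets_PiM_single S)
  qed
qed

lemma distr_eq_if_cdf_eq:
  fixes X :: "'t \<Rightarrow> 'w \<Rightarrow> real" and Y :: "'t \<Rightarrow> 'v \<Rightarrow> real"
  assumes F: "finite F" and P: "prob_space P" and Q: "prob_space Q"
    and X: "\<And>t. t \<in> F \<Longrightarrow> X t \<in> borel_measurable P" and Y: "\<And>t. t \<in> F \<Longrightarrow> Y t \<in> borel_measurable Q"
    and eq: "\<And>x. measure P {w\<in>space P. \<forall>t\<in>F. X t w \<le> x t} = measure Q {w\<in>space Q. \<forall>t\<in>F. Y t w \<le> x t}"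
  shows "distr P (\<Pi>\<^sub>M t\<in>F. borel) (\<lambda>w. \<lambda>t\<in>F. X t w) = distr Q (\<Pi>\<^sub>M t\<in>F. borel) (\<lambda>w. \<lambda>t\<in>F. Y t w)"
proof (rule measure_eqI_generator_eq[where \<Omega> = "\<Pi>\<^sub>E t\<in>F. UNIV" and E = "range (\<lambda>x. \<Pi>\<^sub>E t\<in>F. {..x t :: real})"
      and A = "\<lambda>n. \<Pi>\<^sub>E t\<in>F. {..real n}"])
  interpret P: prob_space P by fact
  interpret Q: prob_space Q by fact
  have mX: "(\<lambda>w. \<lambda>t\<in>F. X t w) \<in> measurable P (\<Pi>\<^sub>M t\<in>F. borel)" using X by (intro measurable_restrict) auto
  have mY: "(\<lambda>w. \<lambda>t\<in>F. Y t w) \<in> measurable Q (\<Pi>\<^sub>M t\<in>F. borel)" using Y by (intro measurable_restrict) auto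
  have box: "(\<Pi>\<^sub>E t\<in>F. {..x t}) \<in> sets (\<Pi>\<^sub>M t\<in>F. borel)" for x :: "'t \<Rightarrow> real"
    using F by (intro sets_PiM_I_finite) auto
  interpret DP: prob_space "distr P (\<Pi>\<^sub>M t\<in>F. borel) (\<lambda>w. \<lambda>t\<in>F. X t w)" by (rule P.prob_space_distr[OF mX])
  show "Int_stable (range (\<lambda>x. \<Pi>\<^sub>E t\<in>F. {..x t :: real}))"
  proof (rule Int_stableI)
    fix A B assume "A \<in> range (\<lambda>x. \<Pi>\<^sub>E t\<in>F. {..x t :: real})" "B \<in> range (\<lambda>x. \<Pi>\<^sub>E t\<in>F. {..x t :: real})"
    then obtain x y where "A = (\<Pi>\<^sub>E t\<in>F. {..x t :: real})" "B = (\<Pi>\<^sub>E t\<in>F. {..y t})" by blast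
    then have "A \<inter> B = (\<Pi>\<^sub>E t\<in>F. {..min (x t) (y t)})" by (auto simp: PiE_iff)
    then show "A \<inter> B \<in> range (\<lambda>x. \<Pi>\<^sub>E t\<in>F. {..x t :: real})"
      by (rule range_eqI[where x = "\<lambda>t. min (x t) (y t)"])
  qed
  fix A assume "A \<in> range (\<lambda>x. \<Pi>\<^sub>E t\<in>F. {..x t :: real})"
  then obtain x where A: "A = (\<Pi>\<^sub>E t\<in>F. {..x t :: real})" by blast
  have "(\<lambda>w. \<lambda>t\<in>F. X t w) -` A \<inter> space P = {w\<in>space P. \<forall>t\<in>F. X t w \<le> x t}"
    "(\<lambda>w. \<lambda>t\<in>F. Y t w) -` A \<inter> space Q = {w\<in>space Q. \<forall>t\<in>F. Y t w \<le> x t}"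
    by (auto simp: A PiE_iff)
  then show "emeasure (distr P (\<Pi>\<^sub>M t\<in>F. borel) (\<lambda>w. \<lambda>t\<in>F. X t w)) A = emeasure (distr Q (\<Pi>\<^sub>M t\<in>F. borel) (\<lambda>w. \<lambda>t\<in>F. Y t w)) A"
    using mX mY box[of x] eq[of x] by (simp add: emeasure_distr A P.emeasure_eq_measure Q.emeasure_eq_measure)
next
  show "(\<Union>n. \<Pi>\<^sub>E t\<in>F. {..real n}) = (\<Pi>\<^sub>E t\<in>F. (UNIV :: real set))"
  proof (rule antisym; rule subsetI)
    fix f :: "'t \<Rightarrow> real" assume f: "f \<in> (\<Pi>\<^sub>E t\<in>F. UNIV)"
    obtain n where n: "(\<Sum>t\<in>F. \<bar>f t\<bar>) \<le> real n" using real_arch_simple by blast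
    have "f t \<le> real n" if "t \<in> F" for t
    proof -
      have "\<bar>f t\<bar> \<le> (\<Sum>t\<in>F. \<bar>f t\<bar>)" using that F by (intro member_le_sum) auto
      then show ?thesis using n by simp
    qed
    then have "f \<in> (\<Pi>\<^sub>E t\<in>F. {..real n})" using f by (auto simp: PiE_iff)
    then show "f \<in> (\<Union>n. \<Pi>\<^sub>E t\<in>F. {..real n})" by blast
  qed (auto simp: PiE_iff)
  show "emeasure (distr P (\<Pi>\<^sub>M t\<in>F. borel) (\<lambda>w. \<lambda>t\<in>F. X t w)) (\<Pi>\<^sub>E t\<in>F. {..real n}) \<noteq> \<infinity>" for n
  proof -
    interpret P: prob_space P by fact
    have mX: "(\<lambda>w. \<lambda>t\<in>F. X t w) \<in> measurable P (\<Pi>\<^sub>M t\<in>F. borel)" using X by (intro measurable_restrict) auto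
    interpret DP: prob_space "distr P (\<Pi>\<^sub>M t\<in>F. borel) (\<lambda>w. \<lambda>t\<in>F. X t w)" by (rule P.prob_space_distr[OF mX])
    show ?thesis by simp
  qed
qed (auto simp: sets_PiM_real_boxes[OF F] PiE_iff)

text \<open>Frechet variables are almost surely positive, and so are variables with the same distribution function on the positive
axis; hence both distribution functions vanish as soon as one bound is not positive.\<close>

lemma same_fdd_if_positive_cdfs_eq:
  fixes X :: "'t \<Rightarrow> 'w \<Rightarrow> real"
  assumes X: "frechet_process P \<alpha> T X" and \<alpha>: "0 < \<alpha>" and Q: "prob_space Q"
    and Y: "\<And>t. t \<in> T \<Longrightarrow> Y t \<in> borel_measurable Q"
    and eq: "\<And>F x. \<lbrakk>finite F; F \<noteq> {}; F \<subseteq> T; \<And>t. t \<in> F \<Longrightarrow> 0 < x t\<rbrakk> \<Longrightarrow>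
      measure P {w\<in>space P. \<forall>t\<in>F. X t w \<le> x t} = measure Q {w\<in>space Q. \<forall>t\<in>F. Y t w \<le> x t}"
  shows "same_fdd T P X Q Y"
  unfolding same_fdd_def
proof (intro allI impI)
  interpret P: prob_space P using X by (simp add: frechet_process_def)
  interpret Q: prob_space Q by fact
  note X_meas = frechet_process_measurable[OF X]
  have X0: "P.prob {w\<in>space P. X t w \<le> 0} = 0" and Y0: "Q.prob {w\<in>space Q. Y t w \<le> 0} = 0" if t: "t \<in> T" for t
  proof -
    obtain c where c: "0 < c" "\<And>y. 0 < y \<Longrightarrow> P.prob {w\<in>space P. \<forall>t\<in>{t}. X t w \<le> y * 1} = exp (- c * y powr (- \<alpha>))"
      using frechet_process_joint_cdf[where x = "\<lambda>_. 1" and F = "{t}", OF X \<alpha>] t by auto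
    have small: "P.prob {w\<in>space P. X t w \<le> 0} \<le> exp (- c * (1 / real (Suc n)) powr (- \<alpha>))"
      "Q.prob {w\<in>space Q. Y t w \<le> 0} \<le> exp (- c * (1 / real (Suc n)) powr (- \<alpha>))" for n
    proof -
      define y where "y = 1 / real (Suc n)"
      have y: "0 < y" by (simp add: y_def)
      have "P.prob {w\<in>space P. X t w \<le> 0} \<le> P.prob {w\<in>space P. X t w \<le> y}"
        using y X_meas[OF t] by (intro P.finite_measure_mono borel_measurable_le) auto
      then show "P.prob {w\<in>space P. X t w \<le> 0} \<le> exp (- c * (1 / real (Suc n)) powr (- \<alpha>))"
        using c(2)[OF y] by (simp add: y_def)
      have "Q.prob {w\<in>space Q. Y t w \<le> 0} \<le> Q.prob {w\<in>space Q. Y t w \<le> y}"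
        using y Y[OF t] by (intro Q.finite_measure_mono borel_measurable_le) auto
      then show "Q.prob {w\<in>space Q. Y t w \<le> 0} \<le> exp (- c * (1 / real (Suc n)) powr (- \<alpha>))"
        using c(2)[OF y] eq[of "{t}" "\<lambda>_. y"] t y by (simp add: y_def)
    qed
    have lim: "(\<lambda>n. exp (- c * (1 / real (Suc n)) powr (- \<alpha>))) \<longlonglongrightarrow> 0"
      using c(1) \<alpha> by real_asymp
    show "P.prob {w\<in>space P. X t w \<le> 0} = 0" "Q.prob {w\<in>space Q. Y t w \<le> 0} = 0"
      using tendsto_lowerbound[OF lim always_eventually[OF allI[OF small(1)]]]
        tendsto_lowerbound[OF lim always_eventually[OF allI[OF small(2)]]]
      by (simp_all add: measure_le_0_iff)
  qed
  fix F assume F: "finite F \<and> F \<subseteq> T"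
  show "distr P (\<Pi>\<^sub>M t\<in>F. borel) (\<lambda>w. \<lambda>t\<in>F. X t w) = distr Q (\<Pi>\<^sub>M t\<in>F. borel) (\<lambda>w. \<lambda>t\<in>F. Y t w)"
  proof (rule distr_eq_if_cdf_eq)
    fix x :: "'t \<Rightarrow> real"
    show "P.prob {w\<in>space P. \<forall>t\<in>F. X t w \<le> x t} = Q.prob {w\<in>space Q. \<forall>t\<in>F. Y t w \<le> x t}"
    proof (cases "\<forall>t\<in>F. 0 < x t")
      case True
      show ?thesis
      proof (cases "F = {}")
        case True
        then show ?thesis by (simp add: P.prob_space Q.prob_space)
      next
        case False
        then show ?thesis using F True by (intro eq) auto
      qed
    next
      case False
      then obtain t where t: "t \<in> F" "x t \<le> 0" by force
      then have "t \<in> T" using F by auto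
      have "P.prob {w\<in>space P. \<forall>t\<in>F. X t w \<le> x t} \<le> P.prob {w\<in>space P. X t w \<le> 0}"
        using t X_meas[OF \<open>t \<in> T\<close>] by (intro P.finite_measure_mono borel_measurable_le) force+
      moreover have "Q.prob {w\<in>space Q. \<forall>t\<in>F. Y t w \<le> x t} \<le> Q.prob {w\<in>space Q. Y t w \<le> 0}"
        using t Y[OF \<open>t \<in> T\<close>] by (intro Q.finite_measure_mono borel_measurable_le) force+
      ultimately show ?thesis using X0[OF \<open>t \<in> T\<close>] Y0[OF \<open>t \<in> T\<close>] by (simp add: measure_le_0_iff)
    qed
  qed (use F X_meas Y P.prob_space_axioms Q.prob_space_axioms in auto)
qed

lemma max_linear_subset:
  assumes "T0 \<subseteq> T" "\<And>t. t \<in> T0 \<Longrightarrow> f0 t = f t"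
  shows "max_linear T0 f0 \<subseteq> max_linear T f"
proof
  fix h assume "h \<in> max_linear T0 f0"
  then obtain a F where h: "h = (\<lambda>s. Max (insert 0 ((\<lambda>t. a t * f0 t s) ` F)))"
    and F: "finite F" "F \<subseteq> T0" "\<forall>t\<in>F. 0 < a t" by (auto simp: max_linear_def)
  have "(\<lambda>t. a t * f0 t s) ` F = (\<lambda>t. a t * f t s) ` F" for s
    using F assms(2) by (intro image_cong) auto
  then have "h = (\<lambda>s. Max (insert 0 ((\<lambda>t. a t * f t s) ` F)))" by (simp add: h)
  then show "h \<in> max_linear T f" using F assms(1) unfolding max_linear_def by blast
qed

lemma ratio_sigma_subset:
  assumes "T0 \<subseteq> T" "\<And>t. t \<in> T0 \<Longrightarrow> f0 t = f t"
  shows "ratio_sigma \<mu> T0 f0 \<subseteq> ratio_sigma \<mu> T f"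
  unfolding ratio_sigma_def
proof (intro sigma_sets_mono' subsetI)
  fix A
  assume "A \<in> {(\<lambda>s. ennreal (f0 t s) / ennreal (f0 t' s)) -` B \<inter> space \<mu> | t t' B.
      t \<in> T0 \<and> t' \<in> T0 \<and> B \<in> sets (borel :: ennreal measure)}"
  then obtain t t' and B :: "ennreal set"
    where A: "A = (\<lambda>s. ennreal (f0 t s) / ennreal (f0 t' s)) -` B \<inter> space \<mu>"
      and t: "t \<in> T0" "t' \<in> T0" "B \<in> sets borel" by blast
  have "A = (\<lambda>s. ennreal (f t s) / ennreal (f t' s)) -` B \<inter> space \<mu>"
    using A t assms(2) by simp
  then show "A \<in> {(\<lambda>s. ennreal (f t s) / ennreal (f t' s)) -` B \<inter> space \<mu> | t t' B.
      t \<in> T \<and> t' \<in> T \<and> B \<in> sets (borel :: ennreal measure)}"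
    using t assms(1) by blast
qed

theorem theorem4p1:
  fixes \<alpha> :: real
    and P :: "'w measure"
    and T :: "'t set"
    and X :: "'t \<Rightarrow> 'w \<Rightarrow> real"
  assumes "\<alpha> > 0"
    and "frechet_process P \<alpha> T X"
    and "condition_S P T X"
  shows "\<exists>I\<in>{0, 1::nat}. \<exists>N::enat. \<exists>f :: 't \<Rightarrow> real \<Rightarrow> real.
     minimal \<alpha> (std_measure I N) T f \<and>
     (\<exists>(Q :: (nat \<Rightarrow> real) measure) M.
        spectral_representation \<alpha> (std_measure I N) T f Q M P X)"
proof -
  note \<alpha> = assms(1) and X = assms(2)
  obtain T0 where T0: "T0 \<subseteq> T" "countable T0"
    and dense: "\<And>t. t \<in> T \<Longrightarrow> \<exists>u::nat \<Rightarrow> 't. (\<forall>n. u n \<in> T0) \<and> tendsto_in_prob P (\<lambda>n. X (u n)) (X t)"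
    using assms(3) unfolding condition_S_def by blast
  obtain I N and q0 :: "'t \<Rightarrow> real \<Rightarrow> real" and w where I: "I \<in> {0, 1::nat}"
    and q0: "represents_cdfs \<alpha> (std_measure I N) T0 q0 P X"
    and w: "integrable (std_measure I N) w" "\<And>s. 0 < w s"
    and approx: "\<And>\<epsilon>. 0 < \<epsilon> \<Longrightarrow> \<exists>h\<in>max_linear T0 (\<lambda>t s. q0 t s powr (1 / \<alpha>)). (\<integral>s. \<bar>h s powr \<alpha> - w s\<bar> \<partial>std_measure I N) < \<epsilon>"
    and gen: "\<And>B. B \<in> sets (std_measure I N) \<Longrightarrow>
      \<exists>A\<in>ratio_sigma (std_measure I N) T0 (\<lambda>t s. q0 t s powr (1 / \<alpha>)). emeasure (std_measure I N) ((A - B) \<union> (B - A)) = 0"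
    using that by (rule standardized_spectral_functions[OF X \<alpha> T0])
  obtain q where q: "represents_cdfs \<alpha> (std_measure I N) T q P X" and q_q0: "\<And>t. t \<in> T0 \<Longrightarrow> q t = q0 t"
  proof (rule represents_cdfs_extend[OF X \<alpha> T0(1) dense q0])
    fix q' assume "represents_cdfs \<alpha> (std_measure I N) T q' P X" "\<And>t. t \<in> T0 \<Longrightarrow> q' t = q0 t"
    then show thesis by (rule that)
  qed
  define \<mu> where "\<mu> = std_measure I N"
  define f where "f t s = q t s powr (1 / \<alpha>)" for t s
  have q_int: "integrable \<mu> (q t)" and q_nonneg: "0 \<le> q t s" if "t \<in> T" for t s
    using q that by (auto simp: represents_cdfs_def \<mu>_def)
  have f_powr: "f t s powr \<alpha> = q t s" if "t \<in> T" for t s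
    using q_nonneg[OF that] \<alpha> by (simp add: f_def powr_powr)
  have f_Lplus: "f t \<in> Lplus \<alpha> \<mu>" if "t \<in> T" for t
  proof -
    have [measurable]: "q t \<in> borel_measurable \<mu>" using q_int[OF that] by auto
    have "f t \<in> borel_measurable \<mu>" unfolding f_def[abs_def] by measurable
    then show ?thesis using q_int[OF that] f_powr[OF that] by (auto simp: Lplus_def f_def)
  qed
  have f_f0: "(\<lambda>s. q0 t s powr (1 / \<alpha>)) = f t" if "t \<in> T0" for t
    using q_q0[OF that] by (simp add: f_def fun_eq_iff)

  have "is_supp \<alpha> \<mu> T f (space \<mu>)"
    unfolding is_supp_def
  proof (intro bexI conjI ballI)
    \<comment> \<open>A positive element of the closure: the limit of maxima of scaled spectral functions.\<close>
    define f0 where "f0 s = w s powr (1 / \<alpha>)" for s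
    have f0_powr: "f0 s powr \<alpha> = w s" for s
      using w(2)[of s] \<alpha> by (simp add: f0_def powr_powr)
    have f0_nonneg: "0 \<le> f0 s" for s by (simp add: f0_def)
    have f0_nz: "f0 s \<noteq> 0" for s using w(2)[of s] by (simp add: f0_def)
    show "space \<mu> = {s \<in> space \<mu>. f0 s \<noteq> 0}" using f0_nz by auto
    show "emeasure \<mu> ({s \<in> space \<mu>. g s \<noteq> 0} - {s \<in> space \<mu>. f0 s \<noteq> 0}) = 0" for g
    proof -
      have "{s \<in> space \<mu>. g s \<noteq> 0} - {s \<in> space \<mu>. f0 s \<noteq> 0} = {}" using f0_nz by auto
      then show ?thesis by (simp only: emeasure_empty)
    qed
    have [measurable]: "w \<in> borel_measurable \<mu>" using w(1) by (auto simp: \<mu>_def)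
    have "f0 \<in> borel_measurable \<mu>" unfolding f0_def[abs_def] by measurable
    then have "f0 \<in> Lplus \<alpha> \<mu>" using w(1) f0_nonneg by (auto simp: Lplus_def f0_powr \<mu>_def)
    moreover have "\<exists>h\<in>max_linear T f. rho \<alpha> \<mu> h f0 < \<epsilon>" if "0 < \<epsilon>" for \<epsilon>
      using approx[OF that] max_linear_subset[OF T0(1), of "\<lambda>t s. q0 t s powr (1 / \<alpha>)" f] f_f0
      unfolding rho_def f0_powr \<mu>_def by blast
    ultimately show "f0 \<in> max_linear_closure \<alpha> \<mu> T f" by (simp add: max_linear_closure_def)
  qed
  moreover have "\<exists>A\<in>ratio_sigma \<mu> T f. emeasure \<mu> ((A - B) \<union> (B - A)) = 0" if "B \<in> sets \<mu>" for B
    using gen[of B] that ratio_sigma_subset[OF T0(1), of "\<lambda>t s. q0 t s powr (1 / \<alpha>)" f \<mu>] f_f0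
    unfolding \<mu>_def by blast
  ultimately have minimal: "minimal \<alpha> \<mu> T f"
    unfolding minimal_def by (intro conjI exI[of _ "space \<mu>"]) auto

  obtain Q :: "(nat \<Rightarrow> real) measure" and L R where "frechet_points Q \<alpha> (std_measure I N) L R"
    by (rule frechet_points_std_measure[OF \<alpha>])
  then interpret frechet_points Q \<alpha> \<mu> L R by (simp add: \<mu>_def)
  have "same_fdd T P X Q (\<lambda>t. extremal_value (f t))"
  proof (rule same_fdd_if_positive_cdfs_eq[OF X \<alpha> prob_space_axioms])
    show "extremal_value (f t) \<in> borel_measurable Q" if "t \<in> T" for t
      using f_Lplus[OF that] by (rule extremal_value_measurable)
    fix F and x :: "'t \<Rightarrow> real" assume F: "finite F" "F \<noteq> {}" "F \<subseteq> T" "\<And>t. t \<in> F \<Longrightarrow> 0 < x t"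
    have "(f t s / x t) powr \<alpha> = q t s / x t powr \<alpha>" if "t \<in> F" for t s
      using f_powr[of t s] F that by (auto simp: powr_divide)
    then have "(\<lambda>t. (f t s / x t) powr \<alpha>) ` F = (\<lambda>t. q t s / x t powr \<alpha>) ` F" for s
      by (intro image_cong) auto
    moreover have "f t \<in> Lplus \<alpha> \<mu>" if "t \<in> F" for t using F that by (intro f_Lplus) auto
    ultimately have "prob {v\<in>space Q. \<forall>t\<in>F. extremal_value (f t) v \<le> x t} = exp (- (\<integral>s. (MAX t\<in>F. q t s / x t powr \<alpha>) \<partial>\<mu>))"
      using prob_real_extremal_le[of F f x] F by (simp add: extremal_value_def)
    also have "\<dots> = measure P {w\<in>space P. \<forall>t\<in>F. X t w \<le> x t}"
      using represents_cdfs_joint[OF q F] by (simp add: \<mu>_def)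
    finally show "measure P {w\<in>space P. \<forall>t\<in>F. X t w \<le> x t} = prob {v\<in>space Q. \<forall>t\<in>F. extremal_value (f t) v \<le> x t}" ..
  qed
  then have "spectral_representation \<alpha> \<mu> T f Q sup_measure P X"
    unfolding spectral_representation_def
    by (intro conjI ballI f_Lplus sup_measure_frechet exI[of _ "\<lambda>t. extremal_value (f t)"]
        has_extremal_integral_extremal_value)
  with minimal I show ?thesis unfolding \<mu>_def by blast
qed

end
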